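(* Let $1\le r\le\infty$, let $\mathcal{F}$ be a $C^r$ foliation on a manifold $M$, and let $\phi\in C^r(\mathcal{F},\mathcal{F})$ be a foliation map. If $\mathrm{Graph}(\phi)=(\mathrm{id}_M,\phi):\mathcal{F}\to\mathcal{F}\times\mathcal{F}$ is ls-transverse to the diagonal $\Delta_M\subset M\times M$, then the fixed point set $\mathrm{Fix}(\phi)$ is a regular submanifold of $M$, and $\mathrm{Fix}_0(\phi)$ is the set of points where $\mathrm{Fix}(\phi)$ is transverse to $\mathcal{F}$.
   Context: $C^r(\mathcal{F},\mathcal{F})$ is the set of $C^r$ foliation maps, i.e. $C^r$ maps $M\to M$ sending each leaf of $\mathcal{F}$ into a leaf of $\mathcal{F}$. $T\mathcal{F}\subset TM$ is the tangent bundle to the leaves. $\mathrm{Fix}(\phi)$ is the set of fixed points of $\phi$; a fixed point $x$ is leafwise simple if $\mathrm{id}-\phi_*:T_x\mathcal{F}\to T_x\mathcal{F}$ is an isomorphism, and $\mathrm{Fix}_0(\phi)$ is the set of leafwise simple fixed points. Regular submanifold means embedded submanifold. A submanifold $N\subset M$ is transverse to $\mathcal{F}$ at $x\in N$ if $T_xN+T_x\mathcal{F}=T_xM$. $\mathcal{F}\times\mathcal{F}$ is the product foliation of $M\times M$, with leaves $L_1\times L_2$. For $V$ open, the restriction of a foliation to $V$ has as leaves the connected components (in the leaf topology) of the intersections of the leaves with $V$. A local saturation of $\Delta_M$ is the saturation of $\Delta_M$ (union of leaves meeting it) with respect to $(\mathcal{F}\times\mathcal{F})|_V$ for some open neighbourhood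 $V$ of $\Delta_M$ in $M\times M$. Let $(\mathcal{F}\times\mathcal{F})|_{\Delta_M}$ be the foliation of $\Delta_M$ with leaves $\Delta_L$, for $L$ a leaf of $\mathcal{F}$. A local saturation $S$ is good if it is a regular $C^r$ submanifold, $(\mathcal{F}\times\mathcal{F})|_S$ is a $C^r$ foliation whose leaves are open subsets of leaves of $\mathcal{F}\times\mathcal{F}$, and for each $z\in\Delta_M$ the inclusion induces an isomorphism $T_z(\mathcal{F}\times\mathcal{F})/T_z((\mathcal{F}\times\mathcal{F})|_{\Delta_M})\cong T_zS/T_z\Delta_M$. A $C^r$ foliation map $\Phi:\mathcal{F}\to\mathcal{F}\times\mathcal{F}$ is ls-transverse to $\Delta_M$ if there are an open neighbourhood $U$ of $\Phi^{-1}(\Delta_M)$ in $M$ and a good local saturation $S$ of $\Delta_M$ with $\Phi(U)\subset S$ and $\Phi:U\to S$ transverse to $\Delta_M$. *)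

theory Defs
  imports "HOL-Analysis.Analysis" "HOL-Library.Set_Algebras" "HOL-Library.Function_Algebras"
begin

section \<open>Maps of class $C^r$\<close>

text \<open>
  Manifolds are modelled on a linear subspace \<open>E\<close> of a Euclidean space, so that dimension 0 is
  allowed and so that submanifolds are manifolds in the same sense. In \<open>Ck_on k E f X\<close> the set
  \<open>X\<close> is meant to be relatively open in \<open>E\<close>; the derivative \<open>f' x\<close> is then determined by
  \<open>f\<close> on \<open>E\<close>, and only its values on \<open>E\<close> are used.
\<close>

primrec Ck_on ::
  "nat \<Rightarrow> 'e::euclidean_space set \<Rightarrow> ('e \<Rightarrow> 'f::real_normed_vector) \<Rightarrow> 'e set \<Rightarrow> bool" where
  "Ck_on 0 E f X \<longleftrightarrow> continuous_on X f"
| "Ck_on (Suc k) E f X \<longleftrightarrow>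
     (\<exists>f'. (\<forall>x\<in>X. (f has_derivative f' x) (at x within X)) \<and> (\<forall>v\<in>E. Ck_on k E (\<lambda>x. f' x v) X))"

definition C_on ::
  "enat \<Rightarrow> 'e::euclidean_space set \<Rightarrow> ('e \<Rightarrow> 'f::real_normed_vector) \<Rightarrow> 'e set \<Rightarrow> bool" where
  "C_on r E f X \<longleftrightarrow> (\<forall>k. enat k \<le> r \<longrightarrow> Ck_on k E f X)"

section \<open>Manifolds\<close>

text \<open>
  The underlying set is a subset of an ambient Hausdorff, second countable space and carries the
  subspace topology. The coordinate map of a chart is only relevant on the domain of the chart.
\<close>

type_synonym ('a, 'e) chart = "'a set \<times> ('a \<Rightarrow> 'e)"

record ('a, 'e) mfd =
  points :: "'a set"
  model :: "'e set"
  atlas :: "('a, 'e) chart set"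

definition is_chart ::
  "('a::{t2_space,second_countable_topology}, 'e::euclidean_space) mfd \<Rightarrow> ('a, 'e) chart \<Rightarrow> bool" where
  "is_chart M = (\<lambda>(U, \<psi>).
     openin (top_of_set (points M)) U \<and> openin (top_of_set (model M)) (\<psi> ` U) \<and>
     homeomorphism U (\<psi> ` U) \<psi> (inv_into U \<psi>))"

definition C_transition ::
  "enat \<Rightarrow> ('a, 'e::euclidean_space) mfd \<Rightarrow> ('a, 'e) chart \<Rightarrow> ('a, 'e) chart \<Rightarrow> bool" where
  "C_transition r M = (\<lambda>(U, \<psi>) (V, \<xi>). C_on r (model M) (\<xi> \<circ> inv_into U \<psi>) (\<psi> ` (U \<inter> V)))"

definition C_manifold ::
  "enat \<Rightarrow> ('a::{t2_space,second_countable_topology}, 'e::euclidean_space) mfd \<Rightarrow> bool" where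
  "C_manifold r M \<longleftrightarrow>
     subspace (model M) \<and> \<Union> (fst ` atlas M) = points M \<and>
     (\<forall>c\<in>atlas M. is_chart M c) \<and> (\<forall>c\<in>atlas M. \<forall>d\<in>atlas M. C_transition r M c d)"

text \<open>The maximal \<open>C^r\<close> atlas.\<close>

definition C_charts ::
  "enat \<Rightarrow> ('a::{t2_space,second_countable_topology}, 'e::euclidean_space) mfd \<Rightarrow> ('a, 'e) chart set" where
  "C_charts r M =
     {c. is_chart M c \<and> (\<forall>d\<in>atlas M. C_transition r M c d \<and> C_transition r M d c)}"

definition C_map ::
  "enat \<Rightarrow> ('a::{t2_space,second_countable_topology}, 'e::euclidean_space) mfd \<Rightarrow>
   ('b::{t2_space,second_countable_topology}, 'f::euclidean_space) mfd \<Rightarrow> ('a \<Rightarrow> 'b) \<Rightarrow> bool" where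
  "C_map r M N f \<longleftrightarrow>
     f ` points M \<subseteq> points N \<and> continuous_on (points M) f \<and>
     (\<forall>(U, \<psi>)\<in>atlas M. \<forall>(V, \<xi>)\<in>atlas N.
        C_on r (model M) (\<xi> \<circ> f \<circ> inv_into U \<psi>) (\<psi> ` (U \<inter> f -` V)))"

definition prod_charts ::
  "('a, 'e) chart set \<Rightarrow> ('b, 'f) chart set \<Rightarrow> ('a \<times> 'b, 'e \<times> 'f) chart set" where
  "prod_charts A B = {(U \<times> V, map_prod \<psi> \<xi>) | U \<psi> V \<xi>. (U, \<psi>) \<in> A \<and> (V, \<xi>) \<in> B}"

definition prod_mfd :: "('a, 'e) mfd \<Rightarrow> ('b, 'f) mfd \<Rightarrow> ('a \<times> 'b, 'e \<times> 'f) mfd" where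
  "prod_mfd M N =
     \<lparr>points = points M \<times> points N, model = model M \<times> model N, atlas = prod_charts (atlas M) (atlas N)\<rparr>"

section \<open>Regular submanifolds\<close>

definition slice_charts ::
  "enat \<Rightarrow> ('a::{t2_space,second_countable_topology}, 'e::euclidean_space) mfd \<Rightarrow> 'e set \<Rightarrow> 'a set \<Rightarrow>
   ('a, 'e) chart set" where
  "slice_charts r M K N = {(U, \<psi>) \<in> C_charts r M. \<psi> ` (U \<inter> N) = \<psi> ` U \<inter> K}"

text \<open>The subspace \<open>K\<close> is the model of \<open>N\<close>; its dimension is that of \<open>N\<close>.\<close>

definition is_submanifold ::
  "enat \<Rightarrow> ('a::{t2_space,second_countable_topology}, 'e::euclidean_space) mfd \<Rightarrow> 'e set \<Rightarrow> 'a set \<Rightarrow> bool"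
  where
  "is_submanifold r M K N \<longleftrightarrow>
     subspace K \<and> K \<subseteq> model M \<and> N \<subseteq> points M \<and> N \<subseteq> \<Union> (fst ` slice_charts r M K N)"

definition regular_submanifold ::
  "enat \<Rightarrow> ('a::{t2_space,second_countable_topology}, 'e::euclidean_space) mfd \<Rightarrow> 'a set \<Rightarrow> bool" where
  "regular_submanifold r M N \<longleftrightarrow> (\<exists>K. is_submanifold r M K N)"

definition submfd ::
  "enat \<Rightarrow> ('a::{t2_space,second_countable_topology}, 'e::euclidean_space) mfd \<Rightarrow> 'e set \<Rightarrow> 'a set \<Rightarrow>
   ('a, 'e) mfd" where
  "submfd r M K N =
     \<lparr>points = N, model = K, atlas = {(U \<inter> N, \<psi>) | U \<psi>. (U, \<psi>) \<in> slice_charts r M K N}\<rparr>"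

section \<open>Tangent spaces\<close>

text \<open>
  A tangent vector at \<open>x\<close> is the family of its coordinate vectors in all charts of the atlas around
  \<open>x\<close> (extended by 0 to all other charts), so the vector space operations are pointwise. It arises
  as the velocity of a curve through \<open>x\<close>. If \<open>T\<close> is the topology of a manifold immersed in \<open>M\<close>,
  \<open>tangent_space M T x\<close> consists of the velocities at \<open>x\<close> of curves in that immersed manifold,
  that is, the tangent space of the latter regarded as a subspace of the tangent space of \<open>M\<close>.
  The subspace topology of \<open>N\<close> gives the tangent space of a regular submanifold \<open>N\<close>, and the leaf
  topology gives the tangent space of the leaf through \<open>x\<close>. In the latter case convergence in
  \<open>T\<close> keeps the curve in one plaque near time 0.
\<close>

definition velocity :: "('a, 'e::real_normed_vector) mfd \<Rightarrow> 'a \<Rightarrow> (real \<Rightarrow> 'a) \<Rightarrow> ('a, 'e) chart \<Rightarrow> 'e" where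
  "velocity M x \<gamma> = (\<lambda>(U, \<psi>).
     if (U, \<psi>) \<in> atlas M \<and> x \<in> U then vector_derivative (\<psi> \<circ> \<gamma>) (at 0) else 0)"

definition curve_at ::
  "('a, 'e::real_normed_vector) mfd \<Rightarrow> 'a topology \<Rightarrow> 'a \<Rightarrow> (real \<Rightarrow> 'a) \<Rightarrow> bool" where
  "curve_at M T x \<gamma> \<longleftrightarrow>
     \<gamma> 0 = x \<and> limitin T \<gamma> x (at 0) \<and>
     (\<forall>(U, \<psi>)\<in>atlas M. x \<in> U \<longrightarrow> (\<psi> \<circ> \<gamma>) differentiable at 0)"

definition tangent_space ::
  "('a, 'e::real_normed_vector) mfd \<Rightarrow> 'a topology \<Rightarrow> 'a \<Rightarrow> (('a, 'e) chart \<Rightarrow> 'e) set" where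
  "tangent_space M T x = velocity M x ` {\<gamma>. curve_at M T x \<gamma>}"

text \<open>For a \<open>C^1\<close> map the velocity of \<open>f \<circ> \<gamma>\<close> depends only on that of \<open>\<gamma>\<close>.\<close>

definition tangent_map ::
  "('a::topological_space, 'e::real_normed_vector) mfd \<Rightarrow> ('b, 'f::real_normed_vector) mfd \<Rightarrow>
   ('a \<Rightarrow> 'b) \<Rightarrow> 'a \<Rightarrow> (('a, 'e) chart \<Rightarrow> 'e) \<Rightarrow> ('b, 'f) chart \<Rightarrow> 'f" where
  "tangent_map M N f x v =
     velocity N (f x) (f \<circ> (SOME \<gamma>. curve_at M (top_of_set (points M)) x \<gamma> \<and> velocity M x \<gamma> = v))"

text \<open>For subspaces \<open>W \<subseteq> V\<close> and \<open>W' \<subseteq> V'\<close>: the inclusion induces an isomorphism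
  \<open>V/W \<cong> V'/W'\<close>. The induced map is linear whenever it is well defined.\<close>

definition cosets_of :: "'v::plus set \<Rightarrow> 'v set \<Rightarrow> 'v set set" where
  "cosets_of V W = (\<lambda>v. v +o W) ` V"

definition inclusion_induces_iso ::
  "'v::plus set \<Rightarrow> 'v set \<Rightarrow> 'v set \<Rightarrow> 'v set \<Rightarrow> bool" where
  "inclusion_induces_iso V W V' W' \<longleftrightarrow>
     V \<subseteq> V' \<and> W \<subseteq> W' \<and>
     (\<exists>h. (\<forall>v\<in>V. h (v +o W) = v +o W') \<and> bij_betw h (cosets_of V W) (cosets_of V' W'))"

section \<open>Foliations\<close>

text \<open>
  A foliation is given by foliated charts, in which the plaques are the slices parallel to the
  subspace \<open>leaf_model\<close> of the model of the manifold. Images of foliated charts need not be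
  rectangular, so slices may be disconnected; this does not affect the leaf topology.
\<close>

record ('a, 'e) foliation =
  leaf_model :: "'e set"
  fol_charts :: "('a, 'e) chart set"

definition C_foliation ::
  "enat \<Rightarrow> ('a::{t2_space,second_countable_topology}, 'e::euclidean_space) mfd \<Rightarrow> ('a, 'e) foliation \<Rightarrow> bool"
  where
  "C_foliation r M F \<longleftrightarrow>
     subspace (leaf_model F) \<and> leaf_model F \<subseteq> model M \<and>
     fol_charts F \<subseteq> C_charts r M \<and> \<Union> (fst ` fol_charts F) = points M \<and>
     (\<forall>(U, \<psi>)\<in>fol_charts F. \<forall>(V, \<xi>)\<in>fol_charts F. \<forall>x\<in>U \<inter> V.
        \<exists>W. open W \<and> x \<in> W \<and>
          (\<forall>y\<in>U \<inter> V \<inter> W. \<forall>z\<in>U \<inter> V \<inter> W. \<psi> y - \<psi> z \<in> leaf_model F \<longrightarrow> \<xi> y - \<xi> z \<in> leaf_model F))"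

definition leaf_topology ::
  "('a::topological_space, 'e::real_normed_vector) foliation \<Rightarrow> 'a topology" where
  "leaf_topology F = topology_generated_by
     {{x \<in> U \<inter> W. \<psi> x - \<psi> y \<in> leaf_model F} | U \<psi> W y. (U, \<psi>) \<in> fol_charts F \<and> open W \<and> y \<in> U}"

definition leaves :: "('a::topological_space, 'e::real_normed_vector) foliation \<Rightarrow> 'a set set" where
  "leaves F = connected_components_of (leaf_topology F)"

text \<open>The leaves of the restriction to \<open>V\<close>.\<close>

definition restricted_leaves ::
  "('a::topological_space, 'e::real_normed_vector) foliation \<Rightarrow> 'a set \<Rightarrow> 'a set set" where
  "restricted_leaves F V =
     (\<Union>L\<in>leaves F. connected_components_of (subtopology (leaf_topology F) (L \<inter> V)))"

definition saturation :: "'a set set \<Rightarrow> 'a set \<Rightarrow> 'a set" where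
  "saturation \<L> X = \<Union> {L \<in> \<L>. L \<inter> X \<noteq> {}}"

definition foliation_map ::
  "enat \<Rightarrow> ('a::{t2_space,second_countable_topology}, 'e::euclidean_space) mfd \<Rightarrow> ('a, 'e) foliation \<Rightarrow>
   ('b::{t2_space,second_countable_topology}, 'f::euclidean_space) mfd \<Rightarrow> ('b, 'f) foliation \<Rightarrow>
   ('a \<Rightarrow> 'b) \<Rightarrow> bool" where
  "foliation_map r M F N G f \<longleftrightarrow> C_map r M N f \<and> (\<forall>L\<in>leaves F. \<exists>L'\<in>leaves G. f ` L \<subseteq> L')"

definition prod_foliation ::
  "('a, 'e) foliation \<Rightarrow> ('b, 'f) foliation \<Rightarrow> ('a \<times> 'b, 'e \<times> 'f) foliation" where
  "prod_foliation F G =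
     \<lparr>leaf_model = leaf_model F \<times> leaf_model G, fol_charts = prod_charts (fol_charts F) (fol_charts G)\<rparr>"

text \<open>The foliation of the diagonal with leaves \<open>Id_on L\<close>, for \<open>L\<close> a leaf of \<open>F\<close>.\<close>

definition diag_foliation :: "('a, 'e) foliation \<Rightarrow> ('a \<times> 'a, 'e) foliation" where
  "diag_foliation F =
     \<lparr>leaf_model = leaf_model F, fol_charts = {(Id_on U, \<psi> \<circ> fst) | U \<psi>. (U, \<psi>) \<in> fol_charts F}\<rparr>"

abbreviation leaf_tangent_space ::
  "('a::topological_space, 'e::real_normed_vector) mfd \<Rightarrow> ('a, 'e) foliation \<Rightarrow> 'a \<Rightarrow>
   (('a, 'e) chart \<Rightarrow> 'e) set" where
  "leaf_tangent_space M F x \<equiv> tangent_space M (leaf_topology F) x"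

section \<open>Local saturations of the diagonal and ls-transversality\<close>

definition local_saturation ::
  "('a::{t2_space,second_countable_topology}, 'e::euclidean_space) mfd \<Rightarrow> ('a, 'e) foliation \<Rightarrow>
   ('a \<times> 'a) set \<Rightarrow> bool" where
  "local_saturation M F S \<longleftrightarrow>
     (\<exists>V. openin (top_of_set (points M \<times> points M)) V \<and> Id_on (points M) \<subseteq> V \<and>
          S = saturation (restricted_leaves (prod_foliation F F) V) (Id_on (points M)))"

text \<open>
  Since \<open>S\<close> is a union of leaves of the restriction of the product foliation \<open>FF\<close> to some \<open>V\<close>, the
  leaves of that restriction which lie in \<open>S\<close> are exactly the members of \<open>restricted_leaves FF S\<close>.
\<close>

definition good_local_saturation ::
  "enat \<Rightarrow> ('a::{t2_space,second_countable_topology}, 'e::euclidean_space) mfd \<Rightarrow> ('a, 'e) foliation \<Rightarrow>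
   ('a \<times> 'a) set \<Rightarrow> bool" where
  "good_local_saturation r M F S \<longleftrightarrow>
     local_saturation M F S \<and>
     (let MM = prod_mfd M M; FF = prod_foliation F F; \<Delta> = Id_on (points M) in
       (\<exists>K. is_submanifold r MM K S \<and>
            (\<exists>G. C_foliation r (submfd r MM K S) G \<and> leaves G = restricted_leaves FF S)) \<and>
       (\<forall>L\<in>restricted_leaves FF S. \<exists>L'\<in>leaves FF. openin (subtopology (leaf_topology FF) L') L) \<and>
       (\<forall>z\<in>\<Delta>. inclusion_induces_iso
          (leaf_tangent_space MM FF z) (tangent_space MM (leaf_topology (diag_foliation F)) z)
          (tangent_space MM (top_of_set S) z) (tangent_space MM (top_of_set \<Delta>) z)))"

text \<open>For foliation maps \<open>\<Phi>\<close> from \<open>M\<close> to the product.\<close>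

definition ls_transverse ::
  "enat \<Rightarrow> ('a::{t2_space,second_countable_topology}, 'e::euclidean_space) mfd \<Rightarrow> ('a, 'e) foliation \<Rightarrow>
   ('a \<Rightarrow> 'a \<times> 'a) \<Rightarrow> bool" where
  "ls_transverse r M F \<Phi> \<longleftrightarrow>
     (let MM = prod_mfd M M; \<Delta> = Id_on (points M) in
       \<exists>U S. openin (top_of_set (points M)) U \<and> {x \<in> points M. \<Phi> x \<in> \<Delta>} \<subseteq> U \<and>
         good_local_saturation r M F S \<and> \<Phi> ` U \<subseteq> S \<and>
         (\<forall>x\<in>U. \<Phi> x \<in> \<Delta> \<longrightarrow>
            tangent_map M MM \<Phi> x ` tangent_space M (top_of_set (points M)) x +
              tangent_space MM (top_of_set \<Delta>) (\<Phi> x) =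
            tangent_space MM (top_of_set S) (\<Phi> x)))"

section \<open>Fixed points\<close>

definition Fix :: "('a, 'e) mfd \<Rightarrow> ('a \<Rightarrow> 'a) \<Rightarrow> 'a set" where
  "Fix M \<phi> = {x \<in> points M. \<phi> x = x}"

text \<open>The linear endomorphism \<open>id - \<phi>\<^sub>*\<close> of the leaf tangent space is an isomorphism iff it is
  bijective.\<close>

definition leafwise_simple ::
  "('a::topological_space, 'e::real_normed_vector) mfd \<Rightarrow> ('a, 'e) foliation \<Rightarrow> ('a \<Rightarrow> 'a) \<Rightarrow> 'a \<Rightarrow> bool"
  where
  "leafwise_simple M F \<phi> x \<longleftrightarrow>
     bij_betw (\<lambda>v. v - tangent_map M M \<phi> x v) (leaf_tangent_space M F x) (leaf_tangent_space M F x)"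

definition Fix0 ::
  "('a::topological_space, 'e::real_normed_vector) mfd \<Rightarrow> ('a, 'e) foliation \<Rightarrow> ('a \<Rightarrow> 'a) \<Rightarrow> 'a set" where
  "Fix0 M F \<phi> = {x \<in> Fix M \<phi>. leafwise_simple M F \<phi> x}"

definition transverse_at ::
  "('a::topological_space, 'e::real_normed_vector) mfd \<Rightarrow> ('a, 'e) foliation \<Rightarrow> 'a set \<Rightarrow> 'a \<Rightarrow> bool" where
  "transverse_at M F N x \<longleftrightarrow>
     tangent_space M (top_of_set N) x + leaf_tangent_space M F x =
     tangent_space M (top_of_set (points M)) x"

end

theory Submission
  imports Defs
begin

text \<open>
  Let \<open>x\<close> be a fixed point, let \<open>L\<close> be the tangent space of the leaf in a chart \<open>\<delta>\<close> around \<open>x\<close>, and let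
  \<open>A = \<phi>\<^sub>* - id\<close>. Since \<open>S\<close> is good, the tangent vectors \<open>(v, w)\<close> of \<open>S\<close> at \<open>(x, x)\<close> satisfy \<open>w - v \<in> L\<close>;
  as the graph of \<open>\<phi>\<close> maps into \<open>S\<close>, this gives \<open>A v \<in> L\<close> for all \<open>v\<close>, and transversality says that \<open>A\<close>
  maps onto \<open>L\<close>. If \<open>P\<close> is a linear projection onto \<open>L\<close>, a point \<open>(y, y')\<close> of \<open>S\<close> near \<open>(x, x)\<close> lies on the
  diagonal as soon as \<open>P (\<delta> y' - \<delta> y) = 0\<close>, so near \<open>x\<close> the fixed points are the zeros of
  \<open>P \<circ> (\<delta> \<circ> \<phi> - \<delta>)\<close>, which is a submersion to \<open>L\<close> at \<open>x\<close>. Hence they form a submanifold with tangent space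
  \<open>N = ker A\<close>. As \<open>A\<close> maps onto \<open>L\<close>, its restriction to \<open>L\<close> is bijective iff \<open>N\<close> and \<open>L\<close> span the tangent space.
\<close>

section \<open>Calculus of maps of class \<open>C^k\<close>\<close>

text \<open>The chart \<open>\<delta>\<close> need not be foliated, so the displacement
  \<open>\<delta> (\<phi> y) - \<delta> y\<close> points into \<open>L\<close> only to first order
  at \<open>x\<close>. Fixed points are therefore cut out by its \<open>L\<close>-component alone,
  and the first-order shape of \<open>S\<close> has to control what the projection discards.
  Goodness enters twice, in opposite directions: surjectivity of the map of quotients confines
  displacements to \<open>L\<close>, while the inclusion of tangent spaces provides the vectors
  \<open>(0, l)\<close> that transversality must reach.

  The kernel of \<open>A\<close> varies with the fixed point, but \<open>is_submanifold\<close>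
  demands slices with one common model \<open>K\<close>. The dimension of the kernel is the
  codimension of the leaves at every fixed point, so \<open>K\<close> is fixed by its dimension and
  each kernel is carried onto it by an isometry.

  Derivatives within subsets of \<open>model M\<close> are determined along \<open>model M\<close>
  only. Theorems on open subsets of the whole space are reached by precomposing with a linear
  projection and adding the complementary component.\<close>

lemma Ck_on_SucE:
  assumes "Ck_on (Suc k) E f X"
  obtains f' where "\<And>x. x \<in> X \<Longrightarrow> (f has_derivative f' x) (at x within X)"
    "\<And>v. v \<in> E \<Longrightarrow> Ck_on k E (\<lambda>x. f' x v) X"
  using assms by (metis Ck_on.simps(2))

lemma Ck_on_SucI:
  assumes "\<And>x. x \<in> X \<Longrightarrow> (f has_derivative f' x) (at x within X)"
    "\<And>v. v \<in> E \<Longrightarrow> Ck_on k E (\<lambda>x. f' x v) X"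
  shows "Ck_on (Suc k) E f X"
  using assms by (metis Ck_on.simps(2))

lemma Ck_on_cong:
  assumes "\<And>x. x \<in> X \<Longrightarrow> f x = g x" "Ck_on k E f X"
  shows "Ck_on k E g X"
proof (cases k)
  case 0
  then show ?thesis using assms continuous_on_cong by auto
next
  case (Suc j)
  then obtain f' where f': "\<And>x. x \<in> X \<Longrightarrow> (f has_derivative f' x) (at x within X)"
    "\<And>v. v \<in> E \<Longrightarrow> Ck_on j E (\<lambda>x. f' x v) X"
    using assms(2) by (metis Ck_on_SucE)
  have "(g has_derivative f' x) (at x within X)" if "x \<in> X" for x
    using f'(1)[OF that] by (rule has_derivative_transform[OF that, rotated]) (simp add: assms(1))
  then show ?thesis using f'(2) Suc by (metis Ck_on_SucI)
qed

lemma Ck_on_subset: "Ck_on k E f X \<Longrightarrow> Y \<subseteq> X \<Longrightarrow> E' \<subseteq> E \<Longrightarrow> Ck_on k E' f Y"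
proof (induction k arbitrary: f)
  case 0
  then show ?case by (auto intro: continuous_on_subset)
next
  case (Suc k)
  obtain f' where f': "\<And>x. x \<in> X \<Longrightarrow> (f has_derivative f' x) (at x within X)"
    "\<And>v. v \<in> E \<Longrightarrow> Ck_on k E (\<lambda>x. f' x v) X" using Suc.prems(1) by (rule Ck_on_SucE) blast
  show ?case
  proof (rule Ck_on_SucI)
    show "(f has_derivative f' x) (at x within Y)" if "x \<in> Y" for x
      using f'(1) Suc.prems(2) that has_derivative_subset by blast
  qed (use f'(2) Suc in auto)
qed

lemma Ck_on_SucD: "Ck_on (Suc k) E f X \<Longrightarrow> Ck_on k E f X"
proof (induction k arbitrary: f)
  case 0
  then show ?case
    by (auto intro!: differentiable_imp_continuous_on elim!: Ck_on_SucE
        simp: differentiable_on_def differentiable_def simp del: Ck_on.simps(2)) blast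
next
  case (Suc k)
  then obtain f' where "\<And>x. x \<in> X \<Longrightarrow> (f has_derivative f' x) (at x within X)"
    "\<And>v. v \<in> E \<Longrightarrow> Ck_on (Suc k) E (\<lambda>x. f' x v) X" by (metis Ck_on_SucE)
  then show ?case using Suc.IH by (metis Ck_on_SucI)
qed

lemma Ck_on_continuous: "Ck_on k E f X \<Longrightarrow> continuous_on X f"
  by (induction k) (auto dest: Ck_on_SucD simp del: Ck_on.simps(2))

lemma Ck_on_const: "Ck_on k E (\<lambda>x. c) X"
  by (induction k arbitrary: c) (auto intro!: Ck_on_SucI[of _ _ "\<lambda>_ _. 0"] simp del: Ck_on.simps(2))

lemma Ck_on_linear:
  assumes "bounded_linear l"
  shows "Ck_on k E l X"
proof (cases k)
  case 0
  then show ?thesis using assms by (simp add: linear_continuous_on)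
next
  case (Suc j)
  have "(l has_derivative l) (at x within X)" for x
    using assms by (rule bounded_linear_imp_has_derivative)
  then show ?thesis using Suc
      by (auto intro!: Ck_on_SucI[of _ _ "\<lambda>_. l"] Ck_on_const simp del: Ck_on.simps(2))
qed

lemma Ck_on_linear_compose:
  assumes "bounded_linear l"
  shows "Ck_on k E f X \<Longrightarrow> Ck_on k E (\<lambda>x. l (f x)) X"
proof (induction k arbitrary: f)
  case 0
  then show ?case using assms by (simp add: bounded_linear.continuous_on)
next
  case (Suc k)
  then obtain f' where "\<And>x. x \<in> X \<Longrightarrow> (f has_derivative f' x) (at x within X)"
    "\<And>v. v \<in> E \<Longrightarrow> Ck_on k E (\<lambda>x. f' x v) X" by (metis Ck_on_SucE)
  then show ?case using Suc.IH
    by (auto intro!: Ck_on_SucI[of _ _ "\<lambda>x v. l (f' x v)"] bounded_linear.has_derivative[OF assms]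
        simp del: Ck_on.simps(2))
qed

lemma Ck_on_add: "Ck_on k E f X \<Longrightarrow> Ck_on k E g X \<Longrightarrow> Ck_on k E (\<lambda>x. f x + g x) X"
proof (induction k arbitrary: f g)
  case 0
  then show ?case by (auto intro: continuous_intros)
next
  case (Suc k)
  obtain f' where f: "\<And>x. x \<in> X \<Longrightarrow> (f has_derivative f' x) (at x within X)"
    "\<And>v. v \<in> E \<Longrightarrow> Ck_on k E (\<lambda>x. f' x v) X" using Suc.prems by (metis Ck_on_SucE)
  obtain g' where g: "\<And>x. x \<in> X \<Longrightarrow> (g has_derivative g' x) (at x within X)"
    "\<And>v. v \<in> E \<Longrightarrow> Ck_on k E (\<lambda>x. g' x v) X" using Suc.prems by (metis Ck_on_SucE)
  show ?case using f g Suc.IH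
    by (auto intro!: Ck_on_SucI[of _ _ "\<lambda>x v. f' x v + g' x v"] has_derivative_add simp del: Ck_on.simps(2))
qed

lemma Ck_on_sum:
  assumes "\<And>i. i \<in> I \<Longrightarrow> Ck_on k E (f i) X"
  shows "Ck_on k E (\<lambda>x. \<Sum>i\<in>I. f i x) X"
  using assms
  by (induction I rule: infinite_finite_induct) (auto intro: Ck_on_const Ck_on_add)

text \<open>The product rule puts undifferentiated factors next to derivatives, so the induction
  also uses both factors one class lower, which \<open>Ck_on_SucD\<close> supplies.\<close>

lemma Ck_on_scaleR:
  fixes a :: "'e::euclidean_space \<Rightarrow> real"
  shows "Ck_on k E a X \<Longrightarrow> Ck_on k E f X \<Longrightarrow> Ck_on k E (\<lambda>x. a x *\<^sub>R f x) X"
proof (induction k arbitrary: a f)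
  case 0
  then show ?case by (auto intro: continuous_intros)
next
  case (Suc k)
  obtain f' where f: "\<And>x. x \<in> X \<Longrightarrow> (f has_derivative f' x) (at x within X)"
    "\<And>v. v \<in> E \<Longrightarrow> Ck_on k E (\<lambda>x. f' x v) X" using Suc.prems by (metis Ck_on_SucE)
  obtain a' where a: "\<And>x. x \<in> X \<Longrightarrow> (a has_derivative a' x) (at x within X)"
    "\<And>v. v \<in> E \<Longrightarrow> Ck_on k E (\<lambda>x. a' x v) X" using Suc.prems by (metis Ck_on_SucE)
  have "((\<lambda>x. a x *\<^sub>R f x) has_derivative (\<lambda>v. a x *\<^sub>R f' x v + a' x v *\<^sub>R f x)) (at x within X)"
    if "x \<in> X" for x
    using a(1)[OF that] f(1)[OF that] by (rule has_derivative_scaleR)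
  moreover have "Ck_on k E a X" "Ck_on k E f X"
    using Suc.prems by (auto dest: Ck_on_SucD simp del: Ck_on.simps(2))
  ultimately show ?case using a f Suc.IH
    by (auto intro!: Ck_on_SucI[of _ _ "\<lambda>x v. a x *\<^sub>R f' x v + a' x v *\<^sub>R f x"] Ck_on_add simp del: Ck_on.simps(2))
qed

text \<open>\<open>Ck_on\<close> controls a derivative only in fixed directions. This expansion
  writes a linear map at a varying vector as a sum of scalar functions times values at fixed basis
  vectors, to which the rules for sums and products apply.\<close>

lemma linear_expand_Basis:
  fixes l :: "'b::euclidean_space \<Rightarrow> 'c::real_vector"
  assumes "linear l"
  shows "l w = (\<Sum>b\<in>Basis. (w \<bullet> b) *\<^sub>R l b)"
proof -
  have "l w = l (\<Sum>b\<in>Basis. (w \<bullet> b) *\<^sub>R b)" by (simp add: euclidean_representation)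
  also have "\<dots> = (\<Sum>b\<in>Basis. (w \<bullet> b) *\<^sub>R l b)"
    using assms by (simp add: linear_sum linear_cmul)
  finally show ?thesis .
qed

text \<open>The chain rule yields \<open>g' (f x) (f' x v)\<close>, where the direction fed to
  \<open>g'\<close> varies with \<open>x\<close>. Expanding over \<open>Basis\<close> makes the
  induction hypothesis applicable to each \<open>g' y b\<close>; all basis vectors must be
  admissible directions, hence the model \<open>UNIV\<close> for \<open>g\<close>.\<close>

lemma Ck_on_compose_UNIV:
  fixes f :: "'e::euclidean_space \<Rightarrow> 'b::euclidean_space" and g :: "'b \<Rightarrow> 'c::real_normed_vector"
  shows "Ck_on k E f X \<Longrightarrow> Ck_on k UNIV g Y \<Longrightarrow> f ` X \<subseteq> Y \<Longrightarrow> Ck_on k E (g \<circ> f) X"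
proof (induction k arbitrary: g)
  case 0
  then show ?case
      by (auto simp del: o_apply intro!: continuous_on_compose intro: continuous_on_subset)
next
  case (Suc k)
  obtain f' where f: "\<And>x. x \<in> X \<Longrightarrow> (f has_derivative f' x) (at x within X)"
    "\<And>v. v \<in> E \<Longrightarrow> Ck_on k E (\<lambda>x. f' x v) X" using Suc.prems by (metis Ck_on_SucE)
  obtain g' where g: "\<And>x. x \<in> Y \<Longrightarrow> (g has_derivative g' x) (at x within Y)"
    "\<And>v. Ck_on k UNIV (\<lambda>x. g' x v) Y" using Ck_on_SucE[OF Suc.prems(2)] UNIV_I by metis
  have d: "(g \<circ> f has_derivative (\<lambda>v. g' (f x) (f' x v))) (at x within X)" if "x \<in> X" for x
  proof -
    have "(g has_derivative g' (f x)) (at (f x) within f ` X)"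
      using g(1)[of "f x"] that Suc.prems(3) by (auto intro: has_derivative_subset)
    from diff_chain_within[OF f(1)[OF that] this] show ?thesis by (simp add: o_def)
  qed
  have fk: "Ck_on k E f X" using Suc.prems(1) by (rule Ck_on_SucD)
  have "Ck_on k E (\<lambda>x. g' (f x) (f' x v)) X" if "v \<in> E" for v
  proof (rule Ck_on_cong)
    show "Ck_on k E (\<lambda>x. \<Sum>b\<in>Basis. (f' x v \<bullet> b) *\<^sub>R ((\<lambda>y. g' y b) \<circ> f) x) X"
      by (intro Ck_on_sum Ck_on_scaleR Ck_on_linear_compose[OF bounded_linear_inner_left]
          f(2) that Suc.IH fk g(2) Suc.prems(3))
    fix x assume "x \<in> X"
    then have "linear (g' (f x))" using g(1)[of "f x"] Suc.prems(3)
      by (auto dest: has_derivative_linear)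
    then show "(\<Sum>b\<in>Basis. (f' x v \<bullet> b) *\<^sub>R ((\<lambda>y. g' y b) \<circ> f) x) = g' (f x) (f' x v)"
      using linear_expand_Basis[of "g' (f x)" "f' x v"] by simp
  qed
  from Ck_on_SucI[OF d this] show ?case .
qed

section \<open>Passage from a model subspace to the whole space\<close>

lemma subspace_projection:
  fixes E :: "'e::euclidean_space set"
  assumes "subspace E"
  obtains p where "bounded_linear p" "\<And>x. p x \<in> E" "\<And>x. x \<in> E \<Longrightarrow> p x = x"
proof -
  obtain p where "p ` UNIV \<subseteq> E" "linear p" "\<forall>v\<in>E. p (id v) = v"
    using real_vector.linear_exists_left_inverse_on[of id E]
    by (metis assms inj_on_id linear_id linear_def real_vector.linear_id)
  then show ?thesis
    by (intro that[of p]) (auto simp: linear_conv_bounded_linear)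
qed

text \<open>Directions outside \<open>E\<close> enter the derivative of \<open>f \<circ> p\<close>
  only through \<open>p v\<close>, which lies in \<open>E\<close>. This is the bridge to results on
  open sets of the whole space.\<close>

lemma Ck_on_extend:
  fixes f :: "'e::euclidean_space \<Rightarrow> 'b::real_normed_vector"
  assumes p: "bounded_linear p" "\<And>x. p x \<in> E"
  shows "Ck_on k E f X \<Longrightarrow> Ck_on k UNIV (f \<circ> p) (p -` X)"
proof (induction k arbitrary: f)
  case 0
  have "continuous_on (p -` X) p" using p(1) by (rule linear_continuous_on)
  moreover have "continuous_on (p ` (p -` X)) f" using 0 by (auto intro: continuous_on_subset)
  ultimately show ?case using continuous_on_compose by (metis Ck_on.simps(1))
next
  case (Suc k)
  obtain f' where f: "\<And>x. x \<in> X \<Longrightarrow> (f has_derivative f' x) (at x within X)"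
    "\<And>v. v \<in> E \<Longrightarrow> Ck_on k E (\<lambda>x. f' x v) X" using Suc.prems by (metis Ck_on_SucE)
  have d: "(f \<circ> p has_derivative (\<lambda>v. f' (p x) (p v))) (at x within p -` X)" if "x \<in> p -` X" for x
  proof -
    have "(p has_derivative p) (at x within p -` X)" 
      using p(1) by (rule bounded_linear_imp_has_derivative)
    moreover have "(f has_derivative f' (p x)) (at (p x) within p ` (p -` X))"
      using f(1)[of "p x"] that by (auto intro: has_derivative_subset)
    ultimately show ?thesis using diff_chain_within by (fastforce simp: o_def)
  qed
  have c: "Ck_on k UNIV (\<lambda>x. f' (p x) (p v)) (p -` X)" for v
    using Suc.IH[OF f(2)[OF p(2)]] by (simp add: o_def)
  from Ck_on_SucI[OF d c] show ?case .
qed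

text \<open>Replacing \<open>g\<close> by \<open>g \<circ> p\<close>, with \<open>p\<close> a
  projection onto \<open>E'\<close>, does not change the composite, because \<open>f\<close> takes
  values in \<open>E'\<close>, and makes all directions admissible for the outer map.\<close>

lemma Ck_on_compose:
  fixes f :: "'e::euclidean_space \<Rightarrow> 'b::euclidean_space" and g :: "'b \<Rightarrow> 'c::real_normed_vector"
  assumes "subspace E'" "Ck_on k E f X" "Ck_on k E' g Y" "f ` X \<subseteq> Y" "Y \<subseteq> E'"
  shows "Ck_on k E (g \<circ> f) X"
proof -
  obtain p where p: "bounded_linear p" "\<And>x. p x \<in> E'" "\<And>x. x \<in> E' \<Longrightarrow> p x = x"
    using subspace_projection[OF assms(1)] by blast
  have "Ck_on k E ((g \<circ> p) \<circ> f) X"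
    using assms(2) Ck_on_extend[OF p(1,2) assms(3)]
    by (rule Ck_on_compose_UNIV) (use assms p(3) in \<open>auto simp: image_subset_iff subset_eq\<close>)
  then show ?thesis
    by (rule Ck_on_cong[rotated]) (use assms p(3) in \<open>auto simp: image_subset_iff subset_eq\<close>)
qed

section \<open>Inverse functions of class \<open>C^r\<close>\<close>

text \<open>Where the scalar factor vanishes, the increment of \<open>c\<close> is multiplied by a
  quantity of first order, so the product rule survives with \<open>c\<close> merely continuous at
  \<open>x\<close>. This allows a family of inverses to be differentiated before its
  differentiability is known.\<close>

lemma has_derivative_scaleR_vanishing:
  fixes a :: "'e::real_normed_vector \<Rightarrow> real"
  assumes a: "(a has_derivative a') (at x within S)" "a x = 0"
    and c: "(c \<longlongrightarrow> c x) (at x within S)"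
  shows "((\<lambda>y. a y *\<^sub>R c y) has_derivative (\<lambda>v. a' v *\<^sub>R c x)) (at x within S)"
proof -
  have bl: "bounded_linear a'" using a(1) by (rule has_derivative_bounded_linear)
  obtain C where C: "\<And>v. norm (a' v) \<le> norm v * C" "C > 0"
    using bounded_linear.pos_bounded[OF bl] by blast
  have 0: "((\<lambda>y. norm (a y - a x - a' (y - x)) / norm (y - x)) \<longlongrightarrow> 0) (at x within S)"
    using a(1) by (simp add: has_derivative_iff_norm)
  have "((\<lambda>y. norm (a y - a x - a' (y - x)) / norm (y - x) * norm (c y) + C * norm (c y - c x)) \<longlongrightarrow>
      0 * norm (c x) + C * norm (c x - c x)) (at x within S)"
    by (intro tendsto_intros 0 c)
  then have lim: "((\<lambda>y. norm (a y - a x - a' (y - x)) / norm (y - x) * norm (c y) + C * norm (c y - c x)) \<longlongrightarrow> 0) (at x within S)"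
    by simp
  have "norm (norm (a y *\<^sub>R c y - a x *\<^sub>R c x - a' (y - x) *\<^sub>R c x) / norm (y - x))
     \<le> norm (a y - a x - a' (y - x)) / norm (y - x) * norm (c y) + C * norm (c y - c x)" if "y \<noteq> x" for y
  proof -
    have "norm (a y *\<^sub>R c y - a x *\<^sub>R c x - a' (y - x) *\<^sub>R c x)
      = norm ((a y - a x - a' (y - x)) *\<^sub>R c y + a' (y - x) *\<^sub>R (c y - c x))"
      using a(2) by (simp add: algebra_simps)
    also have "\<dots> \<le> norm (a y - a x - a' (y - x)) * norm (c y) + norm (a' (y - x)) * norm (c y - c x)"
      by (metis norm_scaleR norm_triangle_ineq real_norm_def)
    also have "\<dots> \<le> norm (a y - a x - a' (y - x)) * norm (c y) + (norm (y - x) * C) * norm (c y - c x)"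
      by (intro add_left_mono mult_right_mono C) auto
    finally show ?thesis using that by (simp add: field_simps)
  qed
  then have "((\<lambda>y. norm (a y *\<^sub>R c y - a x *\<^sub>R c x - a' (y - x) *\<^sub>R c x) / norm (y - x)) \<longlongrightarrow>
      0) (at x within S)"
    by (intro Lim_null_comparison[OF _ lim]) (auto simp: eventually_at_filter)
  moreover have "bounded_linear (\<lambda>v. a' v *\<^sub>R c x)"
    using bl by (rule bounded_linear_scaleR_const)
  ultimately show ?thesis by (simp add: has_derivative_iff_norm)
qed

text \<open>With \<open>u = G y0 w\<close>, the difference \<open>G y w - G y0 w\<close> is
  \<open>G y\<close> applied to \<open>H y0 u - H y u\<close>, which tends to 0. So a uniform bound
  on \<open>G y\<close> for \<open>y\<close> near \<open>y0\<close> is enough.\<close>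

lemma continuous_on_inverse_family:
  fixes H G :: "'e::euclidean_space \<Rightarrow> 'a::euclidean_space \<Rightarrow> 'a"
  assumes H: "\<And>y. y \<in> Y \<Longrightarrow> linear (H y)" and G: "\<And>y. y \<in> Y \<Longrightarrow> linear (G y)"
    and HG: "\<And>y w. y \<in> Y \<Longrightarrow> H y (G y w) = w" and GH: "\<And>y w. y \<in> Y \<Longrightarrow> G y (H y w) = w"
    and cont: "\<And>w. continuous_on Y (\<lambda>y. H y w)"
  shows "continuous_on Y (\<lambda>y. G y w)"
  unfolding continuous_on_def
proof
  fix y0 assume y0: "y0 \<in> Y"
  obtain C where C: "C > 0" "\<And>u. norm (G y0 u) \<le> norm u * C"
    using G[OF y0] bounded_linear.pos_bounded linear_conv_bounded_linear by blast
  have lim: "((\<lambda>y. H y u) \<longlongrightarrow> H y0 u) (at y0 within Y)" for u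
    using cont y0 by (auto simp: continuous_on_def)
  have "((\<lambda>y. \<Sum>b\<in>Basis. norm (H y0 b - H y b)) \<longlongrightarrow>
      (\<Sum>b\<in>Basis. norm (H y0 b - H y0 b))) (at y0 within Y)"
    by (intro tendsto_intros lim)
  then have "((\<lambda>y. \<Sum>b\<in>Basis. norm (H y0 b - H y b)) \<longlongrightarrow> 0) (at y0 within Y)" by simp
  \<comment> \<open>Since \<open>C\<close> bounds \<open>G y0\<close>, a perturbation of
    \<open>H y0\<close> below \<open>1 / (2 * C)\<close> costs at most half of
    \<open>norm (G y z)\<close>. Absorbing that half leaves the bound \<open>2 * C\<close> for
    \<open>G y\<close>.\<close>
  then have "\<forall>\<^sub>F y in at y0 within Y. (\<Sum>b\<in>Basis. norm (H y0 b - H y b)) < 1 / (2 * C)"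
    by (rule order_tendstoD) (use C(1) in simp)
  moreover have "\<forall>\<^sub>F y in at y0 within Y. y \<in> Y" by (simp add: eventually_at_filter)
  ultimately have ev: "\<forall>\<^sub>F y in at y0 within Y. norm (G y w - G y0 w) \<le> 2 * C * norm (H y0 (G y0 w) - H y (G y0 w))"
  proof eventually_elim
    case (elim y)
    have bnd: "norm (H y0 u - H y u) \<le> norm u * (1 / (2 * C))" for u
    proof -
      have lin: "linear (\<lambda>u. H y0 u - H y u)"
        using H[OF y0] H[OF elim(2)] by (intro linear_compose_sub)
      have "norm (H y0 u - H y u) = norm (\<Sum>b\<in>Basis. (u \<bullet> b) *\<^sub>R (H y0 b - H y b))"
        by (subst linear_expand_Basis[OF lin, of u]) simp
      also have "\<dots> \<le> (\<Sum>b\<in>Basis. norm u * norm (H y0 b - H y b))"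
        by (intro order_trans[OF norm_sum] sum_mono)
          (simp add: mult_right_mono Basis_le_norm)
      also have "\<dots> \<le> norm u * (1 / (2 * C))"
        unfolding sum_distrib_left[symmetric] using elim(1) by (intro mult_left_mono) auto
      finally show ?thesis .
    qed
    have inv_bnd: "norm (G y z) \<le> 2 * C * norm z" for z
    proof -
      let ?u = "G y z"
      have "norm ?u = norm (G y0 (H y0 ?u))" by (simp add: GH y0)
      also have "\<dots> \<le> norm (H y0 ?u) * C" by (rule C)
      also have "\<dots> \<le> (norm (H y ?u) + norm ?u * (1 / (2 * C))) * C"
        using bnd[of ?u] norm_triangle_ineq2[of "H y0 ?u" "H y ?u"] C(1)
        by (intro mult_right_mono) auto
      finally show ?thesis using C(1) by (simp add: HG elim algebra_simps)
    qed
    have "G y w - G y0 w = G y (H y0 (G y0 w) - H y (G y0 w))"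
      using G[OF elim(2)] by (simp add: linear_diff HG GH y0 elim)
    then show ?case using inv_bnd by simp
  qed
  have "((\<lambda>y. 2 * C * norm (H y0 (G y0 w) - H y (G y0 w))) \<longlongrightarrow>
      2 * C * norm (H y0 (G y0 w) - H y0 (G y0 w))) (at y0 within Y)"
    by (intro tendsto_intros lim)
  then have "((\<lambda>y. 2 * C * norm (H y0 (G y0 w) - H y (G y0 w))) \<longlongrightarrow> 0) (at y0 within Y)"
    by simp
  from Lim_null_comparison[OF ev this] show "((\<lambda>y. G y w) \<longlongrightarrow> G y0 w) (at y0 within Y)"
    by (rule LIM_zero_cancel)
qed

text \<open>With \<open>u = G x w\<close> one has \<open>G y w = u - G y (H y u - H x u)\<close>.
  The argument of \<open>G y\<close> vanishes at \<open>y = x\<close>, so differentiating at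
  \<open>x\<close> uses only the continuity of \<open>G\<close>, and the derivative is built from
  \<open>G\<close> and derivatives of \<open>H\<close>. This closes the induction.\<close>

lemma Ck_on_inverse_family:
  fixes H G :: "'e::euclidean_space \<Rightarrow> 'a::euclidean_space \<Rightarrow> 'a"
  assumes H: "\<And>y. y \<in> Y \<Longrightarrow> linear (H y)" and G: "\<And>y. y \<in> Y \<Longrightarrow> linear (G y)"
    and HG: "\<And>y w. y \<in> Y \<Longrightarrow> H y (G y w) = w" and GH: "\<And>y w. y \<in> Y \<Longrightarrow> G y (H y w) = w"
  shows "(\<And>w. Ck_on k E (\<lambda>y. H y w) Y) \<Longrightarrow> Ck_on k E (\<lambda>y. G y w) Y"
proof (induction k arbitrary: w)
  case 0
  then show ?case using continuous_on_inverse_family[of Y H G w, OF H G HG GH]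
      by (metis Ck_on.simps(1))
next
  case (Suc k)
  have "\<exists>H'. (\<forall>x\<in>Y. ((\<lambda>y. H y w) has_derivative H' x) (at x within Y)) \<and> (\<forall>v\<in>E. Ck_on k E (\<lambda>x. H' x v) Y)" for w
    using Suc.prems[of w] by simp
  then obtain H' where H': "\<And>w x. x \<in> Y \<Longrightarrow> ((\<lambda>y. H y w) has_derivative H' w x) (at x within Y)"
    "\<And>w v. v \<in> E \<Longrightarrow> Ck_on k E (\<lambda>x. H' w x v) Y" by metis
  have Gk: "Ck_on k E (\<lambda>y. G y w) Y" for w
    using Suc.IH Suc.prems by (blast dest: Ck_on_SucD)
  have contG: "((\<lambda>y. G y w) \<longlongrightarrow> G x w) (at x within Y)" if "x \<in> Y" for x w
    using Ck_on_continuous[OF Gk] that by (auto simp: continuous_on_def)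
  \<comment> \<open>The familiar formula for the derivative of an inverse, minus \<open>G x\<close>
    applied to the derivative of \<open>H\<close> at \<open>G x w\<close>, expanded over
    \<open>Basis\<close> twice so that every summand is a product of functions of known
    class.\<close>
  define D where "D x v = - (\<Sum>c\<in>Basis. ((\<Sum>b\<in>Basis. (G x w \<bullet> b) *\<^sub>R H' b x v) \<bullet> c) *\<^sub>R G x c)" for x v
  have dG: "((\<lambda>y. G y w) has_derivative D x) (at x within Y)" if x: "x \<in> Y" for x
  proof -
    let ?u = "G x w"
    let ?h = "\<lambda>y. H y ?u - H x ?u"
    have "((\<lambda>y. (\<Sum>b\<in>Basis. (?u \<bullet> b) *\<^sub>R H y b) - H x ?u) has_derivative
        (\<lambda>v. (\<Sum>b\<in>Basis. (?u \<bullet> b) *\<^sub>R H' b x v) - 0)) (at x within Y)"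
      by (intro has_derivative_diff has_derivative_sum has_derivative_scaleR_right H' x has_derivative_const)
    then have d: "((\<lambda>y. (\<Sum>b\<in>Basis. (?u \<bullet> b) *\<^sub>R H y b) - H x ?u) has_derivative
        (\<lambda>v. \<Sum>b\<in>Basis. (?u \<bullet> b) *\<^sub>R H' b x v)) (at x within Y)"
      by simp
    have "(?h has_derivative (\<lambda>v. \<Sum>b\<in>Basis. (?u \<bullet> b) *\<^sub>R H' b x v)) (at x within Y)"
      by (rule has_derivative_transform[OF x _ d]) (simp add: linear_expand_Basis[OF H, symmetric])
    then have "((\<lambda>y. ?h y \<bullet> c) has_derivative (\<lambda>v. (\<Sum>b\<in>Basis. (?u \<bullet> b) *\<^sub>R H' b x v) \<bullet> c)) (at x within Y)" for c
      by (rule has_derivative_inner_left)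
    then have "((\<lambda>y. (?h y \<bullet> c) *\<^sub>R G y c) has_derivative (\<lambda>v. ((\<Sum>b\<in>Basis. (?u \<bullet> b) *\<^sub>R H' b x v) \<bullet> c) *\<^sub>R G x c)) (at x within Y)" for c
      by (rule has_derivative_scaleR_vanishing) (use contG x in auto)
    then have dS: "((\<lambda>y. G x w - (\<Sum>c\<in>Basis. (?h y \<bullet> c) *\<^sub>R G y c)) has_derivative
       (\<lambda>v. 0 - (\<Sum>c\<in>Basis. ((\<Sum>b\<in>Basis. (?u \<bullet> b) *\<^sub>R H' b x v) \<bullet> c) *\<^sub>R G x c))) (at x within Y)"
      by (intro has_derivative_diff has_derivative_sum has_derivative_const)
    have "G x w - (\<Sum>c\<in>Basis. (?h y \<bullet> c) *\<^sub>R G y c) = G y w" if "y \<in> Y" for y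
    proof -
      have "(\<Sum>c\<in>Basis. (?h y \<bullet> c) *\<^sub>R G y c) = G y (?h y)"
        by (rule linear_expand_Basis[OF G[OF that], symmetric])
      also have "\<dots> = G x w - G y w" using G[OF that] x that by (simp add: linear_diff HG GH)
      finally show ?thesis by simp
    qed
    then have "((\<lambda>y. G y w) has_derivative
       (\<lambda>v. 0 - (\<Sum>c\<in>Basis. ((\<Sum>b\<in>Basis. (?u \<bullet> b) *\<^sub>R H' b x v) \<bullet> c) *\<^sub>R G x c))) (at x within Y)"
      by (intro has_derivative_transform[OF x _ dS]) simp
    then show ?thesis unfolding D_def by simp
  qed
  have "Ck_on k E (\<lambda>x. D x v) Y" if "v \<in> E" for v
    unfolding D_def
    by (intro Ck_on_linear_compose[OF bounded_linear_minus[OF bounded_linear_ident]] Ck_on_sum Ck_on_scaleR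
        Ck_on_linear_compose[OF bounded_linear_inner_left] Gk H' that)
  from Ck_on_SucI[OF dG this] show ?case .
qed

text \<open>\<open>g' y\<close> is the inverse of \<open>f' (g y)\<close>. If \<open>g\<close> has
  class \<open>C^k\<close>, then so has \<open>f' (g y)\<close> as a function of \<open>y\<close>,
  hence so have the inverses \<open>g' y\<close>, and \<open>g\<close> gains one class.\<close>

lemma Ck_on_inverse_function:
  fixes f :: "'e::euclidean_space \<Rightarrow> 'e"
  assumes "open X" "open Y"
    and hom: "homeomorphism X Y f g"
    and g': "\<And>y. y \<in> Y \<Longrightarrow> (g has_derivative g' y) (at y)"
  shows "Ck_on k UNIV f X \<Longrightarrow> Ck_on k UNIV g Y"
proof (induction k)
  case 0
  then show ?case using hom by (simp add: homeomorphism_def)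
next
  case (Suc k)
  have gk: "Ck_on k UNIV g Y" using Suc.IH[OF Ck_on_SucD[OF Suc.prems]] .
  obtain f' where f': "\<And>x. x \<in> X \<Longrightarrow> (f has_derivative f' x) (at x within X)"
    "\<And>v. Ck_on k UNIV (\<lambda>x. f' x v) X" using Ck_on_SucE[OF Suc.prems] UNIV_I by metis
  have fX: "(f has_derivative f' x) (at x)" if "x \<in> X" for x
    using f'(1)[OF that] unfolding at_within_open[OF that assms(1)] .
  have gY: "g y \<in> X" "f (g y) = y" if "y \<in> Y" for y using hom that by (auto simp: homeomorphism_def)
  have inv1: "f' (g y) (g' y w) = w" and inv2: "g' y (f' (g y) w) = w" if y: "y \<in> Y" for y w
  proof -
    have "(f \<circ> g has_derivative f' (g y) \<circ> g' y) (at y)"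
      using g'[OF y] fX[OF gY(1)[OF y]] by (rule diff_chain_at)
    moreover have "((\<lambda>y. y) has_derivative f' (g y) \<circ> g' y) (at y)"
      by (rule has_derivative_transform_within_open[OF calculation assms(2) y]) (simp add: gY)
    ultimately show "f' (g y) (g' y w) = w"
      using has_derivative_unique[OF _ has_derivative_ident] by (metis comp_apply)
    have *: "(g \<circ> f has_derivative g' y \<circ> f' (g y)) (at (g y))"
      using fX[OF gY(1)[OF y]] g'[of "f (g y)"] y gY by (intro diff_chain_at) auto
    have "((\<lambda>y. y) has_derivative g' y \<circ> f' (g y)) (at (g y))"
      by (rule has_derivative_transform_within_open[OF * assms(1) gY(1)[OF y]])
        (use hom in \<open>auto simp: homeomorphism_def\<close>)
    then show "g' y (f' (g y) w) = w"
      using has_derivative_unique[OF _ has_derivative_ident] by (metis comp_apply)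
  qed
  have "Ck_on k UNIV ((\<lambda>x. f' x w) \<circ> g) Y" for w
    using gk f'(2) by (rule Ck_on_compose_UNIV) (use gY in auto)
  moreover have "linear (f' (g y))" "linear (g' y)" if "y \<in> Y" for y
    using fX[OF gY(1)[OF that]] g'[OF that] by (auto dest: has_derivative_linear)
  ultimately have "Ck_on k UNIV (\<lambda>y. g' y w) Y" for w
    by (intro Ck_on_inverse_family[of Y "\<lambda>y. f' (g y)" g'])
      (simp_all add: inv1 inv2 o_def)
  moreover have "(g has_derivative g' y) (at y within Y)" if "y \<in> Y" for y
    using g' that by (blast intro: has_derivative_at_withinI)
  ultimately show ?case by (intro Ck_on_SucI)
qed

text \<open>The inverse function theorem on the whole space is applied to an extension of
  \<open>f\<close> and cut back to \<open>E\<close>. Injectivity of \<open>D\<close> on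
  \<open>E\<close> is the right hypothesis because \<open>D\<close> maps the finite-dimensional
  \<open>E\<close> into itself.\<close>

lemma inverse_function_C_on:
  fixes f :: "'e::euclidean_space \<Rightarrow> 'e" and E :: "'e set"
  assumes E: "subspace E" and X: "openin (top_of_set E) X" and fE: "f ` X \<subseteq> E"
    and r: "C_on r E f X" "1 \<le> r"
    and e0: "e0 \<in> X" and D: "(f has_derivative D) (at e0 within X)"
    and DE: "\<And>v. v \<in> E \<Longrightarrow> D v \<in> E" and inj: "\<And>v. v \<in> E \<Longrightarrow> D v = 0 \<Longrightarrow> v = 0"
  obtains X' Y g where "openin (top_of_set E) X'" "X' \<subseteq> X" "e0 \<in> X'"
    "openin (top_of_set E) Y" "homeomorphism X' Y f g" "C_on r E g Y"
proof -
  obtain p where p: "bounded_linear p" "\<And>x. p x \<in> E" "\<And>x. x \<in> E \<Longrightarrow> p x = x"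
    using subspace_projection[OF E] by blast
  let ?X = "p -` X"
  \<comment> \<open>\<open>F\<close> adds to \<open>f (p x)\<close> the transverse component
    \<open>x - p x\<close>. It agrees with \<open>f\<close> on \<open>X\<close>, and for
    \<open>x\<close> in its domain \<open>F x\<close> lies in \<open>E\<close> only if
    \<open>x\<close> does; the latter makes the local inverse map \<open>E\<close> back into
    \<open>E\<close>.\<close>
  define F where "F x = (f \<circ> p) x + (x + - p x)" for x
  obtain T where T: "open T" "X = E \<inter> T" using X by (auto simp: openin_open)
  have "?X = p -` T" using p(2) T by auto
  then have opX: "open ?X"
    using T(1) p(1)
        by (metis continuous_on_open_vimage inf_top.right_neutral linear_continuous_on open_UNIV)
  have CF: "Ck_on k UNIV F ?X" if "enat k \<le> r" for k
  proof -
    have "Ck_on k UNIV (f \<circ> p) ?X"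
      using r(1) that by (intro Ck_on_extend[OF p(1,2)]) (simp add: C_on_def)
    moreover have "Ck_on k UNIV (\<lambda>x. x + - p x) ?X"
      by (intro Ck_on_linear bounded_linear_add bounded_linear_minus p(1) bounded_linear_ident)
    ultimately show ?thesis unfolding F_def by (rule Ck_on_add)
  qed
  have "Ck_on (Suc 0) UNIV F ?X" using r(2) by (intro CF) (simp add: one_enat_def)
  then obtain F' where F': "\<And>x. x \<in> ?X \<Longrightarrow> (F has_derivative F' x) (at x within ?X)"
    "\<And>v. continuous_on ?X (\<lambda>x. F' x v)" by auto
  have F'at: "(F has_derivative F' x) (at x)" if "x \<in> ?X" for x
    using F'(1)[OF that] unfolding at_within_open[OF that opX] .
  have e0X: "e0 \<in> ?X" "p e0 = e0" using e0 p(3) T by auto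
  have "(f has_derivative D) (at (p e0) within p ` ?X)"
    unfolding e0X(2) using D by (rule has_derivative_subset) auto
  then have "(f \<circ> p has_derivative D \<circ> p) (at e0 within ?X)"
    using diff_chain_within[OF bounded_linear_imp_has_derivative[OF p(1)]] by blast
  then have "(F has_derivative (\<lambda>v. (D \<circ> p) v + (v + - p v))) (at e0 within ?X)"
    unfolding F_def
    by (intro has_derivative_add bounded_linear_imp_has_derivative bounded_linear_add bounded_linear_minus p(1) bounded_linear_ident)
  then have F'e0: "F' e0 v = D (p v) + (v - p v)" for v
    unfolding at_within_open[OF e0X(1) opX]
    using has_derivative_unique[OF F'at[OF e0X(1)]]
        by (metis (no_types, lifting) add_uminus_conv_diff comp_apply)
  have "linear (F' e0)" using F'at[OF e0X(1)] by (rule has_derivative_linear)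
  moreover have "v = 0" if "F' e0 v = 0" for v
  proof -
    have "v - p v = - D (p v)" using that F'e0 by (simp add: eq_neg_iff_add_eq_0 add.commute)
    then have "v - p v \<in> E" using DE p(2) E by (simp add: subspace_neg)
    then have "v \<in> E" using p(2) E subspace_add[of E "v - p v" "p v"] by simp
    then show ?thesis using inj that F'e0 p(3) by simp
  qed
  ultimately have "inj (F' e0)" by (simp add: linear_injective_0)
  then obtain I where I: "linear I" "\<And>v. I (F' e0 v) = v"
    using \<open>linear (F' e0)\<close> linear_injective_left_inverse by (metis comp_apply id_apply)
  have bl: "bounded_linear (F' x)" if "x \<in> ?X" for x using F'at[OF that]
      by (rule has_derivative_bounded_linear)
  let ?F = "\<lambda>x. Blinfun (F' x)"
  have app: "blinfun_apply (?F x) = F' x" if "x \<in> ?X" for x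
    using bl[OF that] by (simp add: bounded_linear_Blinfun_apply)
  have contF: "continuous_on ?X ?F"
  proof (rule continuous_on_blinfun_componentwise)
    show "continuous_on ?X (\<lambda>x. blinfun_apply (?F x) b)" for b
      using F'(2)[of b] by (rule continuous_on_cong[THEN iffD1, rotated -1]) (auto simp: app)
  qed
  have inv: "Blinfun I o\<^sub>L ?F e0 = id_blinfun"
    by (rule blinfun_eqI) (use I app[OF e0X(1)] in \<open>simp add: bounded_linear_Blinfun_apply linear_conv_bounded_linear\<close>)
  obtain U' V g g' where U': "open U'" "U' \<subseteq> ?X" "e0 \<in> U'" and V: "open V" "F e0 \<in> V"
    and hom: "homeomorphism U' V F g" and g': "\<And>y. y \<in> V \<Longrightarrow> (g has_derivative (g' y)) (at y)"
    using inverse_function_theorem[OF opX, of F ?F e0 "Blinfun I"] F'at app contF e0X inv by metis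
  have FE: "F x = f x" if "x \<in> U'" "x \<in> E" for x using that p(3) by (simp add: F_def)
  have XE: "x \<in> X" if "x \<in> U'" "x \<in> E" for x using that p(3) U'(2) by auto
  have gE: "g y \<in> E" if "y \<in> V" "y \<in> E" for y
  proof -
    have *: "g y \<in> U'" "F (g y) = y" using hom that by (auto simp: homeomorphism_def)
    then have fp: "f (p (g y)) \<in> E" using U'(2) fE by auto
    have "f (p (g y)) + (g y - p (g y)) = y" using *(2) by (simp add: F_def)
    then have "g y - p (g y) = y - f (p (g y))" by (metis add_diff_cancel_left')
    with fp that(2) have "g y - p (g y) \<in> E" using subspace_diff[OF E] by simp
    then show ?thesis using p(2) E subspace_add[of E "g y - p (g y)" "p (g y)"] by simp
  qed
  show ?thesis
  proof (rule that)
    show "openin (top_of_set E) (U' \<inter> E)" "openin (top_of_set E) (V \<inter> E)"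
      using U'(1) V(1) by (auto simp: openin_open)
    show "U' \<inter> E \<subseteq> X" using XE by auto
    show "e0 \<in> U' \<inter> E" using U'(3) e0 T by auto
    have "F ` (U' \<inter> E) = V \<inter> E"
    proof
      have "F ` U' = V" using hom by (simp add: homeomorphism_def)
      moreover have "F x \<in> E" if "x \<in> U'" "x \<in> E" for x
        using FE[OF that] XE[OF that] fE by auto
      ultimately show "F ` (U' \<inter> E) \<subseteq> V \<inter> E" by blast
      show "V \<inter> E \<subseteq> F ` (U' \<inter> E)"
      proof
        fix y assume y: "y \<in> V \<inter> E"
        then have "g y \<in> U'" "F (g y) = y" using hom by (auto simp: homeomorphism_def)
        then show "y \<in> F ` (U' \<inter> E)" using gE y by force
      qed
    qed
    then have "homeomorphism (U' \<inter> E) (V \<inter> E) F g"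
      by (intro homeomorphism_of_subsets[OF hom]) auto
    then show "homeomorphism (U' \<inter> E) (V \<inter> E) f g"
      by (rule homeomorphism_cong) (auto simp: FE)
    show "C_on r E g (V \<inter> E)" unfolding C_on_def
    proof (intro allI impI)
      fix k assume "enat k \<le> r"
      then have "Ck_on k UNIV F U'" using CF U'(2) Ck_on_subset by blast
      then have "Ck_on k UNIV g V" using Ck_on_inverse_function[OF U'(1) V(1) hom g'] by blast
      then show "Ck_on k E g (V \<inter> E)" by (rule Ck_on_subset) auto
    qed
  qed
qed

section \<open>Charts, curves and tangent vectors\<close>

lemma limitin_top_of_set:
  "limitin (top_of_set X) \<gamma> x F \<longleftrightarrow> x \<in> X \<and> (\<forall>\<^sub>F t in F. \<gamma> t \<in> X) \<and> (\<gamma> \<longlongrightarrow> x) F"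
  by (simp add: limitin_subtopology)

lemma limitin_eventually_openin:
  "limitin T \<gamma> x F \<Longrightarrow> openin T U \<Longrightarrow> x \<in> U \<Longrightarrow> \<forall>\<^sub>F t in F. \<gamma> t \<in> U"
  by (simp add: limitin_def)

text \<open>The filter \<open>at 0\<close> ignores time 0 itself, so \<open>f 0 \<in> X\<close> is a
  separate hypothesis. Together the two give an open set of times mapped into \<open>X\<close>, on
  which the derivatives can be chained.\<close>

lemma has_vector_derivative_compose_within:
  fixes f :: "real \<Rightarrow> 'a::real_normed_vector" and g :: "'a \<Rightarrow> 'b::real_normed_vector"
  assumes g: "(g has_derivative T) (at (f 0) within X)"
    and f: "(f has_vector_derivative v) (at 0)"
    and X: "\<forall>\<^sub>F t in at 0. f t \<in> X" "f 0 \<in> X"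
  shows "((g \<circ> f) has_vector_derivative T v) (at 0)"
proof -
  obtain I where I: "open I" "0 \<in> I" "f ` I \<subseteq> X"
    using X unfolding eventually_at_topological image_subset_iff by (metis UNIV_I)
  have "(f has_derivative (\<lambda>t. t *\<^sub>R v)) (at 0 within I)"
    using f by (auto simp: has_vector_derivative_def intro: has_derivative_at_withinI)
  moreover have "(g has_derivative T) (at (f 0) within f ` I)"
    using g I(3) by (rule has_derivative_subset)
  ultimately have "(g \<circ> f has_derivative T \<circ> (\<lambda>t. t *\<^sub>R v)) (at 0 within I)"
    by (rule diff_chain_within)
  moreover have "T \<circ> (\<lambda>t. t *\<^sub>R v) = (\<lambda>t. t *\<^sub>R T v)"
    using has_derivative_linear[OF g] by (auto simp: linear_cmul)
  ultimately show ?thesis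
    by (simp add: has_vector_derivative_def at_within_open[OF I(2,1)])
qed

lemma has_vector_derivative_cong_eventually:
  assumes "(f has_vector_derivative v) (at x)" "\<forall>\<^sub>F t in at x. f t = g t" "f x = g x"
  shows "(g has_vector_derivative v) (at x)"
  using assms has_derivative_transform_eventually unfolding has_vector_derivative_def by blast

text \<open>Projecting the increments onto \<open>E\<close> leaves the curve unchanged near time 0
  and replaces \<open>v\<close> by \<open>p v\<close>; uniqueness of the derivative gives
  \<open>v = p v\<close>.\<close>

lemma has_vector_derivative_in_subspace:
  fixes f :: "real \<Rightarrow> 'e::euclidean_space"
  assumes E: "subspace E" and f: "(f has_vector_derivative v) (at 0)"
    and ev: "\<forall>\<^sub>F t in at 0. f t - f 0 \<in> E"
  shows "v \<in> E"
proof -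
  obtain p where p: "bounded_linear p" "\<And>x. p x \<in> E" "\<And>x. x \<in> E \<Longrightarrow> p x = x"
    using subspace_projection[OF E] by blast
  have "((\<lambda>t. f 0 + p (f t - f 0)) has_vector_derivative 0 + p (v - 0)) (at 0)"
    by (intro has_vector_derivative_add has_vector_derivative_const
        bounded_linear.has_vector_derivative[OF p(1)] has_vector_derivative_diff f)
  then have "(f has_vector_derivative p v) (at 0)"
    using has_vector_derivative_cong_eventually[of "\<lambda>t. f 0 + p (f t - f 0)" "p v" 0 f]
      eventually_mono[OF ev] p linear_0[OF bounded_linear.linear[OF p(1)]] by simp
  then have "v = p v" using f vector_derivative_unique_at by blast
  then show ?thesis using p(2) by metis
qed

lemma eventually_line_in_openin:
  fixes E :: "'e::real_normed_vector set"
  assumes "subspace E" "openin (top_of_set E) X" "e \<in> X" "v \<in> E"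
  shows "\<forall>\<^sub>F t::real in at 0. e + t *\<^sub>R v \<in> X"
proof -
  obtain T where T: "open T" "X = E \<inter> T" using assms(2) by (auto simp: openin_open)
  have "((\<lambda>t::real. e + t *\<^sub>R v) \<longlongrightarrow> e + 0 *\<^sub>R v) (at 0)" by (intro tendsto_intros)
  then have "\<forall>\<^sub>F t::real in at 0. e + t *\<^sub>R v \<in> T"
    by (rule topological_tendstoD[OF _ T(1)]) (use assms(3) T in simp)
  then show ?thesis
    by eventually_elim (use assms T in \<open>auto intro: subspace_add subspace_scale\<close>)
qed

lemma has_vector_derivative_line: "((\<lambda>t. e + t *\<^sub>R v) has_vector_derivative v) (at 0)"
  by (auto intro!: derivative_eq_intros)

lemma is_chartD:
  assumes "is_chart M (U, \<eta>)"
  shows "openin (top_of_set (points M)) U" "openin (top_of_set (model M)) (\<eta> ` U)"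
    "homeomorphism U (\<eta> ` U) \<eta> (inv_into U \<eta>)" "inj_on \<eta> U" "U \<subseteq> points M" "\<eta> ` U \<subseteq> model M"
proof -
  show *: "openin (top_of_set (points M)) U" "openin (top_of_set (model M)) (\<eta> ` U)"
    "homeomorphism U (\<eta> ` U) \<eta> (inv_into U \<eta>)"
    using assms by (auto simp: is_chart_def)
  then show "inj_on \<eta> U" by (metis homeomorphism_apply1 inj_on_inverseI)
  show "U \<subseteq> points M" "\<eta> ` U \<subseteq> model M" using * openin_imp_subset by blast+
qed

lemma chart_image_openin:
  assumes "is_chart M (U, \<eta>)" "openin (top_of_set (points M)) W" "W \<subseteq> U"
  shows "openin (top_of_set (model M)) (\<eta> ` W)"
proof -
  note c = is_chartD[OF assms(1)]
  have "openin (top_of_set U) W"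
    using assms(2,3) c(5) by (rule openin_subset_trans)
  then have "openin (top_of_set (\<eta> ` U)) (\<eta> ` W)"
    using c(3) homeomorphism_imp_open_map by blast
  then show ?thesis using c(2) openin_trans by blast
qed

lemma C_on_has_derivative:
  assumes "C_on r E f X" "1 \<le> r" "x \<in> X"
  obtains D where "(f has_derivative D) (at x within X)"
proof -
  have "Ck_on (Suc 0) E f X" using assms(1,2) by (simp add: C_on_def one_enat_def del: Ck_on.simps)
  then show ?thesis using assms(3) that by auto
qed

text \<open>\<open>T\<close> is a derivative of the transition map and transports velocities of
  curves. A derivative within a relatively open subset of \<open>model M\<close> is determined only
  along \<open>model M\<close>, which is why injectivity is claimed there.\<close>

lemma chart_change:
  assumes c: "is_chart M (U, \<eta>)" and d: "is_chart M (V, \<xi>)" and E: "subspace (model M)"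
    and tr: "C_transition r M (U, \<eta>) (V, \<xi>)" "C_transition r M (V, \<xi>) (U, \<eta>)" and r: "1 \<le> r"
    and x: "x \<in> U" "x \<in> V"
  obtains T where "linear T" "inj_on T (model M)"
    "(\<xi> \<circ> inv_into U \<eta> has_derivative T) (at (\<eta> x) within \<eta> ` (U \<inter> V))"
    "\<And>\<gamma> v. \<gamma> 0 = x \<Longrightarrow> limitin (top_of_set (points M)) \<gamma> x (at 0) \<Longrightarrow>
      (\<eta> \<circ> \<gamma> has_vector_derivative v) (at 0) \<Longrightarrow> (\<xi> \<circ> \<gamma> has_vector_derivative T v) (at 0)"
proof -
  let ?X = "\<eta> ` (U \<inter> V)" and ?Y = "\<xi> ` (V \<inter> U)"
  let ?f = "\<xi> \<circ> inv_into U \<eta>" and ?g = "\<eta> \<circ> inv_into V \<xi>"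
  note C = is_chartD[OF c] and D = is_chartD[OF d]
  have f: "?f (\<eta> y) = \<xi> y" if "y \<in> U" for y using C(4) that by simp
  have g: "?g (\<xi> y) = \<eta> y" if "y \<in> V" for y using D(4) that by simp
  obtain T where T: "(?f has_derivative T) (at (\<eta> x) within ?X)"
    using C_on_has_derivative[of r "model M" ?f ?X "\<eta> x"] tr(1) r x by (auto simp: C_transition_def)
  obtain S where S: "(?g has_derivative S) (at (\<xi> x) within ?Y)"
    using C_on_has_derivative[of r "model M" ?g ?Y "\<xi> x"] tr(2) r x by (auto simp: C_transition_def)
  have fXY: "?f ` ?X \<subseteq> ?Y" using f by auto
  have "(?g has_derivative S) (at (?f (\<eta> x)) within ?f ` ?X)"
    unfolding f[OF x(1)] using S fXY by (rule has_derivative_subset)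
  from diff_chain_within[OF T this]
  have ST: "(?g \<circ> ?f has_derivative S \<circ> T) (at (\<eta> x) within ?X)" .
  have opX: "openin (top_of_set (model M)) ?X"
    by (rule chart_image_openin[OF c]) (use C(1) D(1) in auto)
  \<comment> \<open>The round trip and the identity are compared along a straight line in direction
    \<open>v\<close>: a derivative within a subset of the model is tested only in directions along
    the model.\<close>
  have left_inv: "S (T v) = v" if v: "v \<in> model M" for v
  proof -
    let ?l = "\<lambda>t::real. \<eta> x + t *\<^sub>R v"
    have ev: "\<forall>\<^sub>F t in at 0. ?l t \<in> ?X"
      using eventually_line_in_openin[OF E opX _ v, of "\<eta> x"] x by auto
    have ld: "(?l has_vector_derivative v) (at 0)" by (rule has_vector_derivative_line)
    have "(?g \<circ> ?f \<circ> ?l has_vector_derivative (S \<circ> T) v) (at 0)"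
      using has_vector_derivative_compose_within[of "?g \<circ> ?f" "S \<circ> T" ?l ?X v] ST ld ev x
      by (simp del: o_apply)
    moreover have "\<forall>\<^sub>F t in at 0. (?g \<circ> ?f \<circ> ?l) t = ?l t"
      using ev by eventually_elim (auto simp: C(4) D(4))
    moreover have "(?g \<circ> ?f \<circ> ?l) 0 = ?l 0" using x C(4) D(4) by simp
    ultimately have "(?l has_vector_derivative (S \<circ> T) v) (at 0)"
      by (rule has_vector_derivative_cong_eventually)
    then show ?thesis using ld vector_derivative_unique_at by fastforce
  qed
  show ?thesis
  proof (rule that)
    show "linear T" using T by (rule has_derivative_linear)
    show "inj_on T (model M)" using left_inv by (rule inj_on_inverseI)
    show "(?f has_derivative T) (at (\<eta> x) within ?X)" by (rule T)
    fix \<gamma> :: "real \<Rightarrow> _" and v assume \<gamma>: "\<gamma> 0 = x" "limitin (top_of_set (points M)) \<gamma> x (at 0)"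
      "(\<eta> \<circ> \<gamma> has_vector_derivative v) (at 0)"
    have ev: "\<forall>\<^sub>F t in at 0. \<gamma> t \<in> U \<inter> V"
      using \<gamma>(2) by (rule limitin_eventually_openin) (use C(1) D(1) x in auto)
    have "(?f \<circ> (\<eta> \<circ> \<gamma>) has_vector_derivative T v) (at 0)"
    proof (rule has_vector_derivative_compose_within[where X = ?X and T = T])
      show "\<forall>\<^sub>F t in at 0. (\<eta> \<circ> \<gamma>) t \<in> ?X" using ev by eventually_elim simp
    qed (use T \<gamma> x in simp_all)
    then show "(\<xi> \<circ> \<gamma> has_vector_derivative T v) (at 0)"
      by (rule has_vector_derivative_cong_eventually)
        (use \<gamma>(1) x C(4) in \<open>auto intro: eventually_mono[OF ev]\<close>)
  qed
qed

lemma chart_line: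
  assumes c: "is_chart M (U, \<eta>)" and E: "subspace (model M)" and x: "x \<in> U" and v: "v \<in> model M"
  obtains \<gamma> where "\<gamma> 0 = x" "limitin (top_of_set (points M)) \<gamma> x (at 0)"
    "\<forall>\<^sub>F t in at 0. \<gamma> t \<in> U \<and> \<eta> (\<gamma> t) = \<eta> x + t *\<^sub>R v" "(\<eta> \<circ> \<gamma> has_vector_derivative v) (at 0)"
proof -
  note C = is_chartD[OF c]
  \<comment> \<open>Away from time 0 the line may leave the image of the chart, where
    \<open>inv_into\<close> has an arbitrary value; only the germ of the curve at 0 matters.\<close>
  define \<gamma> where "\<gamma> t = inv_into U \<eta> (\<eta> x + t *\<^sub>R v)" for t
  have ev: "\<forall>\<^sub>F t in at 0. \<eta> x + t *\<^sub>R v \<in> \<eta> ` U"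
    using eventually_line_in_openin[OF E C(2) _ v] x by simp
  have 0: "\<gamma> 0 = x" using C(4) x by (simp add: \<gamma>_def)
  have ev': "\<forall>\<^sub>F t in at 0. \<gamma> t \<in> U \<and> \<eta> (\<gamma> t) = \<eta> x + t *\<^sub>R v"
    using ev by eventually_elim (simp add: \<gamma>_def f_inv_into_f inv_into_into)
  have l0: "((\<lambda>t. \<eta> x + t *\<^sub>R v) \<longlongrightarrow> \<eta> x + 0 *\<^sub>R v) (at 0)" by (intro tendsto_intros)
  have "((\<lambda>t. inv_into U \<eta> (\<eta> x + t *\<^sub>R v)) \<longlongrightarrow> inv_into U \<eta> (\<eta> x + 0 *\<^sub>R v)) (at 0)"
    using continuous_on_tendsto_compose[OF _ l0, of "\<eta> ` U" "inv_into U \<eta>"] ev C(3) x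
    by (simp add: homeomorphism_def)
  then have "(\<gamma> \<longlongrightarrow> x) (at 0)" using C(4) x by (simp add: \<gamma>_def[abs_def])
  then have lim: "limitin (top_of_set (points M)) \<gamma> x (at 0)"
    unfolding limitin_top_of_set using C(5) x ev' by (auto elim: eventually_mono)
  have "(\<eta> \<circ> \<gamma> has_vector_derivative v) (at 0)"
    by (rule has_vector_derivative_cong_eventually[OF has_vector_derivative_line[of "\<eta> x"]])
      (use ev' 0 in \<open>auto elim: eventually_mono\<close>)
  with that 0 lim ev' show ?thesis by blast
qed

section \<open>Tangent spaces read in a single chart\<close>

text \<open>\<open>tangent_space\<close> consists of families indexed by all charts. Reading
  velocities in the one coordinate map \<open>\<delta>\<close> gives a subset of the Euclidean type,
  where dimensions can be compared.\<close>

definition coord_tangent ::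
  "('a, 'e::real_normed_vector) mfd \<Rightarrow> 'a topology \<Rightarrow> ('a \<Rightarrow> 'e) \<Rightarrow> 'a \<Rightarrow> 'e set" where
  "coord_tangent M T \<delta> x = (\<lambda>\<gamma>. vector_derivative (\<delta> \<circ> \<gamma>) (at 0)) ` {\<gamma>. curve_at M T x \<gamma>}"

lemma atlas_subset_C_charts: "C_manifold r M \<Longrightarrow> atlas M \<subseteq> C_charts r M"
  by (auto simp: C_manifold_def C_charts_def)

lemma curve_atD: "curve_at M T x \<gamma> \<Longrightarrow> \<gamma> 0 = x" "curve_at M T x \<gamma> \<Longrightarrow> limitin T \<gamma> x (at 0)"
  by (simp_all add: curve_at_def)

text \<open>Differentiability in one chart spreads to the atlas by \<open>chart_change\<close>. That
  chart may come from the maximal atlas, so slice charts and foliated charts qualify. As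
  \<open>T\<close> is arbitrary, convergence in \<open>M\<close> is asked for besides convergence in
  \<open>T\<close>.\<close>

lemma curve_atI:
  assumes M: "subspace (model M)" "\<forall>c\<in>atlas M. is_chart M c" and c: "(U, \<eta>) \<in> C_charts r M"
    and r: "1 \<le> r" and x: "x \<in> U" and \<gamma>: "\<gamma> 0 = x" "limitin T \<gamma> x (at 0)"
    "limitin (top_of_set (points M)) \<gamma> x (at 0)" "(\<eta> \<circ> \<gamma> has_vector_derivative v) (at 0)"
  shows "curve_at M T x \<gamma>"
  unfolding curve_at_def
proof (intro conjI \<gamma> ballI, clarify)
  fix V \<xi> assume d: "(V, \<xi>) \<in> atlas M" "x \<in> V"
  then have ch: "is_chart M (U, \<eta>)" "is_chart M (V, \<xi>)" and
    tr: "C_transition r M (U, \<eta>) (V, \<xi>)" "C_transition r M (V, \<xi>) (U, \<eta>)"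
    using c M(2) by (auto simp: C_charts_def)
  obtain T where "(\<xi> \<circ> \<gamma> has_vector_derivative T v) (at 0)"
    using chart_change[OF ch M(1) tr r x d(2)] \<gamma> by metis
  then show "\<xi> \<circ> \<gamma> differentiable at 0" using differentiableI_vector by blast
qed

lemma curve_at_has_vector_derivative:
  assumes "curve_at M T x \<gamma>" "(D, \<delta>) \<in> atlas M" "x \<in> D"
  shows "(\<delta> \<circ> \<gamma> has_vector_derivative vector_derivative (\<delta> \<circ> \<gamma>) (at 0)) (at 0)"
  using assms by (auto simp: curve_at_def vector_derivative_works)

lemma curve_at_top_of_set_mono:
  "curve_at M (top_of_set N) x \<gamma> \<Longrightarrow> N \<subseteq> N' \<Longrightarrow> curve_at M (top_of_set N') x \<gamma>"
  by (auto simp: curve_at_def limitin_top_of_set elim: eventually_mono)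

lemma coord_tangent_top:
  assumes M: "subspace (model M)" "\<forall>c\<in>atlas M. is_chart M c" "atlas M \<subseteq> C_charts r M"
    and d: "(D, \<delta>) \<in> atlas M" and r: "1 \<le> r" and x: "x \<in> D"
  shows "coord_tangent M (top_of_set (points M)) \<delta> x = model M"
proof
  have c: "is_chart M (D, \<delta>)" using M d by blast
  note C = is_chartD[OF c]
  show "coord_tangent M (top_of_set (points M)) \<delta> x \<subseteq> model M"
  proof (clarsimp simp: coord_tangent_def)
    fix \<gamma> assume \<gamma>: "curve_at M (top_of_set (points M)) x \<gamma>"
    then have "\<forall>\<^sub>F t in at 0. \<gamma> t \<in> D" "\<gamma> 0 = x"
      using limitin_eventually_openin[OF curve_atD(2) C(1) x] by (simp_all add: curve_atD)
    then have "\<forall>\<^sub>F t in at 0. (\<delta> \<circ> \<gamma>) t - (\<delta> \<circ> \<gamma>) 0 \<in> model M"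
      using C(6) x by (auto elim!: eventually_mono intro!: subspace_diff[OF M(1)])
    then show "vector_derivative (\<delta> \<circ> \<gamma>) (at 0) \<in> model M"
      using has_vector_derivative_in_subspace[OF M(1)] curve_at_has_vector_derivative[OF \<gamma> d x]
          by blast
  qed
  show "model M \<subseteq> coord_tangent M (top_of_set (points M)) \<delta> x"
  proof
    fix v assume "v \<in> model M"
    then obtain \<gamma> where \<gamma>: "\<gamma> 0 = x" "limitin (top_of_set (points M)) \<gamma> x (at 0)"
      "(\<delta> \<circ> \<gamma> has_vector_derivative v) (at 0)"
      using chart_line[OF c M(1) x] by metis
    then have "curve_at M (top_of_set (points M)) x \<gamma>"
      using curve_atI[OF M(1,2) _ r x] d M(3) by blast
    then show "v \<in> coord_tangent M (top_of_set (points M)) \<delta> x"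
      unfolding coord_tangent_def using vector_derivative_at[OF \<gamma>(3)] by force
  qed
qed

text \<open>Leaves and regular submanifolds are treated together: the last two assumptions say that,
  for curves through \<open>x\<close>, convergence in \<open>T\<close> amounts to convergence in
  \<open>M\<close> within the slice of \<open>\<eta>\<close> through \<open>x\<close> parallel to
  \<open>K\<close>. Lines in that slice realise every velocity in \<open>K\<close>, and the change
  from \<open>\<eta>\<close> to \<open>\<delta>\<close> carries these over linearly and
  injectively.\<close>

lemma coord_tangent_slice:
  assumes M: "subspace (model M)" "\<forall>c\<in>atlas M. is_chart M c" and d: "(D, \<delta>) \<in> atlas M" "x \<in> D"
    and c: "(U, \<eta>) \<in> C_charts r M" "x \<in> U" and r: "1 \<le> r"
    and K: "subspace K" "K \<subseteq> model M"
    and T1: "\<And>\<gamma> :: real \<Rightarrow> _. \<gamma> 0 = x \<Longrightarrow> limitin T \<gamma> x (at 0) \<Longrightarrow>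
      limitin (top_of_set (points M)) \<gamma> x (at 0) \<and> (\<forall>\<^sub>F t in at 0. \<eta> (\<gamma> t) - \<eta> x \<in> K)"
    and T2: "\<And>\<gamma> :: real \<Rightarrow> _. \<gamma> 0 = x \<Longrightarrow> limitin (top_of_set (points M)) \<gamma> x (at 0) \<Longrightarrow>
      (\<forall>\<^sub>F t in at 0. \<gamma> t \<in> U \<and> \<eta> (\<gamma> t) - \<eta> x \<in> K) \<Longrightarrow> limitin T \<gamma> x (at 0)"
  shows "subspace (coord_tangent M T \<delta> x)" "dim (coord_tangent M T \<delta> x) = dim K"
proof -
  have cc: "is_chart M (U, \<eta>)" and dc: "is_chart M (D, \<delta>)" using c M d by (auto simp: C_charts_def)
  have tr: "C_transition r M (U, \<eta>) (D, \<delta>)" "C_transition r M (D, \<delta>) (U, \<eta>)"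
    using c d by (auto simp: C_charts_def)
  obtain A where A: "\<And>\<gamma> v. \<gamma> 0 = x \<Longrightarrow> limitin (top_of_set (points M)) \<gamma> x (at 0) \<Longrightarrow>
      (\<delta> \<circ> \<gamma> has_vector_derivative v) (at 0) \<Longrightarrow> (\<eta> \<circ> \<gamma> has_vector_derivative A v) (at 0)"
    using chart_change[OF dc cc M(1) tr(2,1) r d(2) c(2)] by metis
  obtain B where B: "linear B" "inj_on B (model M)" "\<And>\<gamma> v. \<gamma> 0 = x \<Longrightarrow>
      limitin (top_of_set (points M)) \<gamma> x (at 0) \<Longrightarrow>
      (\<eta> \<circ> \<gamma> has_vector_derivative v) (at 0) \<Longrightarrow> (\<delta> \<circ> \<gamma> has_vector_derivative B v) (at 0)"
    using chart_change[OF cc dc M(1) tr r c(2) d(2)] by metis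
  have "coord_tangent M T \<delta> x = B ` K"
  proof
    show "coord_tangent M T \<delta> x \<subseteq> B ` K"
      unfolding coord_tangent_def
    proof clarify
      fix \<gamma> assume \<gamma>: "curve_at M T x \<gamma>"
      then have g: "\<gamma> 0 = x" "limitin (top_of_set (points M)) \<gamma> x (at 0)"
          "\<forall>\<^sub>F t in at 0. \<eta> (\<gamma> t) - \<eta> x \<in> K"
        using T1[of \<gamma>] by (auto simp: curve_at_def)
      let ?v = "vector_derivative (\<delta> \<circ> \<gamma>) (at 0)"
      have a: "(\<eta> \<circ> \<gamma> has_vector_derivative A ?v) (at 0)"
        using A g curve_at_has_vector_derivative[OF \<gamma> d] by blast
      then have "A ?v \<in> K" by (rule has_vector_derivative_in_subspace[OF K(1)]) (use g in simp)
      moreover have "?v = B (A ?v)" using B(3)[OF g(1,2) a] by (rule vector_derivative_at)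
      ultimately show "?v \<in> B ` K" by blast
    qed
    show "B ` K \<subseteq> coord_tangent M T \<delta> x"
    proof clarify
      fix v assume v: "v \<in> K"
      then obtain \<gamma> where \<gamma>: "\<gamma> 0 = x" "limitin (top_of_set (points M)) \<gamma> x (at 0)"
        "\<forall>\<^sub>F t in at 0. \<gamma> t \<in> U \<and> \<eta> (\<gamma> t) = \<eta> x + t *\<^sub>R v" "(\<eta> \<circ> \<gamma> has_vector_derivative v) (at 0)"
        using chart_line[OF cc M(1) c(2), of v] K by blast
      have "limitin T \<gamma> x (at 0)"
        using \<gamma>(3) v by (intro T2 \<gamma>) (auto elim!: eventually_mono intro: subspace_scale[OF K(1)])
      then have "curve_at M T x \<gamma>" using curve_atI[OF M c(1) r c(2) \<gamma>(1) _ \<gamma>(2,4)] by blast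
      then show "B v \<in> coord_tangent M T \<delta> x"
        unfolding coord_tangent_def using vector_derivative_at[OF B(3)[OF \<gamma>(1,2,4)]] by force
    qed
  qed
  moreover have "inj_on B K" using B(2) K(2) by (rule inj_on_subset)
  ultimately show "subspace (coord_tangent M T \<delta> x)" "dim (coord_tangent M T \<delta> x) = dim K"
    using B(1) K(1) by (simp_all add: linear_subspace_image dim_image_eq span_eq_iff[THEN iffD2])
qed

text \<open>\<open>\<Theta>\<close> sends a coordinate vector in \<open>\<delta>\<close> to the
  family of its coordinates in all charts. It serves to move sums, differences and bijectivity
  between \<open>tangent_space\<close> and the Euclidean type.\<close>

lemma tangent_space_coordinates:
  assumes M: "C_manifold r M" and r: "1 \<le> r" and d: "(D, \<delta>) \<in> atlas M" and x: "x \<in> D"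
  obtains \<Theta> where "\<And>a b. \<Theta> (a + b) = \<Theta> a + \<Theta> b" "\<And>a b. \<Theta> (a - b) = \<Theta> a - \<Theta> b"
    "inj_on \<Theta> (model M)"
    "\<And>\<gamma>. curve_at M (top_of_set (points M)) x \<gamma> \<Longrightarrow>
        velocity M x \<gamma> = \<Theta> (vector_derivative (\<delta> \<circ> \<gamma>) (at 0))"
proof -
  have E: "subspace (model M)" and ch: "\<And>c. c \<in> atlas M \<Longrightarrow> is_chart M c"
    and tr: "\<And>c d. c \<in> atlas M \<Longrightarrow> d \<in> atlas M \<Longrightarrow> C_transition r M c d"
    using M by (auto simp: C_manifold_def)
  have "\<exists>T. linear T \<and> inj_on T (model M) \<and> (\<forall>\<gamma> v. \<gamma> 0 = x \<longrightarrow> limitin (top_of_set (points M)) \<gamma> x (at 0) \<longrightarrow>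
      (\<delta> \<circ> \<gamma> has_vector_derivative v) (at 0) \<longrightarrow> (snd c \<circ> \<gamma> has_vector_derivative T v) (at 0))"
    if "c \<in> atlas M" "x \<in> fst c" for c
    using chart_change[OF ch[OF d] ch[of "(fst c, snd c)"] E tr tr r x] d that
        by (metis prod.collapse)
  then obtain T where T: "\<And>c. c \<in> atlas M \<Longrightarrow> x \<in> fst c \<Longrightarrow> linear (T c)"
    "\<And>c. c \<in> atlas M \<Longrightarrow> x \<in> fst c \<Longrightarrow> inj_on (T c) (model M)"
    "\<And>c \<gamma> v. c \<in> atlas M \<Longrightarrow> x \<in> fst c \<Longrightarrow> \<gamma> 0 = x \<Longrightarrow> limitin (top_of_set (points M)) \<gamma> x (at 0) \<Longrightarrow>
      (\<delta> \<circ> \<gamma> has_vector_derivative v) (at 0) \<Longrightarrow> (snd c \<circ> \<gamma> has_vector_derivative T c v) (at 0)"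
    by metis
  \<comment> \<open>The value 0 off the charts around \<open>x\<close> repeats the convention of
    \<open>velocity\<close>, so that the two families agree as functions.\<close>
  define \<Theta> where "\<Theta> a c = (if c \<in> atlas M \<and> x \<in> fst c then T c a else 0)" for a c
  show ?thesis
  proof (rule that)
    show "\<Theta> (a + b) = \<Theta> a + \<Theta> b" "\<Theta> (a - b) = \<Theta> a - \<Theta> b" for a b
      using T(1) by (auto simp: \<Theta>_def linear_add linear_diff)
    show "inj_on \<Theta> (model M)"
    proof (rule inj_onI)
      fix a b assume ab: "a \<in> model M" "b \<in> model M" "\<Theta> a = \<Theta> b"
      then have "T (D, \<delta>) a = T (D, \<delta>) b" using d x by (metis \<Theta>_def fst_conv)
      then show "a = b" using T(2)[OF d] x ab by (auto dest: inj_onD)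
    qed
    fix \<gamma> assume \<gamma>: "curve_at M (top_of_set (points M)) x \<gamma>"
    show "velocity M x \<gamma> = \<Theta> (vector_derivative (\<delta> \<circ> \<gamma>) (at 0))"
    proof (rule ext, clarify)
      fix V \<xi>
      show "velocity M x \<gamma> (V, \<xi>) = \<Theta> (vector_derivative (\<delta> \<circ> \<gamma>) (at 0)) (V, \<xi>)"
        using T(3)[of "(V, \<xi>)" \<gamma>, OF _ _ _ _ curve_at_has_vector_derivative[OF \<gamma> d x]] \<gamma>
        by (auto simp: velocity_def \<Theta>_def curve_at_def intro: vector_derivative_at)
    qed
  qed
qed

lemma tangent_space_eq_image:
  assumes "\<And>\<gamma>. curve_at M (top_of_set (points M)) x \<gamma> \<Longrightarrow>
      velocity M x \<gamma> = \<Theta> (vector_derivative (\<delta> \<circ> \<gamma>) (at 0))"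
    and "\<And>\<gamma>. curve_at M T x \<gamma> \<Longrightarrow> curve_at M (top_of_set (points M)) x \<gamma>"
  shows "tangent_space M T x = \<Theta> ` coord_tangent M T \<delta> x"
  unfolding tangent_space_def coord_tangent_def image_image using assms by (intro image_cong) auto

section \<open>Leaf topologies and products\<close>

text \<open>The sets that satisfy the eventuality condition are closed under finite intersections
  and arbitrary unions, so testing subbasic sets is enough.\<close>

lemma limitin_topology_generated_by:
  "limitin (topology_generated_by \<S>) f l F \<longleftrightarrow>
    l \<in> \<Union>\<S> \<and> (\<forall>U\<in>\<S>. l \<in> U \<longrightarrow> (\<forall>\<^sub>F t in F. f t \<in> U))"
proof
  assume "limitin (topology_generated_by \<S>) f l F"
  then show "l \<in> \<Union>\<S> \<and> (\<forall>U\<in>\<S>. l \<in> U \<longrightarrow> (\<forall>\<^sub>F t in F. f t \<in> U))"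
    using topology_generated_by_Basis by (auto simp: limitin_def)
next
  assume *: "l \<in> \<Union>\<S> \<and> (\<forall>U\<in>\<S>. l \<in> U \<longrightarrow> (\<forall>\<^sub>F t in F. f t \<in> U))"
  have "\<forall>\<^sub>F t in F. f t \<in> U" if "generate_topology_on \<S> U" "l \<in> U" for U
    using that
  proof induction
    case (Int a b)
    then show ?case by (simp add: eventually_conj)
  next
    case (UN K)
    then obtain k where k: "k \<in> K" "l \<in> k" by blast
    show ?case using UN.IH[OF k] by eventually_elim (use k in blast)
  qed (use * in auto)
  then show "limitin (topology_generated_by \<S>) f l F"
    using * by (auto simp: limitin_def openin_topology_generated_by_iff)
qed

lemma limitin_leaf_topology:
  assumes "subspace (leaf_model F)"
  shows "limitin (leaf_topology F) \<gamma> x G \<longleftrightarrow> x \<in> \<Union> (fst ` fol_charts F) \<and>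
    (\<forall>U \<psi> W y. (U, \<psi>) \<in> fol_charts F \<longrightarrow> open W \<longrightarrow> y \<in> U \<longrightarrow> x \<in> U \<inter> W \<longrightarrow> \<psi> x - \<psi> y \<in> leaf_model F \<longrightarrow>
      (\<forall>\<^sub>F t in G. \<gamma> t \<in> U \<inter> W \<and> \<psi> (\<gamma> t) - \<psi> y \<in> leaf_model F))"
proof -
  let ?S = "{{x \<in> U \<inter> W. \<psi> x - \<psi> y \<in> leaf_model F} | U \<psi> W y. (U, \<psi>) \<in> fol_charts F \<and> open W \<and> y \<in> U}"
  have "x \<in> \<Union>?S \<longleftrightarrow> x \<in> \<Union> (fst ` fol_charts F)"
  proof
    assume "x \<in> \<Union> (fst ` fol_charts F)"
    then obtain U \<psi> where "(U, \<psi>) \<in> fol_charts F" "x \<in> U" by auto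
    then have "{z \<in> U \<inter> UNIV. \<psi> z - \<psi> x \<in> leaf_model F} \<in> ?S"
      using open_UNIV by blast
    moreover have "x \<in> {z \<in> U \<inter> UNIV. \<psi> z - \<psi> x \<in> leaf_model F}"
      using subspace_0[OF assms] \<open>x \<in> U\<close> by auto
    ultimately show "x \<in> \<Union>?S" by blast
  qed force
  moreover have "(\<forall>V\<in>?S. x \<in> V \<longrightarrow> (\<forall>\<^sub>F t in G. \<gamma> t \<in> V)) \<longleftrightarrow>
    (\<forall>U \<psi> W y. (U, \<psi>) \<in> fol_charts F \<longrightarrow> open W \<longrightarrow> y \<in> U \<longrightarrow> x \<in> U \<inter> W \<longrightarrow> \<psi> x - \<psi> y \<in> leaf_model F \<longrightarrow>
      (\<forall>\<^sub>F t in G. \<gamma> t \<in> U \<inter> W \<and> \<psi> (\<gamma> t) - \<psi> y \<in> leaf_model F))"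
    (is "?l \<longleftrightarrow> ?r")
  proof
    assume l: ?l
    show ?r
    proof (intro allI impI)
      fix U \<psi> W y
      assume a: "(U, \<psi>) \<in> fol_charts F" "open W" "y \<in> U" "x \<in> U \<inter> W" "\<psi> x - \<psi> y \<in> leaf_model F"
      let ?V = "{x \<in> U \<inter> W. \<psi> x - \<psi> y \<in> leaf_model F}"
      have V: "?V \<in> ?S" unfolding mem_Collect_eq
        by (intro exI[of _ U] exI[of _ \<psi>] exI[of _ W] exI[of _ y] conjI refl a)
      have x: "x \<in> ?V" using a by simp
      from bspec[OF l V, THEN mp, OF x] have "\<forall>\<^sub>F t in G. \<gamma> t \<in> ?V" .
      then show "\<forall>\<^sub>F t in G. \<gamma> t \<in> U \<inter> W \<and> \<psi> (\<gamma> t) - \<psi> y \<in> leaf_model F" by simp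
    qed
  next
    assume r: ?r
    show ?l
    proof (intro ballI impI)
      fix V assume VS: "V \<in> ?S" and x: "x \<in> V"
      obtain U \<psi> W y where V: "V = {x \<in> U \<inter> W. \<psi> x - \<psi> y \<in> leaf_model F}"
        and a: "(U, \<psi>) \<in> fol_charts F" "open W" "y \<in> U"
        using VS unfolding mem_Collect_eq by (elim exE conjE)
      have x: "x \<in> U \<inter> W" "\<psi> x - \<psi> y \<in> leaf_model F" using x unfolding V by simp_all
      from r[rule_format, OF a x] show "\<forall>\<^sub>F t in G. \<gamma> t \<in> V" unfolding V by simp
    qed
  qed
  ultimately show ?thesis
    unfolding leaf_topology_def limitin_topology_generated_by by (simp only:)
qed

lemma C_foliationD:
  assumes "C_foliation r M F"
  shows "subspace (leaf_model F)" "leaf_model F \<subseteq> model M" "fol_charts F \<subseteq> C_charts r M"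
    "\<Union> (fst ` fol_charts F) = points M"
  using assms by (auto simp: C_foliation_def)

text \<open>Both claims come from the subbasic sets with reference point \<open>x\<close> itself:
  the plaque through \<open>x\<close> gives the second, and intersecting it with arbitrary open
  \<open>W\<close> gives the first.\<close>

lemma limitin_leaf_topology_imp:
  assumes F: "C_foliation r M F" and c: "(U, \<psi>) \<in> fol_charts F" "x \<in> U"
    and lim: "limitin (leaf_topology F) \<gamma> x G"
  shows "limitin (top_of_set (points M)) \<gamma> x G" "\<forall>\<^sub>F t in G. \<psi> (\<gamma> t) - \<psi> x \<in> leaf_model F"
proof -
  have "is_chart M (U, \<psi>)" using C_foliationD(3)[OF F] c(1) by (auto simp: C_charts_def)
  then have U: "U \<subseteq> points M" by (rule is_chartD)
  have ev: "\<forall>\<^sub>F t in G. \<gamma> t \<in> U \<inter> W \<and> \<psi> (\<gamma> t) - \<psi> x \<in> leaf_model F" if "open W" "x \<in> W" for W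
    using lim that c subspace_0[OF C_foliationD(1)[OF F]]
    unfolding limitin_leaf_topology[OF C_foliationD(1)[OF F]] by auto
  show "\<forall>\<^sub>F t in G. \<psi> (\<gamma> t) - \<psi> x \<in> leaf_model F"
    using ev[of UNIV] by (auto elim: eventually_mono)
  have "(\<gamma> \<longlongrightarrow> x) G"
  proof (rule topological_tendstoI)
    show "\<forall>\<^sub>F t in G. \<gamma> t \<in> W" if "open W" "x \<in> W" for W
      using ev[OF that] by eventually_elim simp
  qed
  moreover have "\<forall>\<^sub>F t in G. \<gamma> t \<in> points M"
    using ev[of UNIV] U by (auto elim: eventually_mono)
  ultimately show "limitin (top_of_set (points M)) \<gamma> x G"
    using U c(2) by (auto simp: limitin_top_of_set)
qed

text \<open>One foliated chart decides convergence: near \<open>x\<close> the local compatibility of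
  foliated charts turns membership in the plaque of \<open>\<psi>\<close> into membership in that of
  \<open>\<xi>\<close>, and adding \<open>\<xi> x - \<xi> y\<close> moves the reference point from
  \<open>x\<close> to \<open>y\<close>.\<close>

lemma limitin_leaf_topologyI:
  assumes F: "C_foliation r M F" and c: "(U, \<psi>) \<in> fol_charts F" "x \<in> U"
    and lim: "limitin (top_of_set (points M)) \<gamma> x G"
    and ev: "\<forall>\<^sub>F t in G. \<gamma> t \<in> U \<and> \<psi> (\<gamma> t) - \<psi> x \<in> leaf_model F"
  shows "limitin (leaf_topology F) \<gamma> x G"
  unfolding limitin_leaf_topology[OF C_foliationD(1)[OF F]]
proof (intro conjI allI impI)
  show "x \<in> \<Union> (fst ` fol_charts F)" using c by force
  fix V \<xi> W y
  assume d: "(V, \<xi>) \<in> fol_charts F" "open W" "y \<in> V" "x \<in> V \<inter> W" "\<xi> x - \<xi> y \<in> leaf_model F"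
  from F have "\<forall>(U, \<psi>)\<in>fol_charts F. \<forall>(V, \<xi>)\<in>fol_charts F. \<forall>x\<in>U \<inter> V. \<exists>W. open W \<and> x \<in> W \<and>
      (\<forall>y\<in>U \<inter> V \<inter> W. \<forall>z\<in>U \<inter> V \<inter> W. \<psi> y - \<psi> z \<in> leaf_model F \<longrightarrow> \<xi> y - \<xi> z \<in> leaf_model F)"
    unfolding C_foliation_def by (elim conjE)
  from bspec[OF bspec[OF this c(1), unfolded prod.case] d(1), unfolded prod.case]
  obtain W' where W': "open W'" "x \<in> W'"
    "\<forall>y\<in>U \<inter> V \<inter> W'. \<forall>z\<in>U \<inter> V \<inter> W'. \<psi> y - \<psi> z \<in> leaf_model F \<longrightarrow> \<xi> y - \<xi> z \<in> leaf_model F"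
    using c(2) d(4) by blast
  have "is_chart M (V, \<xi>)" using C_foliationD(3)[OF F] d(1) by (auto simp: C_charts_def)
  then have "openin (top_of_set (points M)) V" by (rule is_chartD)
  then have "\<forall>\<^sub>F t in G. \<gamma> t \<in> V" using limitin_eventually_openin[OF lim] d(4) by blast
  moreover have "\<forall>\<^sub>F t in G. \<gamma> t \<in> W \<inter> W'"
    using lim d(2,4) W'(1,2) unfolding limitin_top_of_set by (intro topological_tendstoD[of \<gamma>]) auto
  ultimately show "\<forall>\<^sub>F t in G. \<gamma> t \<in> V \<inter> W \<and> \<xi> (\<gamma> t) - \<xi> y \<in> leaf_model F"
    using ev
  proof eventually_elim
    case (elim t)
    then have "\<xi> (\<gamma> t) - \<xi> x \<in> leaf_model F" using W' c(2) d(4) by auto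
    from subspace_add[OF C_foliationD(1)[OF F] this d(5)] show ?case using elim by simp
  qed
qed

lemma curve_at_leaf_topology:
  assumes F: "C_foliation r M F" and \<gamma>: "curve_at M (leaf_topology F) x \<gamma>"
  shows "curve_at M (top_of_set (points M)) x \<gamma>"
proof -
  have "x \<in> \<Union> (fst ` fol_charts F)"
    using curve_atD(2)[OF \<gamma>] by (simp add: limitin_leaf_topology[OF C_foliationD(1)[OF F]])
  then obtain U \<psi> where "(U, \<psi>) \<in> fol_charts F" "x \<in> U" by auto
  then show ?thesis
    using limitin_leaf_topology_imp(1)[OF F _ _ curve_atD(2)[OF \<gamma>]] \<gamma> by (auto simp: curve_at_def)
qed

lemma coord_tangent_leaf:
  assumes M: "C_manifold r M" and F: "C_foliation r M F" and r: "1 \<le> r"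
    and d: "(D, \<delta>) \<in> atlas M" "x \<in> D"
  shows "subspace (coord_tangent M (leaf_topology F) \<delta> x)"
    "dim (coord_tangent M (leaf_topology F) \<delta> x) = dim (leaf_model F)"
    "coord_tangent M (leaf_topology F) \<delta> x \<subseteq> model M"
proof -
  have E: "subspace (model M)" "\<forall>c\<in>atlas M. is_chart M c" using M by (auto simp: C_manifold_def)
  have "x \<in> points M" using is_chartD(5)[of M D \<delta>] E(2) d by blast
  then obtain U \<psi> where c: "(U, \<psi>) \<in> fol_charts F" "x \<in> U"
    using C_foliationD(4)[OF F, symmetric] by auto
  have cC: "(U, \<psi>) \<in> C_charts r M" using C_foliationD(3)[OF F] c by blast
  show "subspace (coord_tangent M (leaf_topology F) \<delta> x)"
    "dim (coord_tangent M (leaf_topology F) \<delta> x) = dim (leaf_model F)"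
    using coord_tangent_slice[OF E d cC c(2) r C_foliationD(1,2)[OF F], of "leaf_topology F"]
      limitin_leaf_topology_imp[OF F c] limitin_leaf_topologyI[OF F c] by blast+
  have "coord_tangent M (leaf_topology F) \<delta> x \<subseteq> coord_tangent M (top_of_set (points M)) \<delta> x"
    unfolding coord_tangent_def using curve_at_leaf_topology[OF F] by blast
  then show "coord_tangent M (leaf_topology F) \<delta> x \<subseteq> model M"
    using coord_tangent_top[OF E atlas_subset_C_charts[OF M] d(1) r d(2)] by simp
qed

lemma subspace_prod: "subspace A \<Longrightarrow> subspace B \<Longrightarrow> subspace (A \<times> B)"
  by (auto simp: subspace_def zero_prod_def)

text \<open>Subbasic conditions on one factor become conditions on the product by pairing them with
  a fixed chart around the other component and with \<open>UNIV\<close>; conversely, the open set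
  \<open>W\<close> of a product condition is shrunk to a box around \<open>z\<close>. This gives
  access to curves in leaves of the product without describing those leaves.\<close>

lemma limitin_leaf_topology_prod:
  fixes \<gamma> :: "'t \<Rightarrow> 'a::topological_space \<times> 'b::topological_space"
    and F :: "('a, 'e::real_normed_vector) foliation" and F' :: "('b, 'f::real_normed_vector) foliation"
  assumes F: "subspace (leaf_model F)" "subspace (leaf_model F')"
  shows "limitin (leaf_topology (prod_foliation F F')) \<gamma> z G \<longleftrightarrow>
    limitin (leaf_topology F) (fst \<circ> \<gamma>) (fst z) G \<and> limitin (leaf_topology F') (snd \<circ> \<gamma>) (snd z) G"
    (is "?l \<longleftrightarrow> ?r")
proof -
  have FF: "subspace (leaf_model (prod_foliation F F'))"
    using F by (simp add: prod_foliation_def subspace_prod)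
  have pc: "(W, h) \<in> fol_charts (prod_foliation F F') \<longleftrightarrow>
     (\<exists>U \<psi> V \<xi>. W = U \<times> V \<and> h = map_prod \<psi> \<xi> \<and> (U, \<psi>) \<in> fol_charts F \<and> (V, \<xi>) \<in> fol_charts F')" for W h
    by (auto simp: prod_foliation_def prod_charts_def)
  have lm: "leaf_model (prod_foliation F F') = leaf_model F \<times> leaf_model F'"
    by (simp add: prod_foliation_def)
  show ?thesis
  proof
    assume l: ?l
    then have "z \<in> \<Union> (fst ` fol_charts (prod_foliation F F'))"
        by (simp add: limitin_leaf_topology[OF FF])
    then obtain U0 \<psi>0 V0 \<xi>0 where c0: "(U0, \<psi>0) \<in> fol_charts F" "(V0, \<xi>0) \<in> fol_charts F'"
      "fst z \<in> U0" "snd z \<in> V0" using pc by fastforce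
    have ev: "\<forall>\<^sub>F t in G. \<gamma> t \<in> (U \<times> V) \<inter> W \<and> map_prod \<psi> \<xi> (\<gamma> t) - map_prod \<psi> \<xi> y \<in> leaf_model F \<times> leaf_model F'"
      if "(U, \<psi>) \<in> fol_charts F" "(V, \<xi>) \<in> fol_charts F'" "open W" "y \<in> U \<times> V" "z \<in> (U \<times> V) \<inter> W"
        "map_prod \<psi> \<xi> z - map_prod \<psi> \<xi> y \<in> leaf_model F \<times> leaf_model F'" for U \<psi> V \<xi> W y
    proof -
      have "(U \<times> V, map_prod \<psi> \<xi>) \<in> fol_charts (prod_foliation F F')" using that pc by blast
      from l[unfolded limitin_leaf_topology[OF FF] lm, THEN conjunct2, rule_format, OF this that(3-6)]
      show ?thesis .
    qed
    show ?r
      unfolding limitin_leaf_topology[OF F(1)] limitin_leaf_topology[OF F(2)]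
    proof (intro conjI allI impI)
      show "fst z \<in> \<Union> (fst ` fol_charts F)" "snd z \<in> \<Union> (fst ` fol_charts F')" using c0 by force+
    next
      fix U \<psi> W y assume a: "(U, \<psi>) \<in> fol_charts F" "open W" "y \<in> U" "fst z \<in> U \<inter> W"
          "\<psi> (fst z) - \<psi> y \<in> leaf_model F"
      then have "\<forall>\<^sub>F t in G. \<gamma> t \<in> (U \<times> V0) \<inter> (W \<times> UNIV) \<and>
        map_prod \<psi> \<xi>0 (\<gamma> t) - map_prod \<psi> \<xi>0 (y, snd z) \<in> leaf_model F \<times> leaf_model F'"
        using c0 subspace_0[OF F(2)]
        by (intro ev) (auto simp: open_Times mem_Times_iff split: prod.splits)
      then show "\<forall>\<^sub>F t in G. (fst \<circ> \<gamma>) t \<in> U \<inter> W \<and> \<psi> ((fst \<circ> \<gamma>) t) - \<psi> y \<in> leaf_model F"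
        by eventually_elim (auto simp: mem_Times_iff)
    next
      fix V \<xi> W y assume a: "(V, \<xi>) \<in> fol_charts F'" "open W" "y \<in> V" "snd z \<in> V \<inter> W"
          "\<xi> (snd z) - \<xi> y \<in> leaf_model F'"
      then have "\<forall>\<^sub>F t in G. \<gamma> t \<in> (U0 \<times> V) \<inter> (UNIV \<times> W) \<and>
        map_prod \<psi>0 \<xi> (\<gamma> t) - map_prod \<psi>0 \<xi> (fst z, y) \<in> leaf_model F \<times> leaf_model F'"
        using c0 subspace_0[OF F(1)]
        by (intro ev) (auto simp: open_Times mem_Times_iff split: prod.splits)
      then show "\<forall>\<^sub>F t in G. (snd \<circ> \<gamma>) t \<in> V \<inter> W \<and> \<xi> ((snd \<circ> \<gamma>) t) - \<xi> y \<in> leaf_model F'"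
        by eventually_elim (auto simp: mem_Times_iff)
    qed
  next
    assume r: ?r
    show ?l
      unfolding limitin_leaf_topology[OF FF] lm
    proof (intro conjI allI impI)
      obtain U0 \<psi>0 V0 \<xi>0 where c0: "(U0, \<psi>0) \<in> fol_charts F" "(V0, \<xi>0) \<in> fol_charts F'"
        "fst z \<in> U0" "snd z \<in> V0" 
        using r[THEN conjunct1, unfolded limitin_leaf_topology[OF F(1)], THEN conjunct1]
          r[THEN conjunct2, unfolded limitin_leaf_topology[OF F(2)], THEN conjunct1] by auto
      then have "(U0 \<times> V0, map_prod \<psi>0 \<xi>0) \<in> fol_charts (prod_foliation F F')" "z \<in> U0 \<times> V0"
        using pc by (auto simp: mem_Times_iff)
      then show "z \<in> \<Union> (fst ` fol_charts (prod_foliation F F'))" by force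
    next
      fix UV h W y assume a: "(UV, h) \<in> fol_charts (prod_foliation F F')" "open W" "y \<in> UV"
          "z \<in> UV \<inter> W"
        "h z - h y \<in> leaf_model F \<times> leaf_model F'"
      then obtain U \<psi> V \<xi> where h: "UV = U \<times> V" "h = map_prod \<psi> \<xi>" "(U, \<psi>) \<in> fol_charts F"
          "(V, \<xi>) \<in> fol_charts F'"
        using pc by auto
      obtain W1 W2 where W: "open W1" "open W2" "z \<in> W1 \<times> W2" "W1 \<times> W2 \<subseteq> W"
        using a(2,4) open_prod_elim by (metis IntD2)
      have z: "fst z \<in> U" "snd z \<in> V" "fst y \<in> U" "snd y \<in> V" "fst z \<in> W1" "snd z \<in> W2"
        "\<psi> (fst z) - \<psi> (fst y) \<in> leaf_model F" "\<xi> (snd z) - \<xi> (snd y) \<in> leaf_model F'"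
        using a h W by (auto simp: mem_Times_iff)
      have "\<forall>\<^sub>F t in G. (fst \<circ> \<gamma>) t \<in> U \<inter> W1 \<and> \<psi> ((fst \<circ> \<gamma>) t) - \<psi> (fst y) \<in> leaf_model F"
        using r h W z unfolding limitin_leaf_topology[OF F(1)] by blast
      moreover have "\<forall>\<^sub>F t in G. (snd \<circ> \<gamma>) t \<in> V \<inter> W2 \<and> \<xi> ((snd \<circ> \<gamma>) t) - \<xi> (snd y) \<in> leaf_model F'"
        using r h W z unfolding limitin_leaf_topology[OF F(2)] by blast
      ultimately show "\<forall>\<^sub>F t in G. \<gamma> t \<in> UV \<inter> W \<and> h (\<gamma> t) - h y \<in> leaf_model F \<times> leaf_model F'"
      proof eventually_elim
        case (elim t)
        then have "\<gamma> t \<in> W1 \<times> W2" by (simp add: mem_Times_iff)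
        then have "\<gamma> t \<in> W" by (rule subsetD[OF W(4)])
        then show ?case using elim
          by (simp add: h mem_Times_iff map_prod_def case_prod_unfold)
      qed
    qed
  qed
qed

section \<open>Charts and curves of products\<close>

lemma atlas_prod_mfd:
  "c \<in> atlas (prod_mfd M N) \<longleftrightarrow>
    (\<exists>U \<psi> V \<xi>. c = (U \<times> V, map_prod \<psi> \<xi>) \<and> (U, \<psi>) \<in> atlas M \<and> (V, \<xi>) \<in> atlas N)"
  by (auto simp: prod_mfd_def prod_charts_def)

lemma continuous_on_map_pair:
  assumes "continuous_on A f" "continuous_on B g"
  shows "continuous_on (A \<times> B) (\<lambda>z. (f (fst z), g (snd z)))"
proof (rule continuous_on_Pair)
  show "continuous_on (A \<times> B) (\<lambda>z. f (fst z))"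
    by (rule continuous_on_compose2[OF assms(1) continuous_on_fst[OF continuous_on_id]]) auto
  show "continuous_on (A \<times> B) (\<lambda>z. g (snd z))"
    by (rule continuous_on_compose2[OF assms(2) continuous_on_snd[OF continuous_on_id]]) auto
qed

lemma is_chart_prod:
  fixes M :: "('a::{t2_space,second_countable_topology}, 'e::euclidean_space) mfd"
    and N :: "('b::{t2_space,second_countable_topology}, 'f::euclidean_space) mfd"
  assumes "is_chart M (U, \<psi>)" "is_chart N (V, \<xi>)"
  shows "is_chart (prod_mfd M N) (U \<times> V, map_prod \<psi> \<xi>)"
proof -
  note c = is_chartD[OF assms(1)] and d = is_chartD[OF assms(2)]
  have im: "map_prod \<psi> \<xi> ` (U \<times> V) = \<psi> ` U \<times> \<xi> ` V" by (auto simp: map_prod_def image_iff)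
  have inj: "inj_on (map_prod \<psi> \<xi>) (U \<times> V)" using c(4) d(4) by (rule map_prod_inj_on)
  have "homeomorphism (U \<times> V) (\<psi> ` U \<times> \<xi> ` V) (map_prod \<psi> \<xi>) (map_prod (inv_into U \<psi>) (inv_into V \<xi>))"
  proof -
    have "continuous_on (U \<times> V) (\<lambda>z. (\<psi> (fst z), \<xi> (snd z)))"
      "continuous_on (\<psi> ` U \<times> \<xi> ` V) (\<lambda>z. (inv_into U \<psi> (fst z), inv_into V \<xi> (snd z)))"
      using c(3) d(3) by (intro continuous_on_map_pair; simp add: homeomorphism_def)+
    moreover have "map_prod (inv_into U \<psi>) (inv_into V \<xi>) ` (\<psi> ` U \<times> \<xi> ` V) = U \<times> V"
      using c(4) d(4) by (force simp: image_iff)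
    ultimately show ?thesis
      unfolding homeomorphism_def im
      using c(4) d(4) by (auto simp: map_prod_def case_prod_unfold)
  qed
  \<comment> \<open>\<open>is_chart\<close> prescribes \<open>inv_into\<close> of the product map as
    the inverse, so the product of the two inverses has to be identified with it on the
    image.\<close>
  moreover have "inv_into (U \<times> V) (map_prod \<psi> \<xi>) w = map_prod (inv_into U \<psi>) (inv_into V \<xi>) w"
    if w: "w \<in> \<psi> ` U \<times> \<xi> ` V" for w
  proof -
    obtain a b where "w = map_prod \<psi> \<xi> (a, b)" "a \<in> U" "b \<in> V" using w by auto
    then show ?thesis using inv_into_f_f[OF inj, of "(a, b)"] c(4) d(4) by simp
  qed
  ultimately have "homeomorphism (U \<times> V) (\<psi> ` U \<times> \<xi> ` V) (map_prod \<psi> \<xi>) (inv_into (U \<times> V) (map_prod \<psi> \<xi>))"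
    by (auto intro: homeomorphism_cong)
  then show ?thesis
    unfolding is_chart_def using c(1,2) d(1,2) by (simp add: prod_mfd_def im openin_Times)
qed

lemma has_vector_derivative_fst_snd:
  assumes "(f has_vector_derivative w) (at t)"
  shows "((fst \<circ> f) has_vector_derivative fst w) (at t)"
      "((snd \<circ> f) has_vector_derivative snd w) (at t)"
  using bounded_linear.has_vector_derivative[OF bounded_linear_fst assms]
    bounded_linear.has_vector_derivative[OF bounded_linear_snd assms] by (simp_all add: o_def)

lemma curve_at_prod:
  fixes \<gamma> :: "real \<Rightarrow> 'a::{t2_space,second_countable_topology} \<times> 'b::{t2_space,second_countable_topology}"
    and M :: "('a, 'e::euclidean_space) mfd" and N :: "('b, 'f::euclidean_space) mfd"
  assumes "curve_at M T1 (fst z) (fst \<circ> \<gamma>)" "curve_at N T2 (snd z) (snd \<circ> \<gamma>)" "limitin T \<gamma> z (at 0)"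
  shows "curve_at (prod_mfd M N) T z \<gamma>"
  unfolding curve_at_def
proof (intro conjI assms ballI)
  show "\<gamma> 0 = z" using assms curve_atD(1) by (metis comp_apply prod_eqI)
  fix c assume "c \<in> atlas (prod_mfd M N)"
  then obtain U \<psi> V \<xi> where c: "c = (U \<times> V, map_prod \<psi> \<xi>)" "(U, \<psi>) \<in> atlas M" "(V, \<xi>) \<in> atlas N"
    by (auto simp: atlas_prod_mfd)
  have "map_prod \<psi> \<xi> \<circ> \<gamma> differentiable at 0" if "z \<in> U \<times> V"
  proof -
    have "fst z \<in> U" "snd z \<in> V" using that by (auto simp: mem_Times_iff)
    then obtain a b where "(\<psi> \<circ> (fst \<circ> \<gamma>) has_vector_derivative a) (at 0)"
      "(\<xi> \<circ> (snd \<circ> \<gamma>) has_vector_derivative b) (at 0)"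
      using curve_at_has_vector_derivative[OF assms(1) c(2)] curve_at_has_vector_derivative[OF assms(2) c(3)] by blast
    from has_vector_derivative_Pair[OF this]
    show ?thesis by (intro differentiableI_vector) (simp add: o_def map_prod_def case_prod_unfold)
  qed
  then show "case c of (U, \<psi>) \<Rightarrow> z \<in> U \<longrightarrow> \<psi> \<circ> \<gamma> differentiable at 0" using c by simp
qed

text \<open>The atlas of the product contains product charts only. To test one component in its
  chart, the other must be covered by some chart as well, hence the charts supplied around both
  components of \<open>z\<close>.\<close>

lemma curve_at_fst_snd:
  fixes \<gamma> :: "real \<Rightarrow> 'a::{t2_space,second_countable_topology} \<times> 'b::{t2_space,second_countable_topology}"
    and M :: "('a, 'e::euclidean_space) mfd" and N :: "('b, 'f::euclidean_space) mfd"
  assumes \<gamma>: "curve_at (prod_mfd M N) T z \<gamma>"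
    and at: "(U, \<psi>) \<in> atlas M" "fst z \<in> U" "(V, \<xi>) \<in> atlas N" "snd z \<in> V"
  shows "limitin T1 (fst \<circ> \<gamma>) (fst z) (at 0) \<Longrightarrow> curve_at M T1 (fst z) (fst \<circ> \<gamma>)"
    "limitin T2 (snd \<circ> \<gamma>) (snd z) (at 0) \<Longrightarrow> curve_at N T2 (snd z) (snd \<circ> \<gamma>)"
proof -
  have z: "\<gamma> 0 = z" using \<gamma> by (rule curve_atD)
  have vd: "(map_prod \<psi>' \<xi>' \<circ> \<gamma> has_vector_derivative vector_derivative (map_prod \<psi>' \<xi>' \<circ> \<gamma>) (at 0)) (at 0)"
    if "(U', \<psi>') \<in> atlas M" "fst z \<in> U'" "(V', \<xi>') \<in> atlas N" "snd z \<in> V'" for U' \<psi>' V' \<xi>'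
    using that
        by (intro curve_at_has_vector_derivative[OF \<gamma>, of "U' \<times> V'"]) (auto simp: atlas_prod_mfd mem_Times_iff)
  have "\<psi>' \<circ> (fst \<circ> \<gamma>) differentiable at 0" if "(U', \<psi>') \<in> atlas M" "fst z \<in> U'" for U' \<psi>'
    using has_vector_derivative_fst_snd(1)[OF vd[OF that at(3,4)]] differentiableI_vector
    by (fastforce simp: o_def)
  then show "limitin T1 (fst \<circ> \<gamma>) (fst z) (at 0) \<Longrightarrow> curve_at M T1 (fst z) (fst \<circ> \<gamma>)"
    using z by (auto simp: curve_at_def)
  have "\<xi>' \<circ> (snd \<circ> \<gamma>) differentiable at 0" if "(V', \<xi>') \<in> atlas N" "snd z \<in> V'" for V' \<xi>'
    using has_vector_derivative_fst_snd(2)[OF vd[OF at(1,2) that]] differentiableI_vector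
    by (fastforce simp: o_def)
  then show "limitin T2 (snd \<circ> \<gamma>) (snd z) (at 0) \<Longrightarrow> curve_at N T2 (snd z) (snd \<circ> \<gamma>)"
    using z by (auto simp: curve_at_def)
qed

section \<open>Slices\<close>

text \<open>\<open>D\<close> is injective only along \<open>K\<close>. The map \<open>g\<close>
  pairs \<open>f \<circ> q\<close> with the component \<open>y - q y\<close>, which makes its
  derivative injective on the whole space; on \<open>K\<close> that component vanishes, so
  injectivity of \<open>g\<close> becomes injectivity of \<open>f\<close>.\<close>

lemma C1_locally_injective_on_subspace:
  fixes f :: "'a::euclidean_space \<Rightarrow> 'b::euclidean_space"
  assumes K: "subspace K" "K \<subseteq> E" and X: "openin (top_of_set E) X"
    and f: "Ck_on (Suc 0) E f X" and e0: "e0 \<in> X" "e0 \<in> K"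
    and D: "(f has_derivative D) (at e0 within X)" and inj: "\<And>k. k \<in> K \<Longrightarrow> D k = 0 \<Longrightarrow> k = 0"
  obtains N where "open N" "e0 \<in> N" "inj_on f (N \<inter> K)"
proof -
  obtain q where q: "bounded_linear q" "\<And>x. q x \<in> K" "\<And>x. x \<in> K \<Longrightarrow> q x = x"
    using subspace_projection[OF K(1)] by blast
  obtain T where T: "open T" "X = E \<inter> T" using X by (auto simp: openin_open)
  let ?X = "q -` X"
  have "?X = q -` T" using q(2) K T by auto
  then have opX: "open ?X"
    using T(1) q(1)
        by (metis continuous_on_open_vimage inf_top.right_neutral linear_continuous_on open_UNIV)
  have e0X: "e0 \<in> ?X" "q e0 = e0" using e0 q(3) by auto
  define g where "g y = (f (q y), y + - q y)" for y
  have "Ck_on (Suc 0) UNIV (f \<circ> q) (q -` (X \<inter> K))"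
    by (rule Ck_on_extend[OF q(1,2)], rule Ck_on_subset[OF f]) (use K in auto)
  moreover have "q -` (X \<inter> K) = ?X" using q(2) by auto
  ultimately have "Ck_on (Suc 0) UNIV (f \<circ> q) ?X" by simp
  then obtain F' where F': "\<And>x. x \<in> ?X \<Longrightarrow> (f \<circ> q has_derivative F' x) (at x within ?X)"
    "\<And>v. continuous_on ?X (\<lambda>x. F' x v)" by auto
  define g' where "g' x v = (F' x v, v + - q v)" for x v
  have g': "(g has_derivative g' x) (at x)" if "x \<in> ?X" for x
  proof -
    have "(f \<circ> q has_derivative F' x) (at x)"
      using F'(1)[OF that] unfolding at_within_open[OF that opX] .
    then have "((\<lambda>y. ((f \<circ> q) y, y + - q y)) has_derivative (\<lambda>v. (F' x v, v + - q v))) (at x)"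
      by (intro has_derivative_Pair bounded_linear_imp_has_derivative bounded_linear_add bounded_linear_minus
          q(1) bounded_linear_ident)
    then show ?thesis by (simp add: g_def[abs_def] g'_def[abs_def])
  qed
  have "(f has_derivative D) (at (q e0) within q ` ?X)"
    unfolding e0X(2) using D by (rule has_derivative_subset) auto
  then have "(f \<circ> q has_derivative D \<circ> q) (at e0 within ?X)"
    using diff_chain_within[OF bounded_linear_imp_has_derivative[OF q(1)]] by blast
  then have "(f \<circ> q has_derivative D \<circ> q) (at e0)" unfolding at_within_open[OF e0X(1) opX] .
  moreover have "(f \<circ> q has_derivative F' e0) (at e0)"
    using F'(1)[OF e0X(1)] unfolding at_within_open[OF e0X(1) opX] .
  ultimately have F'e0: "F' e0 = D \<circ> q" by (rule has_derivative_unique[symmetric])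
  have lin: "linear (g' e0)" using g'[OF e0X(1)] by (rule has_derivative_linear)
  have "v = 0" if "g' e0 v = 0" for v
  proof -
    have v: "D (q v) = 0" "v = q v"
      using arg_cong[OF that, of fst] arg_cong[OF that, of snd] by (simp_all add: g'_def F'e0)
    then have "q v = 0" using inj[OF q(2)] by blast
    then show ?thesis using v(2) by simp
  qed
  then have "inj (g' e0)" using lin by (simp add: linear_injective_0)
  then obtain I where I: "linear I" "I \<circ> g' e0 = id"
    using lin linear_injective_left_inverse by blast
  \<comment> \<open>Local injectivity needs the derivative to vary continuously in operator norm.
    That norm is bounded by the values at finitely many basis vectors, where the second components
    of \<open>g'\<close> cancel.\<close>
  have onorm_small: "\<exists>d>0. \<forall>x. dist e0 x < d \<longrightarrow> onorm (\<lambda>v. g' x v - g' e0 v) < e" if e: "e > 0" for e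
  proof -
    have "((\<lambda>x. \<Sum>b\<in>Basis. norm (F' x b - F' e0 b)) \<longlongrightarrow> (\<Sum>b\<in>Basis. norm (F' e0 b - F' e0 b))) (at e0)"
    proof (intro tendsto_intros)
      show "((\<lambda>x. F' x v) \<longlongrightarrow> F' e0 v) (at e0)" for v
        using F'(2)[of v, unfolded continuous_on_def, rule_format, OF e0X(1)]
        unfolding at_within_open[OF e0X(1) opX] .
    qed
    then have "\<forall>\<^sub>F x in at e0. (\<Sum>b\<in>Basis. norm (F' x b - F' e0 b)) < e"
      by (rule order_tendstoD) (use e in simp)
    moreover have "\<forall>\<^sub>F x in at e0. x \<in> ?X"
      using opX e0X(1) by (auto simp: eventually_at_topological)
    ultimately have "\<forall>\<^sub>F x in at e0. onorm (\<lambda>v. g' x v - g' e0 v) < e"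
    proof eventually_elim
      case (elim x)
      have "bounded_linear (\<lambda>v. g' x v - g' e0 v)"
        using g'[of x] g'[of e0] elim e0X
            by (intro bounded_linear_sub) (auto intro: has_derivative_bounded_linear)
      then have "onorm (\<lambda>v. g' x v - g' e0 v) \<le> (\<Sum>b\<in>Basis. norm (g' x b - g' e0 b))"
        by (rule onorm_componentwise)
      also have "\<dots> = (\<Sum>b\<in>Basis. norm (F' x b - F' e0 b))" by (simp add: g'_def)
      finally show ?case using elim by simp
    qed
    then obtain d where d: "d > 0" "\<And>x. x \<noteq> e0 \<Longrightarrow> dist x e0 < d \<Longrightarrow> onorm (\<lambda>v. g' x v - g' e0 v) < e"
      unfolding eventually_at by blast
    have "onorm (\<lambda>v. g' e0 v - g' e0 v) < e" using e by (simp add: onorm_zero)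
    then show ?thesis using d by (metis dist_commute)
  qed
  obtain r where r: "r > 0" "ball e0 r \<subseteq> ?X" "inj_on g (ball e0 r)"
    using has_derivative_locally_injective[OF e0X(1) opX _ I(2) g' onorm_small] I(1)
    by (auto simp: linear_conv_bounded_linear)
  have "inj_on f (ball e0 r \<inter> K)"
  proof (rule inj_onI)
    fix a b assume ab: "a \<in> ball e0 r \<inter> K" "b \<in> ball e0 r \<inter> K" "f a = f b"
    then have "g a = g b" using q(3) by (simp add: g_def)
    then show "a = b" using r(3) ab by (auto dest: inj_onD)
  qed
  then show ?thesis using that[of "ball e0 r"] r(1) by simp
qed

text \<open>\<open>A\<close> maps the orthogonal complement of its kernel inside \<open>E\<close>
  isomorphically onto the image of \<open>E\<close>.\<close>

lemma dim_kernel_on_subspace: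
  fixes A :: "'a::euclidean_space \<Rightarrow> 'b::euclidean_space"
  assumes "linear A" "subspace E"
  shows "dim {v \<in> E. A v = 0} + dim (A ` E) = dim E"
proof -
  define N where "N = {v \<in> E. A v = 0}"
  define N' where "N' = {y \<in> E. \<forall>x\<in>N. orthogonal x y}"
  have N: "subspace N"
    using assms by (auto simp: N_def subspace_def linear_add linear_cmul linear_0)
  have N': "subspace N'"
    using assms(2) by (auto simp: N'_def subspace_def orthogonal_clauses)
  have d: "dim N' + dim N = dim E"
    unfolding N'_def using N assms(2)
        by (intro dim_subspace_orthogonal_to_vectors) (auto simp: N_def)
  have "A ` N' = A ` E"
  proof
    show "A ` E \<subseteq> A ` N'"
    proof
      fix w assume "w \<in> A ` E"
      then obtain x where x: "x \<in> E" "w = A x" by blast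
      obtain y z where yz: "y \<in> N" "\<And>w. w \<in> N \<Longrightarrow> orthogonal z w" "x = y + z"
        using orthogonal_subspace_decomp_exists[of N x] unfolding span_eq_iff[THEN iffD2, OF N]
            by blast
      have "z = x - y" using yz(3) by simp
      then have "z \<in> E" using x yz(1) assms(2) by (simp add: subspace_diff N_def)
      then have "z \<in> N'" using yz(2) by (auto simp: N'_def orthogonal_commute)
      moreover have "A z = w" using x yz assms(1) by (simp add: N_def linear_add)
      ultimately show "w \<in> A ` N'" by blast
    qed
  qed (auto simp: N'_def)
  moreover have "inj_on A N'"
  proof (rule inj_onI)
    fix a b assume ab: "a \<in> N'" "b \<in> N'" "A a = A b"
    then have "a - b \<in> N'" using N' subspace_diff by blast
    moreover have "a - b \<in> N" using ab assms by (auto simp: N_def N'_def subspace_diff linear_diff)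
    ultimately have "orthogonal (a - b) (a - b)" by (auto simp: N'_def)
    then show "a = b" by (simp add: orthogonal_def)
  qed
  ultimately have "dim (A ` E) = dim N'"
    using dim_image_eq[OF assms(1), of N'] N' by (metis span_eq_iff)
  then show ?thesis using d by (simp add: N_def)
qed

text \<open>The coordinates: a linear map \<open>\<alpha>\<close> that is an isomorphism from the kernel of the derivative of \<open>u\<close>
  onto \<open>K\<close>, plus \<open>u\<close> followed by an isomorphism onto the orthogonal complement of \<open>K\<close>.\<close>

lemma submersion_slice_coordinates:
  fixes u :: "'e::euclidean_space \<Rightarrow> 'e"
  assumes E: "subspace E" and L: "subspace L" "L \<subseteq> E" and K: "subspace K" "K \<subseteq> E"
    and dim: "dim K + dim L = dim E"
    and X: "openin (top_of_set E) X" and uL: "u ` X \<subseteq> L" and r: "C_on r E u X" "1 \<le> r"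
    and e0: "e0 \<in> X" and A: "(u has_derivative A) (at e0 within X)" and AE: "A ` E = L"
  obtains X' Y \<Psi> g where "openin (top_of_set E) X'" "X' \<subseteq> X" "e0 \<in> X'" "openin (top_of_set E) Y"
    "homeomorphism X' Y \<Psi> g" "C_on r E \<Psi> X'" "C_on r E g Y" "\<And>e. e \<in> X' \<Longrightarrow> \<Psi> e \<in> K \<longleftrightarrow> u e = 0"
proof -
  have lA: "linear A" using A by (rule has_derivative_linear)
  define N where "N = {v \<in> E. A v = 0}"
  define K' where "K' = {y \<in> E. \<forall>x\<in>K. orthogonal x y}"
  have N: "subspace N" using E lA by (auto simp: N_def subspace_def linear_add linear_cmul linear_0)
  have K': "subspace K'" using E by (auto simp: K'_def subspace_def orthogonal_clauses)
  have "dim N + dim L = dim E" using dim_kernel_on_subspace[OF lA E] AE by (simp add: N_def)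
  then have "dim N = dim K" using dim by simp
  \<comment> \<open>\<open>K\<close> is prescribed and agrees with the kernel \<open>N\<close> only
    in dimension; this yields an isometry between them, and preservation of norms gives injectivity
    at once.\<close>
  then obtain \<alpha>0 where \<alpha>0: "linear \<alpha>0" "\<alpha>0 ` N = K" "\<And>x. x \<in> N \<Longrightarrow> norm (\<alpha>0 x) = norm x"
    by (rule isometries_subspaces[OF N K(1)]) (rule that)
  have "dim K' + dim K = dim E" unfolding K'_def
      by (rule dim_subspace_orthogonal_to_vectors[OF K(1) E K(2)])
  then have "dim L = dim K'" using dim by simp
  then obtain \<beta> where \<beta>: "linear \<beta>" "\<beta> ` L = K'" "\<And>x. x \<in> L \<Longrightarrow> norm (\<beta> x) = norm x"
    by (rule isometries_subspaces[OF L(1) K']) (rule that)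
  obtain p where p: "bounded_linear p" "\<And>x. p x \<in> N" "\<And>x. x \<in> N \<Longrightarrow> p x = x"
    using subspace_projection[OF N] by blast
  have bl: "bounded_linear \<alpha>0" "bounded_linear \<beta>"
    using \<alpha>0(1) \<beta>(1) by (simp_all add: linear_conv_bounded_linear)
  define \<Psi> where "\<Psi> e = \<alpha>0 (p e) + \<beta> (u e)" for e
  have \<alpha>K: "\<alpha>0 (p e) \<in> K" for e using \<alpha>0(2) p(2) by blast
  have \<beta>K: "\<beta> w \<in> K'" if "w \<in> L" for w using \<beta>(2) that by blast
  have sum0: "a = 0 \<and> b = 0" if "a \<in> K" "b \<in> K'" "a + b = 0" for a b
  proof -
    have "orthogonal a b" "b = - a" using that by (auto simp: K'_def add_eq_0_iff)
    then show ?thesis by (simp add: orthogonal_def)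
  qed
  have slice: "\<Psi> e \<in> K \<longleftrightarrow> u e = 0" if "e \<in> X" for e
  proof
    assume "\<Psi> e \<in> K"
    then have "\<beta> (u e) \<in> K" using subspace_diff[OF K(1) _ \<alpha>K[of e], of "\<Psi> e"] by (simp add: \<Psi>_def)
    moreover have uL': "u e \<in> L" using uL that by blast
    ultimately have "orthogonal (\<beta> (u e)) (\<beta> (u e))" using \<beta>K by (auto simp: K'_def)
    then show "u e = 0" using \<beta>(3)[OF uL'] by (simp add: orthogonal_def)
  next
    assume "u e = 0"
    then show "\<Psi> e \<in> K" using \<alpha>K \<beta>(1) by (simp add: \<Psi>_def linear_0)
  qed
  have C: "C_on r E \<Psi> X"
    unfolding C_on_def
  proof (intro allI impI)
    fix k assume "enat k \<le> r"
    then have "Ck_on k E u X" using r(1) by (simp add: C_on_def)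
    then have "Ck_on k E (\<lambda>e. \<beta> (u e)) X" by (rule Ck_on_linear_compose[OF bl(2)])
    moreover have "Ck_on k E (\<lambda>e. \<alpha>0 (p e)) X"
      by (rule Ck_on_linear[OF bounded_linear_compose[OF bl(1) p(1)]])
    ultimately show "Ck_on k E \<Psi> X" unfolding \<Psi>_def[abs_def] by (intro Ck_on_add)
  qed
  have D: "(\<Psi> has_derivative (\<lambda>v. \<alpha>0 (p v) + \<beta> (A v))) (at e0 within X)"
    unfolding \<Psi>_def[abs_def]
    by (intro has_derivative_add bounded_linear_imp_has_derivative bounded_linear_compose[OF bl(1) p(1)]
        bounded_linear.has_derivative[OF bl(2)] A)
  obtain X' Y g where "openin (top_of_set E) X'" "X' \<subseteq> X" "e0 \<in> X'"
    "openin (top_of_set E) Y" "homeomorphism X' Y \<Psi> g" "C_on r E g Y"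
  proof (rule inverse_function_C_on[OF E X _ C r(2) e0 D])
    show "\<Psi> ` X \<subseteq> E"
      using \<alpha>K \<beta>K uL K
          by (auto simp: \<Psi>_def K'_def image_subset_iff subset_eq intro!: subspace_add[OF E])
    fix v assume v: "v \<in> E"
    then have "A v \<in> L" using AE by blast
    then show "\<alpha>0 (p v) + \<beta> (A v) \<in> E"
      using \<alpha>K[of v] \<beta>K[of "A v"] K by (intro subspace_add[OF E]) (auto simp: K'_def)
    assume "\<alpha>0 (p v) + \<beta> (A v) = 0"
    then have *: "\<alpha>0 (p v) = 0 \<and> \<beta> (A v) = 0" by (rule sum0[OF \<alpha>K \<beta>K[OF \<open>A v \<in> L\<close>]])
    then have "A v = 0" using \<beta>(3)[OF \<open>A v \<in> L\<close>] by simp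
    then have "v \<in> N" using v by (simp add: N_def)
    then show "v = 0" using * \<alpha>0(3)[of v] p(3) by simp
  qed blast
  then show ?thesis
    using that[of X' Y \<Psi> g] C slice by (meson C_on_def Ck_on_subset order_refl subsetD)
qed

section \<open>New charts from changes of coordinates\<close>

lemma C_on_compose:
  fixes f :: "'e::euclidean_space \<Rightarrow> 'b::euclidean_space" and g :: "'b \<Rightarrow> 'c::real_normed_vector"
  assumes "subspace E'" "C_on r E f X" "C_on r E' g Y" "f ` X \<subseteq> Y" "Y \<subseteq> E'"
  shows "C_on r E (g \<circ> f) X"
  unfolding C_on_def
proof (intro allI impI)
  fix k assume "enat k \<le> r"
  then show "Ck_on k E (g \<circ> f) X"
    using assms(2,3) by (intro Ck_on_compose[OF assms(1) _ _ assms(4,5)]) (simp_all add: C_on_def)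
qed

lemma C_on_cong: "(\<And>x. x \<in> X \<Longrightarrow> f x = g x) \<Longrightarrow> C_on r E f X \<Longrightarrow> C_on r E g X"
  unfolding C_on_def using Ck_on_cong by blast

lemma C_on_subset: "C_on r E f X \<Longrightarrow> Y \<subseteq> X \<Longrightarrow> C_on r E f Y"
  unfolding C_on_def using Ck_on_subset by blast

text \<open>Transitions out of the new chart are old ones preceded by \<open>g\<close>, transitions
  into it are old ones followed by \<open>\<Psi>\<close>. In this way straightening coordinates
  become members of the maximal atlas.\<close>

lemma C_charts_compose:
  fixes M :: "('a::{t2_space,second_countable_topology}, 'e::euclidean_space) mfd"
  assumes M: "C_manifold r M" and d: "(D, \<delta>) \<in> atlas M"
    and X: "openin (top_of_set (model M)) X" "X \<subseteq> \<delta> ` D" and Y: "openin (top_of_set (model M)) Y"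
    and hom: "homeomorphism X Y \<Psi> g" and C: "C_on r (model M) \<Psi> X" "C_on r (model M) g Y"
  shows "(D \<inter> \<delta> -` X, \<Psi> \<circ> \<delta>) \<in> C_charts r M"
proof -
  let ?E = "model M" and ?U = "D \<inter> \<delta> -` X"
  have E: "subspace ?E" and ch: "\<And>c. c \<in> atlas M \<Longrightarrow> is_chart M c"
    and tr: "\<And>c d. c \<in> atlas M \<Longrightarrow> d \<in> atlas M \<Longrightarrow> C_transition r M c d"
    using M by (auto simp: C_manifold_def)
  note c = is_chartD[OF ch[OF d]]
  have im: "\<delta> ` ?U = X" using X(2) by auto
  have XE: "X \<subseteq> ?E" using X(1) openin_imp_subset by blast
  have YE: "Y \<subseteq> ?E" using Y openin_imp_subset by blast
  have hom\<delta>: "homeomorphism ?U X \<delta> (inv_into D \<delta>)"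
    by (rule homeomorphism_of_subsets[OF c(3)]) (use X(2) im in auto)
  have hom2: "homeomorphism ?U Y (\<Psi> \<circ> \<delta>) (inv_into D \<delta> \<circ> g)"
    by (rule homeomorphism_compose[OF hom\<delta> hom])
  have img: "(\<Psi> \<circ> \<delta>) ` ?U = Y" using hom2 by (simp add: homeomorphism_def)
  have inj: "inj_on (\<Psi> \<circ> \<delta>) ?U" by (rule inj_on_inverseI) (rule homeomorphism_apply1[OF hom2])
  have inv: "inv_into ?U (\<Psi> \<circ> \<delta>) y = inv_into D \<delta> (g y)" if "y \<in> Y" for y
  proof -
    have "(inv_into D \<delta> \<circ> g) y \<in> ?U" "(\<Psi> \<circ> \<delta>) ((inv_into D \<delta> \<circ> g) y) = y"
      using hom2 that by (auto simp: homeomorphism_def simp del: o_apply)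
    then show ?thesis using inv_into_f_eq[OF inj] by (metis comp_apply)
  qed
  have op: "openin (top_of_set (points M)) ?U"
  proof -
    have "openin (top_of_set (\<delta> ` D)) X" using X c(6) openin_subset_trans by blast
    then have "openin (top_of_set D) ?U"
      using c(3)
          by (intro continuous_openin_preimage[of D \<delta> "\<delta> ` D"]) (auto simp: homeomorphism_def)
    then show ?thesis using c(1) openin_trans by blast
  qed
  have chart: "is_chart M (?U, \<Psi> \<circ> \<delta>)"
    unfolding is_chart_def using op Y homeomorphism_cong[OF hom2 refl refl] inv img by simp
  have "C_transition r M (?U, \<Psi> \<circ> \<delta>) (V, \<xi>) \<and> C_transition r M (V, \<xi>) (?U, \<Psi> \<circ> \<delta>)"
    if v: "(V, \<xi>) \<in> atlas M" for V \<xi>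
  proof
    have "C_on r ?E ((\<xi> \<circ> inv_into D \<delta>) \<circ> g) ((\<Psi> \<circ> \<delta>) ` (?U \<inter> V))"
    proof (rule C_on_compose[OF E])
      show "C_on r ?E g ((\<Psi> \<circ> \<delta>) ` (?U \<inter> V))" by (rule C_on_subset[OF C(2)]) (use img in blast)
      show "C_on r ?E (\<xi> \<circ> inv_into D \<delta>) (\<delta> ` (D \<inter> V))"
        using tr[OF d v] by (simp add: C_transition_def)
      show "g ` (\<Psi> \<circ> \<delta>) ` (?U \<inter> V) \<subseteq> \<delta> ` (D \<inter> V)"
        using homeomorphism_apply1[OF hom] by auto
      show "\<delta> ` (D \<inter> V) \<subseteq> ?E" using c(6) by auto
    qed
    then have "C_on r ?E (\<xi> \<circ> inv_into ?U (\<Psi> \<circ> \<delta>)) ((\<Psi> \<circ> \<delta>) ` (?U \<inter> V))"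
      by (rule C_on_cong[rotated]) (use inv img in \<open>auto simp del: o_apply simp: comp_def[of \<xi>] comp_def[of _ g]\<close>)
    then show "C_transition r M (?U, \<Psi> \<circ> \<delta>) (V, \<xi>)" by (simp add: C_transition_def)
    note cv = is_chartD[OF ch[OF v]]
    have "C_on r ?E (\<Psi> \<circ> (\<delta> \<circ> inv_into V \<xi>)) (\<xi> ` (V \<inter> ?U))"
    proof (rule C_on_compose[OF E _ C(1)])
      have "C_on r ?E (\<delta> \<circ> inv_into V \<xi>) (\<xi> ` (V \<inter> D))" using tr[OF v d]
          by (simp add: C_transition_def)
      then show "C_on r ?E (\<delta> \<circ> inv_into V \<xi>) (\<xi> ` (V \<inter> ?U))" by (rule C_on_subset) auto
      show "(\<delta> \<circ> inv_into V \<xi>) ` \<xi> ` (V \<inter> ?U) \<subseteq> X" using cv(4) by auto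
      show "X \<subseteq> ?E" by (rule XE)
    qed
    then show "C_transition r M (V, \<xi>) (?U, \<Psi> \<circ> \<delta>)" by (simp add: C_transition_def o_assoc)
  qed
  then show ?thesis using chart by (auto simp: C_charts_def)
qed

section \<open>Fixed points of foliation maps\<close>

text \<open>This is surjectivity of the induced map: the coset of \<open>w\<close> is that of some
  \<open>a\<close> in \<open>V\<close>, and \<open>0 \<in> W'\<close> puts \<open>w\<close> into its
  own coset.\<close>

lemma inclusion_induces_iso_decompose:
  fixes V W V' W' :: "'v::monoid_add set"
  assumes "inclusion_induces_iso V W V' W'" "0 \<in> W'" "w \<in> V'"
  obtains a b where "a \<in> V" "b \<in> W'" "w = a + b"
proof -
  obtain h where h: "\<forall>v\<in>V. h (v +o W) = v +o W'" "bij_betw h (cosets_of V W) (cosets_of V' W')"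
    using assms(1) unfolding inclusion_induces_iso_def by (elim conjE exE)
  have "w +o W' \<in> h ` cosets_of V W"
    using h(2) assms(3) by (auto simp: bij_betw_def cosets_of_def)
  then obtain a where a: "a \<in> V" "w +o W' = a +o W'" using h(1) by (auto simp: cosets_of_def)
  have "w \<in> w +o W'" using assms(2) by (force simp: elt_set_plus_def)
  then show ?thesis using a that by (auto simp: elt_set_plus_def)
qed

lemma coord_tangentI:
  "curve_at M T x \<gamma> \<Longrightarrow> (\<delta> \<circ> \<gamma> has_vector_derivative v) (at 0) \<Longrightarrow> v \<in> coord_tangent M T \<delta> x"
  unfolding coord_tangent_def by (rule image_eqI[of _ _ \<gamma>]) (simp_all add: vector_derivative_at)

text \<open>Each diagonal point lies in its own restricted leaf, which thereby meets the diagonal.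
  The content is that the point belongs to the topspace of the leaf topology.\<close>

lemma diagonal_subset_local_saturation:
  assumes F: "C_foliation r M F" and S: "local_saturation M F S"
  shows "Id_on (points M) \<subseteq> S"
proof
  fix z assume z: "z \<in> Id_on (points M)"
  let ?FF = "prod_foliation F F"
  obtain V where V: "Id_on (points M) \<subseteq> V"
      "S = saturation (restricted_leaves ?FF V) (Id_on (points M))"
    using S unfolding local_saturation_def by blast
  \<comment> \<open>Along the filter \<open>bot\<close> every eventuality holds, so convergence to
    \<open>z\<close> means just that \<open>z\<close> is in the topspace; the criterion for limits
    in products thus settles membership.\<close>
  have "limitin (leaf_topology F) (fst \<circ> (\<lambda>_::real. z)) (fst z) bot"
    "limitin (leaf_topology F) (snd \<circ> (\<lambda>_::real. z)) (snd z) bot"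
    unfolding limitin_leaf_topology[OF C_foliationD(1)[OF F]]
    using z C_foliationD(4)[OF F] by auto
  then have "limitin (leaf_topology ?FF) (\<lambda>_::real. z) z bot"
    by (intro limitin_leaf_topology_prod[OF C_foliationD(1)[OF F] C_foliationD(1)[OF F], THEN iffD2] conjI)
  then have top: "z \<in> topspace (leaf_topology ?FF)" by (rule limitin_topspace)
  then obtain A where A: "A \<in> leaves ?FF" "z \<in> A"
    unfolding leaves_def using Union_connected_components_of by (metis UnionE)
  have "z \<in> topspace (subtopology (leaf_topology ?FF) (A \<inter> V))" using top A(2) z V(1) by auto
  then obtain B where B: "B \<in> connected_components_of (subtopology (leaf_topology ?FF) (A \<inter> V))"
      "z \<in> B"
    using Union_connected_components_of by (metis UnionE)
  have "B \<in> restricted_leaves ?FF V" unfolding restricted_leaves_def using A(1) B(1) by (rule UN_I)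
  then show "z \<in> S" unfolding V(2) saturation_def using B(2) z by blast
qed

section \<open>The linear algebra at one fixed point\<close>

text \<open>One fixed point in one chart around it. With \<open>\<phi>'\<close>, the derivative of
  the coordinate expression of \<open>\<phi>\<close>, as a parameter, \<open>\<phi>' v - v\<close>
  is a map on coordinate vectors. The assumptions on \<open>U\<close> and \<open>S\<close> unfold
  ls-transversality at \<open>x\<close>.\<close>

locale ls_transverse_fixed_point =
  fixes r :: enat
    and M :: "('a::{t2_space,second_countable_topology}, 'e::euclidean_space) mfd"
    and F :: "('a, 'e) foliation" and \<phi> :: "'a \<Rightarrow> 'a" and U :: "'a set" and S :: "('a \<times> 'a) set"
    and D :: "'a set" and \<delta> :: "'a \<Rightarrow> 'e" and x :: 'a and \<phi>' :: "'e \<Rightarrow> 'e"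
  assumes r: "1 \<le> r" and M: "C_manifold r M" and F: "C_foliation r M F" and \<phi>: "C_map r M M \<phi>"
    and U: "openin (top_of_set (points M)) U"
    and S: "good_local_saturation r M F S"
    and US: "\<And>y. y \<in> U \<Longrightarrow> (y, \<phi> y) \<in> S"
    and x: "x \<in> U" "\<phi> x = x"
    and trans: "tangent_map M (prod_mfd M M) (\<lambda>x. (x, \<phi> x)) x ` tangent_space M (top_of_set (points M)) x +
        tangent_space (prod_mfd M M) (top_of_set (Id_on (points M))) (x, x) =
      tangent_space (prod_mfd M M) (top_of_set S) (x, x)"
    and d: "(D, \<delta>) \<in> atlas M" and xD: "x \<in> D"
    and \<phi>': "(\<delta> \<circ> \<phi> \<circ> inv_into D \<delta> has_derivative \<phi>') (at (\<delta> x) within \<delta> ` (D \<inter> \<phi> -` D))"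
begin

abbreviation "E \<equiv> model M"
abbreviation "MM \<equiv> prod_mfd M M"
abbreviation "FF \<equiv> prod_foliation F F"
abbreviation "\<Delta> \<equiv> Id_on (points M)"
abbreviation "DD \<equiv> D \<times> D"
abbreviation "\<delta>\<delta> \<equiv> map_prod \<delta> \<delta>"
abbreviation "\<Phi> \<equiv> \<lambda>x. (x, \<phi> x)"
abbreviation "TM \<equiv> top_of_set (points M)"

definition "L = coord_tangent M (leaf_topology F) \<delta> x"

lemma E: "subspace E" and charts: "\<forall>c\<in>atlas M. is_chart M c" and atl: "atlas M \<subseteq> C_charts r M"
  using M atlas_subset_C_charts by (auto simp: C_manifold_def)

lemma chart: "is_chart M (D, \<delta>)"
  using charts d by blast

lemmas chartD = is_chartD[OF chart]

lemma xM: "x \<in> points M"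
  using chartD(5) xD by blast

lemma EE: "subspace (model MM)" and charts_MM: "\<forall>c\<in>atlas MM. is_chart MM c"
  and d2: "(DD, \<delta>\<delta>) \<in> atlas MM" and points_MM: "points MM = points M \<times> points M"
  and model_MM: "model MM = E \<times> E"
proof -
  show "\<forall>c\<in>atlas MM. is_chart MM c"
    using charts by (auto simp: atlas_prod_mfd intro!: is_chart_prod)
  show "(DD, \<delta>\<delta>) \<in> atlas MM" using d by (auto simp: atlas_prod_mfd)
qed (use E in \<open>simp_all add: prod_mfd_def subspace_prod\<close>)

lemma L: "subspace L" "dim L = dim (leaf_model F)" "L \<subseteq> E"
  unfolding L_def using coord_tangent_leaf[OF M F r d xD] .

lemma \<phi>M: "\<phi> ` points M \<subseteq> points M" and \<phi>_cont: "continuous_on (points M) \<phi>"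
  and \<phi>_C: "C_on r E (\<delta> \<circ> \<phi> \<circ> inv_into D \<delta>) (\<delta> ` (D \<inter> \<phi> -` D))"
  using \<phi> d by (auto simp: C_map_def)

lemma op_\<phi>D: "openin TM (D \<inter> \<phi> -` D)"
proof -
  have "openin TM (points M \<inter> \<phi> -` D)"
    using \<phi>_cont \<phi>M chartD(1) by (intro continuous_openin_preimage) auto
  moreover have "D \<inter> \<phi> -` D = D \<inter> (points M \<inter> \<phi> -` D)" using chartD(5) by blast
  ultimately show ?thesis using openin_Int[OF chartD(1)] by simp
qed

lemma curve_top:
  assumes "v \<in> E"
  obtains \<gamma> where "curve_at M TM x \<gamma>" "(\<delta> \<circ> \<gamma> has_vector_derivative v) (at 0)"
proof -
  have "v \<in> coord_tangent M TM \<delta> x"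
    using assms coord_tangent_top[OF E charts atl d r xD] by simp
  then obtain \<gamma> where \<gamma>: "curve_at M TM x \<gamma>" "v = vector_derivative (\<delta> \<circ> \<gamma>) (at 0)"
    unfolding coord_tangent_def by blast
  then show ?thesis using curve_at_has_vector_derivative[OF \<gamma>(1) d xD] that by simp
qed

lemma vd_curve:
  assumes "curve_at M TM x \<gamma>"
  shows "vector_derivative (\<delta> \<circ> \<gamma>) (at 0) \<in> E"
  using assms coord_tangent_top[OF E charts atl d r xD] by (auto simp: coord_tangent_def)

lemma \<phi>_curve:
  assumes "curve_at M TM x \<gamma>" "(\<delta> \<circ> \<gamma> has_vector_derivative v) (at 0)"
  shows "(\<delta> \<circ> (\<phi> \<circ> \<gamma>) has_vector_derivative \<phi>' v) (at 0)" "curve_at M TM x (\<phi> \<circ> \<gamma>)"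
proof -
  note g = curve_atD[OF assms(1)]
  have ev: "\<forall>\<^sub>F t in at 0. \<gamma> t \<in> D \<inter> \<phi> -` D"
    using g(2) op_\<phi>D by (rule limitin_eventually_openin) (use xD x in auto)
  have 1: "((\<delta> \<circ> \<phi> \<circ> inv_into D \<delta>) \<circ> (\<delta> \<circ> \<gamma>) has_vector_derivative \<phi>' v) (at 0)"
  proof (rule has_vector_derivative_compose_within[where T = \<phi>'])
    show "\<forall>\<^sub>F t in at 0. (\<delta> \<circ> \<gamma>) t \<in> \<delta> ` (D \<inter> \<phi> -` D)" using ev by eventually_elim auto
    show "(\<delta> \<circ> \<gamma>) 0 \<in> \<delta> ` (D \<inter> \<phi> -` D)" using g(1) xD x by auto
    show "(\<delta> \<circ> \<phi> \<circ> inv_into D \<delta> has_derivative \<phi>') (at ((\<delta> \<circ> \<gamma>) 0) within \<delta> ` (D \<inter> \<phi> -` D))"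
      using \<phi>' g(1) by simp
  qed (rule assms(2))
  show 2: "(\<delta> \<circ> (\<phi> \<circ> \<gamma>) has_vector_derivative \<phi>' v) (at 0)"
  proof (rule has_vector_derivative_cong_eventually[OF 1])
    show "\<forall>\<^sub>F t in at 0. ((\<delta> \<circ> \<phi> \<circ> inv_into D \<delta>) \<circ> (\<delta> \<circ> \<gamma>)) t = (\<delta> \<circ> (\<phi> \<circ> \<gamma>)) t"
      using ev by eventually_elim (use chartD(4) in auto)
    show "((\<delta> \<circ> \<phi> \<circ> inv_into D \<delta>) \<circ> (\<delta> \<circ> \<gamma>)) 0 = (\<delta> \<circ> (\<phi> \<circ> \<gamma>)) 0"
      using chartD(4) g(1) xD by simp
  qed
  have lim: "(\<gamma> \<longlongrightarrow> x) (at 0)" "\<forall>\<^sub>F t in at 0. \<gamma> t \<in> points M"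
    using g(2) by (auto simp: limitin_top_of_set)
  have "((\<lambda>t. \<phi> (\<gamma> t)) \<longlongrightarrow> \<phi> x) (at 0)"
    by (rule continuous_on_tendsto_compose[OF \<phi>_cont lim(1) xM lim(2)])
  moreover have "\<forall>\<^sub>F t in at 0. \<phi> (\<gamma> t) \<in> points M"
    using lim(2) by eventually_elim (use \<phi>M in auto)
  ultimately have "limitin TM (\<phi> \<circ> \<gamma>) x (at 0)"
    using xM x by (simp add: limitin_top_of_set o_def)
  then show "curve_at M TM x (\<phi> \<circ> \<gamma>)"
    using d atl g x by (intro curve_atI[OF E charts _ r xD _ _ _ 2]) auto
qed

lemma velocity_MM:
  assumes "curve_at MM T (x, x) \<gamma>"
  shows "(\<delta>\<delta> \<circ> \<gamma> has_vector_derivative velocity MM (x, x) \<gamma> (DD, \<delta>\<delta>)) (at 0)"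
  using curve_at_has_vector_derivative[OF assms d2] d2 xD by (simp add: velocity_def)

lemma velocity_MM_eqI:
  assumes "(\<delta> \<circ> (fst \<circ> \<gamma>) has_vector_derivative a) (at 0)"
      "(\<delta> \<circ> (snd \<circ> \<gamma>) has_vector_derivative b) (at 0)"
  shows "velocity MM (x, x) \<gamma> (DD, \<delta>\<delta>) = (a, b)"
proof -
  have "(\<delta>\<delta> \<circ> \<gamma> has_vector_derivative (a, b)) (at 0)"
    using has_vector_derivative_Pair[OF assms] by (simp add: o_def map_prod_def case_prod_unfold)
  then show ?thesis using d2 xD vector_derivative_at by (auto simp: velocity_def)
qed

lemma velocity_MM_components:
  assumes "curve_at MM T (x, x) \<gamma>"
  shows "(\<delta> \<circ> (fst \<circ> \<gamma>) has_vector_derivative fst (velocity MM (x, x) \<gamma> (DD, \<delta>\<delta>))) (at 0)"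
    "(\<delta> \<circ> (snd \<circ> \<gamma>) has_vector_derivative snd (velocity MM (x, x) \<gamma> (DD, \<delta>\<delta>))) (at 0)"
  using has_vector_derivative_fst_snd[OF velocity_MM[OF assms]] by (simp_all add: o_def)

text \<open>Convergence in the leaf topology of the product splits, so both components of a curve in
  a product leaf run in leaves of \<open>F\<close>.\<close>

lemma leaf_vector_components:
  assumes "a \<in> leaf_tangent_space MM FF (x, x)"
  shows "fst (a (DD, \<delta>\<delta>)) \<in> L" "snd (a (DD, \<delta>\<delta>)) \<in> L"
proof -
  obtain \<gamma> where \<gamma>: "curve_at MM (leaf_topology FF) (x, x) \<gamma>" "a = velocity MM (x, x) \<gamma>"
    using assms by (auto simp: tangent_space_def)
  have "limitin (leaf_topology F) (fst \<circ> \<gamma>) x (at 0)" "limitin (leaf_topology F) (snd \<circ> \<gamma>) x (at 0)"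
    using curve_atD(2)[OF \<gamma>(1)] C_foliationD(1)[OF F] by (simp_all add: limitin_leaf_topology_prod)
  then have "curve_at M (leaf_topology F) x (fst \<circ> \<gamma>)" "curve_at M (leaf_topology F) x (snd \<circ> \<gamma>)"
    using curve_at_fst_snd[OF \<gamma>(1) d _ d] xD by simp_all
  then show "fst (a (DD, \<delta>\<delta>)) \<in> L" "snd (a (DD, \<delta>\<delta>)) \<in> L"
    unfolding L_def \<gamma>(2) using velocity_MM_components[OF \<gamma>(1)] by (auto intro: coord_tangentI)
qed

lemma diagonal_vector_components:
  assumes "b \<in> tangent_space MM (top_of_set \<Delta>) (x, x)"
  shows "fst (b (DD, \<delta>\<delta>)) = snd (b (DD, \<delta>\<delta>))"
proof -
  obtain \<gamma> where \<gamma>: "curve_at MM (top_of_set \<Delta>) (x, x) \<gamma>" "b = velocity MM (x, x) \<gamma>"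
    using assms by (auto simp: tangent_space_def)
  have "\<forall>\<^sub>F t in at 0. \<gamma> t \<in> \<Delta>" using curve_atD(2)[OF \<gamma>(1)] by (simp add: limitin_top_of_set)
  then have ev: "\<forall>\<^sub>F t in at 0. (\<delta> \<circ> (fst \<circ> \<gamma>)) t = (\<delta> \<circ> (snd \<circ> \<gamma>)) t"
    by eventually_elim (auto simp: Id_on_def)
  have "(\<delta> \<circ> (snd \<circ> \<gamma>) has_vector_derivative fst (b (DD, \<delta>\<delta>))) (at 0)"
    unfolding \<gamma>(2)
    by (rule has_vector_derivative_cong_eventually[OF velocity_MM_components(1)[OF \<gamma>(1)] ev])
      (simp add: curve_atD(1)[OF \<gamma>(1)])
  then show ?thesis
    using velocity_MM_components(2)[OF \<gamma>(1)] \<gamma>(2) vector_derivative_unique_at by blast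
qed

lemma zero_diagonal: "0 \<in> tangent_space MM (top_of_set \<Delta>) (x, x)"
proof -
  have c: "curve_at MM (top_of_set \<Delta>) (x, x) (\<lambda>t. (x, x))"
    using xM by (auto simp: curve_at_def limitin_top_of_set Id_on_def o_def)
  have "velocity MM (x, x) (\<lambda>t. (x, x)) = 0"
    by (rule ext) (auto simp: velocity_def o_def zero_fun_def split: prod.splits)
  then show ?thesis using c unfolding tangent_space_def by (metis (mono_tags) imageI mem_Collect_eq)
qed

lemma inclusion_iso:
  "inclusion_induces_iso (leaf_tangent_space MM FF (x, x)) (tangent_space MM (leaf_topology (diag_foliation F)) (x, x))
    (tangent_space MM (top_of_set S) (x, x)) (tangent_space MM (top_of_set \<Delta>) (x, x))"
proof -
  have "(x, x) \<in> \<Delta>" using xM by (simp add: Id_on_def)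
  then show ?thesis using S unfolding good_local_saturation_def Let_def by blast
qed

text \<open>By surjectivity of the isomorphism of quotients, \<open>w\<close> is a vector tangent to
  the product leaves plus one tangent to the diagonal. The former has both components in
  \<open>L\<close>, the latter has equal components and drops out of the difference.\<close>

lemma saturation_vector_components:
  assumes "w \<in> tangent_space MM (top_of_set S) (x, x)"
  shows "snd (w (DD, \<delta>\<delta>)) - fst (w (DD, \<delta>\<delta>)) \<in> L"
proof -
  obtain a b where ab: "a \<in> leaf_tangent_space MM FF (x, x)"
      "b \<in> tangent_space MM (top_of_set \<Delta>) (x, x)" "w = a + b"
    using inclusion_induces_iso_decompose[OF inclusion_iso zero_diagonal assms] by blast
  have "snd (w (DD, \<delta>\<delta>)) - fst (w (DD, \<delta>\<delta>)) = snd (a (DD, \<delta>\<delta>)) - fst (a (DD, \<delta>\<delta>))"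
    using diagonal_vector_components[OF ab(2)] ab(3) by simp
  then show ?thesis using leaf_vector_components[OF ab(1)] L(1) by (simp add: subspace_diff)
qed

text \<open>The curve \<open>(\<gamma> t, \<phi> (\<gamma> t))\<close> stays in \<open>S\<close>
  near time 0 because \<open>U\<close> is open, and its velocity is
  \<open>(v, \<phi>' v)\<close>.\<close>

lemma displacement_in_leaf:
  assumes "v \<in> E"
  shows "\<phi>' v - v \<in> L"
proof -
  obtain \<gamma> where \<gamma>: "curve_at M TM x \<gamma>" "(\<delta> \<circ> \<gamma> has_vector_derivative v) (at 0)"
    using curve_top[OF assms] by blast
  let ?g = "\<lambda>t. (\<gamma> t, \<phi> (\<gamma> t))"
  have fs: "fst \<circ> ?g = \<gamma>" "snd \<circ> ?g = \<phi> \<circ> \<gamma>" by auto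
  have "\<forall>\<^sub>F t in at 0. \<gamma> t \<in> U" by (rule limitin_eventually_openin[OF curve_atD(2)[OF \<gamma>(1)] U x(1)])
  then have "\<forall>\<^sub>F t in at 0. ?g t \<in> S" by eventually_elim (rule US)
  moreover have "(\<gamma> \<longlongrightarrow> x) (at 0)" "((\<phi> \<circ> \<gamma>) \<longlongrightarrow> x) (at 0)"
    using curve_atD(2)[OF \<gamma>(1)] curve_atD(2)[OF \<phi>_curve(2)[OF \<gamma>]] by (auto simp: limitin_top_of_set)
  then have "(?g \<longlongrightarrow> (x, x)) (at 0)" by (auto intro: tendsto_Pair simp: o_def)
  ultimately have "limitin (top_of_set S) ?g (x, x) (at 0)"
    using US[OF x(1)] x(2) by (simp add: limitin_top_of_set)
  then have "curve_at MM (top_of_set S) (x, x) ?g"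
    using \<gamma>(1) \<phi>_curve(2)[OF \<gamma>]
        by (intro curve_at_prod[where ?T1.0 = TM and ?T2.0 = TM]) (simp_all add: fs)
  then have "velocity MM (x, x) ?g \<in> tangent_space MM (top_of_set S) (x, x)"
    by (auto simp: tangent_space_def)
  moreover have "velocity MM (x, x) ?g (DD, \<delta>\<delta>) = (v, \<phi>' v)"
    using \<gamma>(2) \<phi>_curve(1)[OF \<gamma>] by (intro velocity_MM_eqI) (simp_all add: fs)
  ultimately show ?thesis using saturation_vector_components by fastforce
qed

text \<open>\<open>tangent_map\<close> selects a representative curve by \<open>SOME\<close>.
  Exposing that curve turns statements about the tangent map into computations along it.\<close>

lemma tangent_map_curve:
  assumes "v \<in> tangent_space M TM x"
  obtains \<gamma> where "curve_at M TM x \<gamma>" "velocity M x \<gamma> = v"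
      "tangent_map M N f x v = velocity N (f x) (f \<circ> \<gamma>)"
proof -
  let ?\<gamma> = "SOME \<gamma>. curve_at M TM x \<gamma> \<and> velocity M x \<gamma> = v"
  have "\<exists>\<gamma>. curve_at M TM x \<gamma> \<and> velocity M x \<gamma> = v" using assms by (auto simp: tangent_space_def)
  then have "curve_at M TM x ?\<gamma> \<and> velocity M x ?\<gamma> = v" by (rule someI_ex)
  then show ?thesis using that[of ?\<gamma>] by (simp add: tangent_map_def)
qed

text \<open>The test vector is \<open>(0, l)\<close>, the velocity of a curve constant in the first
  factor and running in the leaf in the second; the inclusion of tangent spaces makes it tangent to
  \<open>S\<close>. Transversality writes it as \<open>(a, \<phi>' a) + (b, b)\<close>. The first
  component forces \<open>b = - a\<close>, and the second gives
  \<open>l = \<phi>' a - a\<close>.\<close>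

lemma displacement_surj:
  assumes "l \<in> L"
  obtains v where "v \<in> E" "\<phi>' v - v = l"
proof -
  obtain \<gamma> where \<gamma>: "curve_at M (leaf_topology F) x \<gamma>" "l = vector_derivative (\<delta> \<circ> \<gamma>) (at 0)"
    using assms by (auto simp: L_def coord_tangent_def)
  let ?g = "\<lambda>t. (x, \<gamma> t)"
  have fs: "fst \<circ> ?g = (\<lambda>t. x)" "snd \<circ> ?g = \<gamma>" by auto
  have "limitin (leaf_topology F) (\<lambda>t::real. x) x (at 0)"
    using limitin_topspace[OF curve_atD(2)[OF \<gamma>(1)]] by (simp add: limitin_def)
  then have c: "curve_at M (leaf_topology F) x (\<lambda>t. x)" by (auto simp: curve_at_def o_def)
  have "limitin (leaf_topology FF) ?g (x, x) (at 0)"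
    using curve_atD(2)[OF c] curve_atD(2)[OF \<gamma>(1)] C_foliationD(1)[OF F]
    by (simp add: limitin_leaf_topology_prod fs)
  then have "curve_at MM (leaf_topology FF) (x, x) ?g"
    using c \<gamma>(1)
        by (intro curve_at_prod[where ?T1.0 = "leaf_topology F" and ?T2.0 = "leaf_topology F"]) (simp_all add: fs)
  then have "velocity MM (x, x) ?g \<in> leaf_tangent_space MM FF (x, x)"
      by (auto simp: tangent_space_def)
  then have "velocity MM (x, x) ?g \<in> tangent_space MM (top_of_set S) (x, x)"
    using inclusion_iso by (auto simp: inclusion_induces_iso_def)
  then obtain v b where v: "v \<in> tangent_space M TM x" and b: "b \<in> tangent_space MM (top_of_set \<Delta>) (x, x)"
    and eq: "velocity MM (x, x) ?g = tangent_map M MM \<Phi> x v + b"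
    unfolding trans[symmetric] by (auto elim!: set_plus_elim)
  obtain \<beta> where \<beta>: "curve_at M TM x \<beta>" "tangent_map M MM \<Phi> x v = velocity MM (\<Phi> x) (\<Phi> \<circ> \<beta>)"
    using tangent_map_curve[OF v] by metis
  let ?a = "vector_derivative (\<delta> \<circ> \<beta>) (at 0)"
  have vd: "(\<delta> \<circ> \<beta> has_vector_derivative ?a) (at 0)"
      by (rule curve_at_has_vector_derivative[OF \<beta>(1) d xD])
  have "velocity MM (x, x) (\<Phi> \<circ> \<beta>) (DD, \<delta>\<delta>) = (?a, \<phi>' ?a)"
    using vd \<phi>_curve(1)[OF \<beta>(1) vd] by (intro velocity_MM_eqI) (simp_all add: o_def)
  moreover have "velocity MM (x, x) ?g (DD, \<delta>\<delta>) = (0, l)"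
    using curve_at_has_vector_derivative[OF \<gamma>(1) d xD] \<gamma>(2)
    by (intro velocity_MM_eqI) (simp_all add: fs o_def)
  ultimately have "(0, l) = (?a, \<phi>' ?a) + b (DD, \<delta>\<delta>)"
    using eq \<beta>(2) x(2) by simp
  then have 0: "?a + fst (b (DD, \<delta>\<delta>)) = 0" and l: "l = \<phi>' ?a + fst (b (DD, \<delta>\<delta>))"
    using diagonal_vector_components[OF b] by (simp_all add: prod_eq_iff)
  have "\<phi>' ?a - ?a = l" using minus_unique[OF 0] l by simp
  then show ?thesis using that vd_curve[OF \<beta>(1)] by blast
qed

lemma displacement_linear: "linear (\<lambda>v. \<phi>' v - v)"
  using has_derivative_linear[OF \<phi>']
      by (intro linear_compose_sub) (auto simp: linear_id[unfolded id_def])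

lemma displacement_image: "(\<lambda>v. \<phi>' v - v) ` E = L"
  using displacement_in_leaf displacement_surj by (auto simp: image_iff) metis

text \<open>On \<open>S\<close> near \<open>(x, x)\<close> a point \<open>(y, y')\<close> is determined
    by the coordinates of \<open>y\<close> and the \<open>L\<close>-component
  of the displacement: the derivative of these functions is injective on the tangent space of \<open>S\<close>, whose
  vectors have displacement in \<open>L\<close>. As \<open>(y, y)\<close> lies in \<open>S\<close> as well, vanishing of the component forces \<open>y' = y\<close>.\<close>

lemma displacement_component_detects_fixed_points:
  assumes P: "bounded_linear P" "\<And>l. l \<in> L \<Longrightarrow> P l = l"
  obtains W where "openin TM W" "x \<in> W" "W \<subseteq> D \<inter> \<phi> -` D"
    "\<And>y. y \<in> W \<Longrightarrow> P (\<delta> (\<phi> y) - \<delta> y) = 0 \<Longrightarrow> \<phi> y = y"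
proof -
  obtain K where K: "is_submanifold r MM K S"
    using S unfolding good_local_saturation_def Let_def by blast
  have zS: "(x, x) \<in> S" using US[OF x(1)] x(2) by simp
  then obtain \<Omega> \<eta> where sl: "(\<Omega>, \<eta>) \<in> slice_charts r MM K S" "(x, x) \<in> \<Omega>"
    using K unfolding is_submanifold_def by fastforce
  have c: "(\<Omega>, \<eta>) \<in> C_charts r MM" and slice: "\<eta> ` (\<Omega> \<inter> S) = \<eta> ` \<Omega> \<inter> K"
    using sl(1) by (auto simp: slice_charts_def)
  have cc: "is_chart MM (\<Omega>, \<eta>)" and tr: "C_transition r MM (\<Omega>, \<eta>) (DD, \<delta>\<delta>)"
      "C_transition r MM (DD, \<delta>\<delta>) (\<Omega>, \<eta>)"
    using c d2 by (auto simp: C_charts_def)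
  note C = is_chartD[OF cc]
  have zD: "(x, x) \<in> DD" using xD by simp
  have chDD: "is_chart MM (DD, \<delta>\<delta>)" using charts_MM d2 by blast
  let ?X = "\<eta> ` (\<Omega> \<inter> DD)"
  let ?\<tau> = "\<delta>\<delta> \<circ> inv_into \<Omega> \<eta>"
  obtain T where T: "linear T" "inj_on T (model MM)"
      "(?\<tau> has_derivative T) (at (\<eta> (x, x)) within ?X)"
    "\<And>\<gamma> v. \<gamma> 0 = (x, x) \<Longrightarrow> limitin (top_of_set (points MM)) \<gamma> (x, x) (at 0) \<Longrightarrow>
      (\<eta> \<circ> \<gamma> has_vector_derivative v) (at 0) \<Longrightarrow> (\<delta>\<delta> \<circ> \<gamma> has_vector_derivative T v) (at 0)"
    by (rule chart_change[OF cc chDD EE tr r sl(2) zD]) (rule that)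
  have Ksub: "subspace K" "K \<subseteq> model MM" using K by (auto simp: is_submanifold_def)
  have zK: "\<eta> (x, x) \<in> K" using slice sl(2) zS by blast
  \<comment> \<open>A vector of \<open>K\<close> is the velocity of a line in the slice chart, hence
    of a curve in \<open>S\<close>; \<open>T\<close> translates it into the product chart of
    \<open>\<delta>\<close>.\<close>
  have TK: "snd (T k) - fst (T k) \<in> L" if k: "k \<in> K" for k
  proof -
    obtain \<gamma> where \<gamma>: "\<gamma> 0 = (x, x)" "limitin (top_of_set (points MM)) \<gamma> (x, x) (at 0)"
      "\<forall>\<^sub>F t in at 0. \<gamma> t \<in> \<Omega> \<and> \<eta> (\<gamma> t) = \<eta> (x, x) + t *\<^sub>R k"
          "(\<eta> \<circ> \<gamma> has_vector_derivative k) (at 0)"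
      using chart_line[OF cc EE sl(2), of k] k Ksub(2) by blast
    have "\<forall>\<^sub>F t in at 0. \<gamma> t \<in> S"
      using \<gamma>(3)
    proof eventually_elim
      case (elim t)
      then have "\<eta> (\<gamma> t) \<in> K" using subspace_add[OF Ksub(1) zK subspace_scale[OF Ksub(1) k, of t]]
          by simp
      then have "\<eta> (\<gamma> t) \<in> \<eta> ` \<Omega> \<inter> K" using elim by blast
      then obtain w where w: "w \<in> \<Omega>" "w \<in> S" "\<eta> (\<gamma> t) = \<eta> w" unfolding slice[symmetric] by blast
      then show ?case using inj_onD[OF C(4) w(3) conjunct1[OF elim] w(1)] by simp
    qed
    then have "limitin (top_of_set S) \<gamma> (x, x) (at 0)" using \<gamma>(2) zS
        by (simp add: limitin_top_of_set)
    then have cu: "curve_at MM (top_of_set S) (x, x) \<gamma>"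
      using curve_atI[OF EE charts_MM c r sl(2) \<gamma>(1) _ \<gamma>(2,4)] by blast
    have "velocity MM (x, x) \<gamma> (DD, \<delta>\<delta>) = T k"
      using velocity_MM[OF cu] T(4)[OF \<gamma>(1,2,4)] by (rule vector_derivative_unique_at)
    moreover have "velocity MM (x, x) \<gamma> \<in> tangent_space MM (top_of_set S) (x, x)"
      using cu by (auto simp: tangent_space_def)
    ultimately show ?thesis using saturation_vector_components by metis
  qed
  define l where "l w = (fst w, P (snd w - fst w))" for w :: "'e \<times> 'e"
  have bl: "bounded_linear l"
    unfolding l_def[abs_def]
    by (intro bounded_linear_Pair bounded_linear_fst bounded_linear_compose[OF P(1)] bounded_linear_sub bounded_linear_snd)
  have "openin (top_of_set (points MM)) (\<Omega> \<inter> DD)" using C(1) is_chartD(1)[OF chDD]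
      by (rule openin_Int)
  then have opX: "openin (top_of_set (model MM)) ?X"
    by (rule chart_image_openin[OF cc]) auto
  have "Ck_on (Suc 0) (model MM) ?\<tau> ?X"
    using tr(1) r unfolding C_transition_def C_on_def
        by (auto simp: one_enat_def simp del: Ck_on.simps)
  then have C1: "Ck_on (Suc 0) (model MM) (\<lambda>e. l (?\<tau> e)) ?X" by (rule Ck_on_linear_compose[OF bl])
  have D1: "((\<lambda>e. l (?\<tau> e)) has_derivative (\<lambda>v. l (T v))) (at (\<eta> (x, x)) within ?X)"
    by (rule bounded_linear.has_derivative[OF bl T(3)])
  have inj: "k = 0" if k: "k \<in> K" "l (T k) = 0" for k
  proof -
    have f: "fst (T k) = 0" using arg_cong[OF k(2), of fst] by (simp add: l_def)
    have "P (snd (T k) - fst (T k)) = 0" using arg_cong[OF k(2), of snd] by (simp add: l_def)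
    then have "snd (T k) - fst (T k) = 0" using P(2)[OF TK[OF k(1)]] by metis
    then have "T k = 0" using f by (simp add: prod_eq_iff)
    then have "T k = T 0" using T(1) by (simp add: linear_0)
    then show ?thesis using inj_onD[OF T(2)] k(1) Ksub subspace_0[OF Ksub(1)] by blast
  qed
  obtain N where N: "open N" "\<eta> (x, x) \<in> N" "inj_on (\<lambda>e. l (?\<tau> e)) (N \<inter> K)"
    by (rule C1_locally_injective_on_subspace[OF Ksub opX C1 _ zK D1 inj]) (use sl(2) zD in auto)
  have "openin (top_of_set \<Omega>) (\<Omega> \<inter> \<eta> -` N)"
    using C(3) N(1) by (intro continuous_openin_preimage_gen) (auto simp: homeomorphism_def)
  then have "openin (top_of_set (points MM)) (\<Omega> \<inter> \<eta> -` N)" using C(1) openin_trans by blast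
  then have opN: "openin (top_of_set (points M \<times> points M)) (\<Omega> \<inter> \<eta> -` N)" by (simp add: points_MM)
  have op1: "openin TM (points M \<inter> \<Phi> -` (\<Omega> \<inter> \<eta> -` N))"
    using opN \<phi>_cont \<phi>M by (intro continuous_openin_preimage[OF _ _ opN] continuous_intros) auto
  have op2: "openin TM (points M \<inter> (\<lambda>y. (y, y)) -` (\<Omega> \<inter> \<eta> -` N))"
    using opN by (intro continuous_openin_preimage[OF _ _ opN] continuous_intros) auto
  \<comment> \<open>Both \<open>(y, \<phi> y)\<close> and \<open>(y, y)\<close> have to lie where
    the comparison map is injective, hence the preimages under the graph map and under the diagonal
    map.\<close>
  let ?W = "U \<inter> (D \<inter> \<phi> -` D) \<inter> (points M \<inter> \<Phi> -` (\<Omega> \<inter> \<eta> -` N)) \<inter> (points M \<inter> (\<lambda>y. (y, y)) -` (\<Omega> \<inter> \<eta> -` N))"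
  have "\<Delta> \<subseteq> S"
    using diagonal_subset_local_saturation[OF F] S by (simp add: good_local_saturation_def)
  then have diag: "(y, y) \<in> S" if "y \<in> points M" for y
    using that by (auto simp: Id_on_def)
  show ?thesis
  proof (rule that)
    show "openin TM ?W" by (intro openin_Int U op_\<phi>D op1 op2)
    show "x \<in> ?W" using x xD xM sl(2) N(2) by simp
    show "?W \<subseteq> D \<inter> \<phi> -` D" by blast
    fix y assume y: "y \<in> ?W" and P0: "P (\<delta> (\<phi> y) - \<delta> y) = 0"
    have m: "(y, \<phi> y) \<in> \<Omega>" "(y, y) \<in> \<Omega>" "\<eta> (y, \<phi> y) \<in> N" "\<eta> (y, y) \<in> N" "y \<in> D" "\<phi> y \<in> D" "y \<in> U"
        "y \<in> points M"
      using y by simp_all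
    then have K: "\<eta> (y, \<phi> y) \<in> K" "\<eta> (y, y) \<in> K" using slice US[OF m(7)] diag[OF m(8)] by blast+
    have "l (?\<tau> (\<eta> (y, \<phi> y))) = l (?\<tau> (\<eta> (y, y)))"
      using m C(4) P0 linear_0[OF bounded_linear.linear[OF P(1)]] by (simp add: l_def)
    then have "\<eta> (y, \<phi> y) = \<eta> (y, y)" using N(3) K m by (auto dest: inj_onD)
    then show "\<phi> y = y" using C(4) m by (auto dest: inj_onD)
  qed
qed

section \<open>Slice charts and tangent space of the fixed point set\<close>

text \<open>\<open>P\<close> forces the values of \<open>u\<close> into \<open>L\<close> without
  changing the derivative along \<open>E\<close> at \<open>\<delta> x\<close>, since
  \<open>\<phi>' v - v\<close> already lies in \<open>L\<close>. So \<open>u\<close> is a submersion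
  onto \<open>L\<close> at that point, and straightening it with the prescribed \<open>K\<close>
  gives the slice chart.\<close>

lemma fixed_points_slice:
  assumes K: "subspace K" "K \<subseteq> E" "dim K + dim L = dim E"
  shows "x \<in> \<Union> (fst ` slice_charts r M K (Fix M \<phi>))"
proof -
  obtain P where P: "bounded_linear P" "\<And>w. P w \<in> L" "\<And>l. l \<in> L \<Longrightarrow> P l = l"
    using subspace_projection[OF L(1)] by blast
  obtain W where W: "openin TM W" "x \<in> W" "W \<subseteq> D \<inter> \<phi> -` D"
    "\<And>y. y \<in> W \<Longrightarrow> P (\<delta> (\<phi> y) - \<delta> y) = 0 \<Longrightarrow> \<phi> y = y"
    using displacement_component_detects_fixed_points[OF P(1,3)] by blast
  define u where "u e = P ((\<delta> \<circ> \<phi> \<circ> inv_into D \<delta>) e + - e)" for e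
  have u\<delta>: "u (\<delta> y) = P (\<delta> (\<phi> y) - \<delta> y)" if "y \<in> D" for y using chartD(4) that by (simp add: u_def)
  let ?X = "\<delta> ` W"
  have XD: "?X \<subseteq> \<delta> ` (D \<inter> \<phi> -` D)" using W(3) by blast
  have opX: "openin (top_of_set E) ?X"
      by (rule chart_image_openin[OF chart W(1)]) (use W(3) in blast)
  have Cu: "C_on r E u ?X"
    unfolding C_on_def
  proof (intro allI impI)
    fix k assume "enat k \<le> r"
    then have "Ck_on k E (\<delta> \<circ> \<phi> \<circ> inv_into D \<delta>) (\<delta> ` (D \<inter> \<phi> -` D))" using \<phi>_C
        by (simp add: C_on_def)
    then have "Ck_on k E (\<delta> \<circ> \<phi> \<circ> inv_into D \<delta>) ?X" by (rule Ck_on_subset[OF _ XD]) simp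
    moreover have "Ck_on k E (\<lambda>e. - e) ?X"
        by (intro Ck_on_linear bounded_linear_minus bounded_linear_ident)
    ultimately show "Ck_on k E u ?X" unfolding u_def[abs_def]
      by (intro Ck_on_linear_compose[OF P(1)] Ck_on_add)
  qed
  have "((\<lambda>e. (\<delta> \<circ> \<phi> \<circ> inv_into D \<delta>) e + - e) has_derivative (\<lambda>v. \<phi>' v + - v)) (at (\<delta> x) within ?X)"
    by (intro has_derivative_add has_derivative_minus has_derivative_ident has_derivative_subset[OF \<phi>' XD])
  then have Du: "(u has_derivative (\<lambda>v. P (\<phi>' v + - v))) (at (\<delta> x) within ?X)"
    unfolding u_def[abs_def] by (rule bounded_linear.has_derivative[OF P(1)])
  have "(\<lambda>v. P (\<phi>' v + - v)) ` E = (\<lambda>v. \<phi>' v - v) ` E"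
    using displacement_in_leaf P(3) by (intro image_cong) auto
  then have AE: "(\<lambda>v. P (\<phi>' v + - v)) ` E = L" using displacement_image by simp
  obtain X' Y \<Psi> g where X': "openin (top_of_set E) X'" "X' \<subseteq> ?X" "\<delta> x \<in> X'"
      "openin (top_of_set E) Y"
    "homeomorphism X' Y \<Psi> g" "C_on r E \<Psi> X'" "C_on r E g Y" and \<Psi>K: "\<And>e. e \<in> X' \<Longrightarrow> \<Psi> e \<in> K \<longleftrightarrow> u e = 0"
    by (rule submersion_slice_coordinates[OF E L(1,3) K opX _ Cu r _ Du AE])
      (use W(2) P(2) in \<open>auto simp: u_def\<close>)
  let ?U = "D \<inter> \<delta> -` X'"
  have "X' \<subseteq> \<delta> ` D" using X'(2) W(3) by blast
  from C_charts_compose[OF M d X'(1) this X'(4-7)]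
  have "(?U, \<Psi> \<circ> \<delta>) \<in> C_charts r M" .
  moreover have "(\<Psi> \<circ> \<delta>) ` (?U \<inter> Fix M \<phi>) = (\<Psi> \<circ> \<delta>) ` ?U \<inter> K"
  proof -
    have eq: "y \<in> Fix M \<phi> \<longleftrightarrow> \<Psi> (\<delta> y) \<in> K" if y: "y \<in> ?U" for y
    proof -
      have "y \<in> W" using y X'(2) W(3) chartD(4) by (auto dest!: subsetD[OF X'(2)] inj_onD)
      then have "y \<in> Fix M \<phi> \<longleftrightarrow> P (\<delta> (\<phi> y) - \<delta> y) = 0"
        using W(3,4) chartD(5) linear_0[OF bounded_linear.linear[OF P(1)]] by (auto simp: Fix_def)
      then show ?thesis using \<Psi>K u\<delta> y by simp
    qed
    then show ?thesis by auto
  qed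
  ultimately have "(?U, \<Psi> \<circ> \<delta>) \<in> slice_charts r M K (Fix M \<phi>)" by (simp add: slice_charts_def)
  moreover have "x \<in> ?U" using xD X'(3) by simp
  ultimately show ?thesis by (force simp: image_iff)
qed

text \<open>A curve of fixed points satisfies \<open>\<phi> \<circ> \<gamma> = \<gamma>\<close> near
  time 0, so its velocity is in the kernel. Equality follows by dimension: the slice chart gives
  \<open>dim K\<close>, and rank-nullity gives the kernel the same dimension.\<close>

lemma coord_tangent_Fix:
  assumes K: "subspace K" "K \<subseteq> E" "dim K + dim L = dim E"
  shows "coord_tangent M (top_of_set (Fix M \<phi>)) \<delta> x = {v \<in> E. \<phi>' v - v = 0}"
proof -
  let ?T = "coord_tangent M (top_of_set (Fix M \<phi>)) \<delta> x" and ?N = "{v \<in> E. \<phi>' v - v = 0}"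
  have FixM: "Fix M \<phi> \<subseteq> points M" by (auto simp: Fix_def)
  have xF: "x \<in> Fix M \<phi>" using xM x by (simp add: Fix_def)
  obtain V \<eta> where sl: "(V, \<eta>) \<in> slice_charts r M K (Fix M \<phi>)" "x \<in> V"
    using fixed_points_slice[OF K] by auto
  have c: "(V, \<eta>) \<in> C_charts r M" and slice: "\<eta> ` (V \<inter> Fix M \<phi>) = \<eta> ` V \<inter> K"
    using sl(1) by (auto simp: slice_charts_def)
  have "is_chart M (V, \<eta>)" using c by (simp add: C_charts_def)
  note C = is_chartD[OF this]
  have Fix_iff: "y \<in> Fix M \<phi> \<longleftrightarrow> \<eta> y - \<eta> x \<in> K" if y: "y \<in> V" for y
  proof -
    have x\<eta>: "\<eta> x \<in> K" using slice sl(2) xF by blast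
    have "y \<in> Fix M \<phi> \<longleftrightarrow> \<eta> y \<in> K"
    proof
      assume "\<eta> y \<in> K"
      then have "\<eta> y \<in> \<eta> ` (V \<inter> Fix M \<phi>)" using y unfolding slice by blast
      then obtain w where w: "w \<in> V" "w \<in> Fix M \<phi>" "\<eta> y = \<eta> w" by blast
      then show "y \<in> Fix M \<phi>" using inj_onD[OF C(4) w(3) y w(1)] by simp
    next
      assume "y \<in> Fix M \<phi>"
      then have "\<eta> y \<in> \<eta> ` (V \<inter> Fix M \<phi>)" using y by blast
      then show "\<eta> y \<in> K" unfolding slice by blast
    qed
    also have "\<dots> \<longleftrightarrow> \<eta> y - \<eta> x \<in> K"
      using subspace_add[OF K(1) _ x\<eta>, of "\<eta> y - \<eta> x"] subspace_diff[OF K(1) _ x\<eta>, of "\<eta> y"] by auto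
    finally show ?thesis .
  qed
  have T: "subspace ?T" "dim ?T = dim K"
  proof -
    have *: "limitin TM \<gamma> x (at 0) \<and> (\<forall>\<^sub>F t in at 0. \<eta> (\<gamma> t) - \<eta> x \<in> K)"
      if "limitin (top_of_set (Fix M \<phi>)) \<gamma> x (at 0)" for \<gamma> :: "real \<Rightarrow> 'a"
    proof
      show lim: "limitin TM \<gamma> x (at 0)" using that FixM
          by (auto simp: limitin_top_of_set elim: eventually_mono)
      have "\<forall>\<^sub>F t in at 0. \<gamma> t \<in> V" by (rule limitin_eventually_openin[OF lim C(1) sl(2)])
      moreover have "\<forall>\<^sub>F t in at 0. \<gamma> t \<in> Fix M \<phi>" using that by (simp add: limitin_top_of_set)
      ultimately show "\<forall>\<^sub>F t in at 0. \<eta> (\<gamma> t) - \<eta> x \<in> K" by eventually_elim (use Fix_iff in blast)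
    qed
    have **: "limitin (top_of_set (Fix M \<phi>)) \<gamma> x (at 0)"
      if "limitin TM \<gamma> x (at 0)" "\<forall>\<^sub>F t in at 0. \<gamma> t \<in> V \<and> \<eta> (\<gamma> t) - \<eta> x \<in> K" for \<gamma> :: "real \<Rightarrow> 'a"
      using that(1) xF eventually_mono[OF that(2)] Fix_iff by (auto simp: limitin_top_of_set)
    show "subspace ?T"
      by (rule coord_tangent_slice(1)[OF E charts d xD c sl(2) r K(1,2)]) (use * ** in blast)+
    show "dim ?T = dim K"
      by (rule coord_tangent_slice(2)[OF E charts d xD c sl(2) r K(1,2)]) (use * ** in blast)+
  qed
  have "?T \<subseteq> ?N"
  proof
    fix v assume "v \<in> ?T"
    then obtain \<gamma> where \<gamma>: "curve_at M (top_of_set (Fix M \<phi>)) x \<gamma>"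
        "v = vector_derivative (\<delta> \<circ> \<gamma>) (at 0)"
      by (auto simp: coord_tangent_def)
    have \<gamma>M: "curve_at M TM x \<gamma>" using \<gamma>(1) FixM by (rule curve_at_top_of_set_mono)
    have vd: "(\<delta> \<circ> \<gamma> has_vector_derivative v) (at 0)"
      using curve_at_has_vector_derivative[OF \<gamma>(1) d xD] \<gamma>(2) by simp
    have "\<forall>\<^sub>F t in at 0. \<gamma> t \<in> Fix M \<phi>" using curve_atD(2)[OF \<gamma>(1)]
        by (simp add: limitin_top_of_set)
    then have ev: "\<forall>\<^sub>F t in at 0. (\<delta> \<circ> (\<phi> \<circ> \<gamma>)) t = (\<delta> \<circ> \<gamma>) t"
      by eventually_elim (simp add: Fix_def)
    have "(\<delta> \<circ> \<gamma> has_vector_derivative \<phi>' v) (at 0)"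
      by (rule has_vector_derivative_cong_eventually[OF \<phi>_curve(1)[OF \<gamma>M vd] ev])
        (simp add: curve_atD(1)[OF \<gamma>(1)] x(2))
    then have "\<phi>' v = v" using vd vector_derivative_unique_at by blast
    then show "v \<in> ?N" using vd_curve[OF \<gamma>M] \<gamma>(2) by simp
  qed
  moreover have "subspace ?N"
    using displacement_linear E subspace_0[OF E]
    by (intro subspaceI) (auto simp: linear_0[OF has_derivative_linear[OF \<phi>']]
        linear_add[OF has_derivative_linear[OF \<phi>']] linear_cmul[OF has_derivative_linear[OF \<phi>']] subspace_add subspace_scale)
  moreover have "dim ?N + dim L = dim E"
    using dim_kernel_on_subspace[OF displacement_linear E] displacement_image by simp
  ultimately show ?thesis using T K(3) by (intro subspace_dim_equal) auto
qed

text \<open>Write \<open>A v = \<phi>' v - v\<close>. If \<open>A\<close> is bijective on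
  \<open>L\<close>, then \<open>A v \<in> L\<close> equals \<open>A l\<close> for some
  \<open>l \<in> L\<close>, and \<open>v - l\<close> is in the kernel. Conversely, if the kernel and
  \<open>L\<close> span \<open>E\<close>, then \<open>A\<close> has the same image on
  \<open>L\<close> as on \<open>E\<close>, namely \<open>L\<close>, and a surjective endomorphism of
  a finite-dimensional space is injective.\<close>

lemma leafwise_simple_iff_transverse:
  assumes K: "subspace K" "K \<subseteq> E" "dim K + dim L = dim E"
  shows "leafwise_simple M F \<phi> x \<longleftrightarrow> transverse_at M F (Fix M \<phi>) x"
proof -
  let ?N = "{v \<in> E. \<phi>' v - v = 0}"
  let ?A = "\<lambda>v. \<phi>' v - v"
  obtain \<Theta> where \<Theta>: "\<And>a b. \<Theta> (a + b) = \<Theta> a + \<Theta> b" "\<And>a b. \<Theta> (a - b) = \<Theta> a - \<Theta> b" "inj_on \<Theta> E"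
    "\<And>\<gamma>. curve_at M TM x \<gamma> \<Longrightarrow> velocity M x \<gamma> = \<Theta> (vector_derivative (\<delta> \<circ> \<gamma>) (at 0))"
    using tangent_space_coordinates[OF M r d xD] by blast
  have FixM: "Fix M \<phi> \<subseteq> points M" by (auto simp: Fix_def)
  have TL: "leaf_tangent_space M F x = \<Theta> ` L"
    unfolding L_def by (rule tangent_space_eq_image[OF \<Theta>(4) curve_at_leaf_topology[OF F]])
  have TN: "tangent_space M (top_of_set (Fix M \<phi>)) x = \<Theta> ` ?N"
    unfolding coord_tangent_Fix[OF K, symmetric]
    by (rule tangent_space_eq_image[OF \<Theta>(4) curve_at_top_of_set_mono[OF _ FixM]])
  have TE: "tangent_space M TM x = \<Theta> ` E"
    unfolding coord_tangent_top[OF E charts atl d r xD, symmetric]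
    by (rule tangent_space_eq_image[OF \<Theta>(4)])
  \<comment> \<open>Injectivity of \<open>\<Theta>\<close> on \<open>E\<close> forces the curve
    selected by \<open>tangent_map\<close> to have coordinate velocity \<open>e\<close>.\<close>
  have tm: "tangent_map M M \<phi> x (\<Theta> e) = \<Theta> (\<phi>' e)" if e: "e \<in> E" for e
  proof -
    have "\<Theta> e \<in> tangent_space M TM x" using TE e by blast
    then obtain \<gamma> where \<gamma>: "curve_at M TM x \<gamma>" "velocity M x \<gamma> = \<Theta> e"
      "tangent_map M M \<phi> x (\<Theta> e) = velocity M (\<phi> x) (\<phi> \<circ> \<gamma>)"
      using tangent_map_curve by metis
    have "vector_derivative (\<delta> \<circ> \<gamma>) (at 0) = e"
      using \<gamma>(2) \<Theta>(4)[OF \<gamma>(1)] inj_onD[OF \<Theta>(3)] vd_curve[OF \<gamma>(1)] e by metis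
    then have vd: "(\<delta> \<circ> \<gamma> has_vector_derivative e) (at 0)"
      using curve_at_has_vector_derivative[OF \<gamma>(1) d xD] by simp
    show ?thesis
      using \<gamma>(3) \<Theta>(4)[OF \<phi>_curve(2)[OF \<gamma>(1) vd]] vector_derivative_at[OF \<phi>_curve(1)[OF \<gamma>(1) vd]] x(2) by simp
  qed
  have inj\<Theta>L: "inj_on \<Theta> L" using \<Theta>(3) L(3) by (rule inj_on_subset)
  have LE: "l \<in> E" if "l \<in> L" for l using L(3) that by blast
  have neg: "l - \<phi>' l \<in> L" if "l \<in> L" for l
    using subspace_neg[OF L(1) displacement_in_leaf[OF LE[OF that]]] by simp
  \<comment> \<open>The first three equivalences conjugate by \<open>\<Theta>\<close> and replace
    the endomorphism of the leaf tangent space by \<open>l - \<phi>' l\<close> on \<open>L\<close>.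
    This is the negative of \<open>?A\<close>, with the same kernel and image on
    \<open>L\<close>.\<close>
  have "leafwise_simple M F \<phi> x \<longleftrightarrow> bij_betw ((\<lambda>v. v - tangent_map M M \<phi> x v) \<circ> \<Theta>) L (\<Theta> ` L)"
    unfolding leafwise_simple_def TL
    using bij_betw_comp_iff[of \<Theta> L "\<Theta> ` L"] inj\<Theta>L by (simp add: bij_betw_def)
  also have "\<dots> \<longleftrightarrow> bij_betw (\<Theta> \<circ> (\<lambda>l. l - \<phi>' l)) L (\<Theta> ` L)"
    by (rule bij_betw_cong) (simp add: tm LE \<Theta>(2))
  also have "\<dots> \<longleftrightarrow> bij_betw (\<lambda>l. l - \<phi>' l) L L"
    using bij_betw_comp_iff2[of \<Theta> L "\<Theta> ` L" "\<lambda>l. l - \<phi>' l" L] inj\<Theta>L neg by (auto simp: bij_betw_def)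
  also have "\<dots> \<longleftrightarrow> {n + l | n l. n \<in> ?N \<and> l \<in> L} = E"
  proof
    assume b: "bij_betw (\<lambda>l. l - \<phi>' l) L L"
    show "{n + l | n l. n \<in> ?N \<and> l \<in> L} = E"
    proof
      show "{n + l | n l. n \<in> ?N \<and> l \<in> L} \<subseteq> E" using LE by (auto intro: subspace_add[OF E])
      show "E \<subseteq> {n + l | n l. n \<in> ?N \<and> l \<in> L}"
      proof
        fix v assume v: "v \<in> E"
        have "- ?A v \<in> L" using subspace_neg[OF L(1) displacement_in_leaf[OF v]] .
        then obtain l where l: "l \<in> L" "- ?A v = l - \<phi>' l" using b by (auto simp: bij_betw_def)
        have "?A (v - l) = ?A v - ?A l" using linear_diff[OF displacement_linear] by blast
        also have "\<dots> = 0" using l(2) by (simp add: algebra_simps)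
        finally have "v - l \<in> ?N" using v l LE E by (simp add: subspace_diff)
        moreover have "v = (v - l) + l" by simp
        ultimately show "v \<in> {n + l | n l. n \<in> ?N \<and> l \<in> L}" using l(1) by blast
      qed
    qed
  next
    assume NL: "{n + l | n l. n \<in> ?N \<and> l \<in> L} = E"
    have AL: "?A ` L = L"
    proof
      show "?A ` L \<subseteq> L" using displacement_in_leaf LE by blast
      show "L \<subseteq> ?A ` L"
      proof
        fix w assume "w \<in> L"
        then obtain v where v: "v \<in> E" "w = ?A v" using displacement_image by blast
        then obtain n l where nl: "n \<in> ?N" "l \<in> L" "v = n + l" using NL by blast
        have "?A v = ?A n + ?A l" unfolding nl(3) using linear_add[OF displacement_linear] by blast
        then have "w = ?A l" using v(2) nl(1) by simp
        then show "w \<in> ?A ` L" using nl(2) by blast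
      qed
    qed
    then have "dim {v \<in> L. ?A v = 0} = 0"
      using dim_kernel_on_subspace[OF displacement_linear L(1)] by simp
    then have ker: "{v \<in> L. ?A v = 0} \<subseteq> {0}" by (simp only: dim_eq_0)
    have "inj_on (\<lambda>l. l - \<phi>' l) L"
    proof (rule inj_onI)
      fix a b assume ab: "a \<in> L" "b \<in> L" "a - \<phi>' a = b - \<phi>' b"
      have "?A (a - b) = ?A a - ?A b" using linear_diff[OF displacement_linear] by blast
      also have "\<dots> = 0" using ab(3) by (simp add: algebra_simps)
      finally have "a - b \<in> {v \<in> L. ?A v = 0}" using ab subspace_diff[OF L(1)] by simp
      then show "a = b" using ker by auto
    qed
    moreover have "(\<lambda>l. l - \<phi>' l) ` L = L"
    proof
      show "L \<subseteq> (\<lambda>l. l - \<phi>' l) ` L"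
      proof
        fix w assume "w \<in> L"
        then have "- w \<in> ?A ` L" using AL subspace_neg[OF L(1)] by simp
        then obtain l where "l \<in> L" "- w = ?A l" by blast
        then have "w = l - \<phi>' l" by (metis minus_diff_eq minus_minus)
        then show "w \<in> (\<lambda>l. l - \<phi>' l) ` L" using \<open>l \<in> L\<close> by blast
      qed
    qed (use neg in blast)
    ultimately show "bij_betw (\<lambda>l. l - \<phi>' l) L L" by (simp add: bij_betw_def)
  qed
  also have "\<dots> \<longleftrightarrow> \<Theta> ` {n + l | n l. n \<in> ?N \<and> l \<in> L} = \<Theta> ` E"
    using LE by (intro inj_on_image_eq_iff[OF \<Theta>(3), symmetric]) (auto intro: subspace_add[OF E])
  also have "\<Theta> ` {n + l | n l. n \<in> ?N \<and> l \<in> L} = \<Theta> ` ?N + \<Theta> ` L"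
    by (force simp: set_plus_def \<Theta>(1))
  finally show ?thesis unfolding transverse_at_def TL TN TE .
qed

end

section \<open>Assembly over all fixed points\<close>

theorem corollary12p5:
  fixes r :: enat
    and M :: "('a::{t2_space,second_countable_topology}, 'e::euclidean_space) mfd"
    and F :: "('a, 'e) foliation"
    and \<phi> :: "'a \<Rightarrow> 'a"
  assumes "1 \<le> r"
    and "C_manifold r M"
    and "C_foliation r M F"
    and "foliation_map r M F M F \<phi>"
    and "ls_transverse r M F (\<lambda>x. (x, \<phi> x))"
  shows "regular_submanifold r M (Fix M \<phi>) \<and>
         Fix0 M F \<phi> = {x \<in> Fix M \<phi>. transverse_at M F (Fix M \<phi>) x}"
proof -
  have \<phi>: "C_map r M M \<phi>" using assms(4) by (simp add: foliation_map_def)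
  have E: "subspace (model M)" and at: "\<Union> (fst ` atlas M) = points M"
    using assms(2) by (auto simp: C_manifold_def)
  obtain U S where U: "openin (top_of_set (points M)) U"
      "{x \<in> points M. (x, \<phi> x) \<in> Id_on (points M)} \<subseteq> U"
    and S: "good_local_saturation r M F S" "(\<lambda>x. (x, \<phi> x)) ` U \<subseteq> S"
    and trans: "\<forall>x\<in>U. (x, \<phi> x) \<in> Id_on (points M) \<longrightarrow>
        tangent_map M (prod_mfd M M) (\<lambda>x. (x, \<phi> x)) x ` tangent_space M (top_of_set (points M)) x +
          tangent_space (prod_mfd M M) (top_of_set (Id_on (points M))) (x, \<phi> x) =
        tangent_space (prod_mfd M M) (top_of_set S) (x, \<phi> x)"
    using assms(5) unfolding ls_transverse_def Let_def by (elim exE conjE)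
  have lm: "subspace (leaf_model F)" "leaf_model F \<subseteq> model M"
    using assms(3) by (rule C_foliationD)+
  \<comment> \<open>One \<open>K\<close> has to serve at every fixed point, so it is chosen by its
    dimension alone, the codimension of the leaves. The subtraction of natural numbers is not
    truncated because \<open>leaf_model F\<close> lies in \<open>model M\<close>.\<close>
  obtain K where K: "subspace K" "K \<subseteq> model M" "dim K = dim (model M) - dim (leaf_model F)"
    using choose_subspace_of_subspace[of "dim (model M) - dim (leaf_model F)" "model M"] E
    by (metis diff_le_self span_eq_iff)
  have *: "x \<in> \<Union> (fst ` slice_charts r M K (Fix M \<phi>)) \<and>
      (leafwise_simple M F \<phi> x \<longleftrightarrow> transverse_at M F (Fix M \<phi>) x)" if "x \<in> Fix M \<phi>" for x
  proof -
    have x: "x \<in> points M" "\<phi> x = x" using that by (auto simp: Fix_def)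
    then have \<Delta>: "(x, \<phi> x) \<in> Id_on (points M)" by (simp add: Id_on_def)
    then have "x \<in> {x \<in> points M. (x, \<phi> x) \<in> Id_on (points M)}" using x(1) by simp
    with U(2) have xU: "x \<in> U" by (rule subsetD)
    obtain D \<delta> where d: "(D, \<delta>) \<in> atlas M" "x \<in> D" using at x(1) by fastforce
    have "C_on r (model M) (\<delta> \<circ> \<phi> \<circ> inv_into D \<delta>) (\<delta> ` (D \<inter> \<phi> -` D))"
      using \<phi> d(1) by (auto simp: C_map_def)
    then obtain \<phi>' where \<phi>': "(\<delta> \<circ> \<phi> \<circ> inv_into D \<delta> has_derivative \<phi>') (at (\<delta> x) within \<delta> ` (D \<inter> \<phi> -` D))"
      using C_on_has_derivative[OF _ assms(1)] d(2) x(2) by (metis IntI imageI vimageI2)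
    interpret ls_transverse_fixed_point r M F \<phi> U S D \<delta> x \<phi>'
      by standard (use assms \<phi> U S x xU d \<phi>' bspec[OF trans xU] \<Delta> in auto)
    have "dim K + dim L = dim (model M)" using K(3) L(2) dim_subset[OF lm(2)] by simp
    then show ?thesis using fixed_points_slice leafwise_simple_iff_transverse K(1,2) by blast
  qed
  have "is_submanifold r M K (Fix M \<phi>)"
    using K * by (auto simp: is_submanifold_def Fix_def)
  then show ?thesis using * by (auto simp: regular_submanifold_def Fix0_def)
qed

end
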